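(* Let $m,n\geq1$ and $r\geq0$ be integers, let $(K,\partial_1,\dots,\partial_m)$ be a differential field of characteristic zero with $m$ commuting derivations, and let $x=(x_1,\dots,x_n)$ be differential indeterminates. Suppose $S$ is a collection of differential polynomials in $K\{x\}$ of order at most $r$. Then each minimal prime differential ideal $P$ containing $S$ has a characteristic set (with respect to the canonical orderly ranking) whose elements have order at most $C_{r,m}^n$.
   Context: Notation. $\mathbb N=\{0,1,2,\dots\}$, $\mathfrak n=\{1,\dots,n\}$. For $\xi=(u_1,\dots,u_m)\in\mathbb N^m$, $\deg\xi=u_1+\cdots+u_m$ and $\partial^\xi=\partial_1^{u_1}\cdots\partial_m^{u_m}$; $\deg(\xi,i)=\deg\xi$ for $(\xi,i)\in\mathbb N^m\times\mathfrak n$. $K\{x\}$ is the ring of differential polynomials, i.e. the polynomial ring over $K$ in the $\partial^\xi x_i$. The canonical orderly ranking on $\{\partial^\xi x_i\}$ orders $\partial^\xi x_i$ before $\partial^\tau x_j$ iff $(\deg\xi,i,u_1,\dots,u_m)$ is lexicographically (from the left) smaller than $(\deg\tau,j,v_1,\dots,v_m)$, where $\xi=(u_1,\dots,u_m)$, $\tau=(v_1,\dots,v_m)$. Characteristic sets of differential ideals are in the usual sense of Ritt and Kolchin. The number $C_{r,m}^n$. $\Gamma(r)=\{\alpha\in\mathbb N^m\times\mathfrak n:\deg\alpha\leq r\}$. ${\bf k}\in\mathbb N^m$ is the tuple with $1$ in the $k$-th entry and zeros elsewhere. $(\xi,i)\leq(\tau,j)$ iff $i=j$ and $\xi\leq\tau$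 in the product order of $\mathbb N^m$. An antichain sequence of $\mathbb N^m\times\mathfrak n$ is a finite sequence of pairwise $\leq$-incomparable elements. $\mathrm{LUB}(\eta,\tau)$ is the entrywise maximum of $\eta,\tau\in\mathbb N^m$. For an antichain (sequence) $\bar\alpha$, $\gamma(\bar\alpha)=\{(\mathrm{LUB}(\eta,\tau),i):\eta\neq\tau,\ (\eta,i),(\tau,i)\in\bar\alpha\text{ for some }i\}$ and $\Gamma_{\bar\alpha}(p)=\{\alpha\in\bar\alpha:\alpha\in\Gamma(p)\}$. $D_{r,\bar\alpha}$ is the smallest integer $p\geq r$ such that: for every $(\tau,l)\in\gamma(\Gamma_{\bar\alpha}(p))\setminus\Gamma(p)$ and $1\leq i<j\leq m$ such that $(\tau-{\bf i},l)\geq\beta_1$ and $(\tau-{\bf j},l)\geq\beta_2$ for some $\beta_1,\beta_2\in\Gamma_{\bar\alpha}(p)$, there exists a sequence $(\eta_1,l),\dots,(\eta_s,l)$ in $\Gamma_{\bar\alpha}(p)$ and indices $k_1,\dots,k_s\in\{1,\dots,m\}$ with $k_1=i$, $k_s=j$, $\eta_\ell\leq\tau-{\bf k}_\ell$ for all $\ell$ (where ${\bf k}_\ell$ has $1$ in entry $k_\ell$ and zeros elsewhere), and $\deg\mathrm{LUB}(\eta_\ell,\eta_{\ell+1})\leq p$ for $\ell=1,\dots,s-1$. Then $C_{r,m}^n=\max\{D_{r,\bar\alpha}:\bar\alpha\text{ an antichain sequence of }\mathbb N^m\times\mathfrak n\}$ (this maximum is finite). *)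

theory Defs
  imports "HOL-Library.Poly_Mapping" "HOL-Algebra.Algebraic_Closure_Type"
begin

text \<open>
  The \<open>m\<close> derivations and the \<open>n\<close> indeterminates are indexed by arbitrary nonempty finite
  linearly ordered types \<open>'m\<close> and \<open>'n\<close>, which play the roles of \<open>{1,...,m}\<close> and
  \<open>{1,...,n}\<close>. A pair \<open>(\<xi>, i)\<close> is an element of \<open>\<nat>\<^sup>m \<times> {1,...,n}\<close>; it also serves
  as the name of the derivative \<open>\<partial>\<^sup>\<xi> x\<^sub>i\<close>. The product order of \<open>\<nat>\<^sup>m\<close> is the pointwise
  order on functions.
\<close>

type_synonym 'm mindex = "'m \<Rightarrow> nat"
type_synonym ('m, 'n) dvar = "'m mindex \<times> 'n"

definition mdeg :: "'m::finite mindex \<Rightarrow> nat" where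
  "mdeg \<xi> = (\<Sum>k\<in>UNIV. \<xi> k)"

definition munit :: "'m \<Rightarrow> 'm mindex" where
  "munit k = (\<lambda>l. if l = k then 1 else 0)"

definition mlub :: "'m mindex \<Rightarrow> 'm mindex \<Rightarrow> 'm mindex" where
  "mlub \<eta> \<tau> = (\<lambda>k. max (\<eta> k) (\<tau> k))"

definition mshift :: "'m \<Rightarrow> 'm mindex \<Rightarrow> 'm mindex" where
  "mshift k \<xi> = (\<lambda>l. \<xi> l + munit k l)"


section \<open>The number \<open>C\<close>\<close>

definition dvar_le :: "('m, 'n) dvar \<Rightarrow> ('m, 'n) dvar \<Rightarrow> bool" where
  "dvar_le \<alpha> \<beta> \<longleftrightarrow> snd \<alpha> = snd \<beta> \<and> fst \<alpha> \<le> fst \<beta>"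

definition Gam :: "nat \<Rightarrow> ('m::finite, 'n) dvar set" where
  "Gam p = {\<alpha>. mdeg (fst \<alpha>) \<le> p}"

definition antichain_seq :: "('m, 'n) dvar list \<Rightarrow> bool" where
  "antichain_seq as \<longleftrightarrow>
     (\<forall>s < length as. \<forall>t < length as. s \<noteq> t \<longrightarrow> \<not> dvar_le (as ! s) (as ! t))"

definition gam :: "('m, 'n) dvar set \<Rightarrow> ('m, 'n) dvar set" where
  "gam A = {(mlub \<eta> \<tau>, i) | \<eta> \<tau> i. \<eta> \<noteq> \<tau> \<and> (\<eta>, i) \<in> A \<and> (\<tau>, i) \<in> A}"

definition Gam_seq :: "('m::finite, 'n) dvar list \<Rightarrow> nat \<Rightarrow> ('m, 'n) dvar set" where
  "Gam_seq as p = {\<alpha> \<in> set as. \<alpha> \<in> Gam p}"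

text \<open>
  \<open>below_pred \<eta> \<tau> k\<close> says that \<open>\<eta> \<le> \<tau> - k\<close>, where \<open>k\<close> also stands for the \<open>k\<close>-th unit
  tuple. If the \<open>k\<close>-th entry of \<open>\<tau>\<close> is \<open>0\<close>, then \<open>\<tau> - k\<close> has a negative entry and
  lies above no element of \<open>\<nat>\<^sup>m\<close>; the first conjunct prevents truncated subtraction
  from changing this.
\<close>
definition below_pred :: "'m mindex \<Rightarrow> 'm mindex \<Rightarrow> 'm \<Rightarrow> bool" where
  "below_pred \<eta> \<tau> k \<longleftrightarrow> \<tau> k > 0 \<and> \<eta> \<le> (\<lambda>l. \<tau> l - munit k l)"

definition D_condition ::
    "('m::{finite,linorder}, 'n) dvar list \<Rightarrow> nat \<Rightarrow> bool" where
  "D_condition as p \<longleftrightarrow>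
     (\<forall>\<tau> l i j. (\<tau>, l) \<in> gam (Gam_seq as p) - Gam p \<and> i < j \<and>
        (\<exists>\<beta>. (\<beta>, l) \<in> Gam_seq as p \<and> below_pred \<beta> \<tau> i) \<and>
        (\<exists>\<beta>. (\<beta>, l) \<in> Gam_seq as p \<and> below_pred \<beta> \<tau> j) \<longrightarrow>
        (\<exists>\<eta>s ks. \<eta>s \<noteq> [] \<and> length ks = length \<eta>s \<and> hd ks = i \<and> last ks = j \<and>
           (\<forall>t < length \<eta>s. (\<eta>s ! t, l) \<in> Gam_seq as p \<and> below_pred (\<eta>s ! t) \<tau> (ks ! t)) \<and>
           (\<forall>t. Suc t < length \<eta>s \<longrightarrow> mdeg (mlub (\<eta>s ! t) (\<eta>s ! Suc t)) \<le> p)))"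

text \<open>
  The condition holds vacuously for all large \<open>p\<close>, since \<open>gam (set as)\<close> is finite;
  so the least \<open>p\<close> below exists for every \<open>as\<close>.
\<close>
definition D_num :: "nat \<Rightarrow> ('m::{finite,linorder}, 'n) dvar list \<Rightarrow> nat" where
  "D_num r as = (LEAST p. r \<le> p \<and> D_condition as p)"

definition C_num :: "'m::{finite,linorder} itself \<Rightarrow> 'n::{finite,linorder} itself \<Rightarrow> nat \<Rightarrow> nat" where
  "C_num _ _ r = Max {D_num r as | as :: ('m, 'n) dvar list. antichain_seq as}"


section \<open>Differential fields and differential polynomials\<close>

definition is_derivation :: "('a::comm_ring_1 \<Rightarrow> 'a) \<Rightarrow> bool" where
  "is_derivation d \<longleftrightarrow>
     (\<forall>a b. d (a + b) = d a + d b) \<and> (\<forall>a b. d (a * b) = d a * b + a * d b)"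

definition differential_field :: "('m \<Rightarrow> 'k::field \<Rightarrow> 'k) \<Rightarrow> bool" where
  "differential_field \<delta> \<longleftrightarrow>
     (\<forall>k. is_derivation (\<delta> k)) \<and> (\<forall>k l a. \<delta> k (\<delta> l a) = \<delta> l (\<delta> k a))"

text \<open>Monomials are finitely supported exponent functions on the derivatives \<open>\<partial>\<^sup>\<xi> x\<^sub>i\<close>.\<close>

type_synonym ('m, 'n) dmonom = "('m, 'n) dvar \<Rightarrow>\<^sub>0 nat"
type_synonym ('k, 'm, 'n) dpoly = "('m, 'n) dmonom \<Rightarrow>\<^sub>0 'k"

definition dconst :: "'k::comm_ring_1 \<Rightarrow> ('k, 'm, 'n) dpoly" where
  "dconst c = Poly_Mapping.single 0 c"

definition dvar_poly :: "('m, 'n) dvar \<Rightarrow> ('k::comm_ring_1, 'm, 'n) dpoly" where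
  "dvar_poly v = Poly_Mapping.single (Poly_Mapping.single v 1) 1"

text \<open>
  \<open>ddiff \<delta> k\<close> is the extension of the \<open>k\<close>-th derivation \<open>\<delta> k\<close> of the coefficient field to
  differential polynomials. A term \<open>c * M\<close> is sent to
  \<open>\<delta> k c * M\<close> plus the sum over the derivatives \<open>v\<close> in \<open>M\<close>, of exponent \<open>e\<close>, of
  \<open>e * c * (M / v) * \<partial>\<^sub>k v\<close>; it is characterised by the lemmas that follow.
\<close>
definition ddiff_term ::
    "('m \<Rightarrow> 'k::comm_ring_1 \<Rightarrow> 'k) \<Rightarrow> 'm \<Rightarrow> ('m, 'n) dmonom \<Rightarrow> 'k \<Rightarrow> ('k, 'm, 'n) dpoly" where
  "ddiff_term \<delta> k M c =
     Poly_Mapping.single M (\<delta> k c) +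
     (\<Sum>v\<in>Poly_Mapping.keys M.
        Poly_Mapping.single
          (M - Poly_Mapping.single v 1 + Poly_Mapping.single (mshift k (fst v), snd v) 1)
          (of_nat (Poly_Mapping.lookup M v) * c))"

definition ddiff ::
    "('m \<Rightarrow> 'k::comm_ring_1 \<Rightarrow> 'k) \<Rightarrow> 'm \<Rightarrow> ('k, 'm, 'n) dpoly \<Rightarrow> ('k, 'm, 'n) dpoly" where
  "ddiff \<delta> k f = (\<Sum>M\<in>Poly_Mapping.keys f. ddiff_term \<delta> k M (Poly_Mapping.lookup f M))"

lemma is_derivation_0: "is_derivation d \<Longrightarrow> d 0 = 0"
  unfolding is_derivation_def by (metis add_cancel_left_left add_0)

lemma is_derivation_1: "is_derivation d \<Longrightarrow> d 1 = 0"
  unfolding is_derivation_def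
  by (metis add_cancel_right_left mult.right_neutral mult_1)

lemma ddiff_term_0: "is_derivation (\<delta> k) \<Longrightarrow> ddiff_term \<delta> k M 0 = 0"
  by (simp add: ddiff_term_def is_derivation_0)

lemma ddiff_term_add:
  "is_derivation (\<delta> k) \<Longrightarrow> ddiff_term \<delta> k M (a + b) = ddiff_term \<delta> k M a + ddiff_term \<delta> k M b"
  by (simp add: ddiff_term_def is_derivation_def single_add distrib_left sum.distrib)

lemma ddiff_superset:
  assumes "is_derivation (\<delta> k)" "finite A" "Poly_Mapping.keys f \<subseteq> A"
  shows "ddiff \<delta> k f = (\<Sum>M\<in>A. ddiff_term \<delta> k M (Poly_Mapping.lookup f M))"
  unfolding ddiff_def
  by (rule sum.mono_neutral_left) (use assms in \<open>auto simp: in_keys_iff ddiff_term_0\<close>)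

lemma ddiff_single:
  assumes "is_derivation (\<delta> k)"
  shows "ddiff \<delta> k (Poly_Mapping.single M c) = ddiff_term \<delta> k M c"
  by (subst ddiff_superset[where A = "{M}"]) (use assms in auto)

lemma ddiff_add:
  assumes "is_derivation (\<delta> k)"
  shows "ddiff \<delta> k (f + g) = ddiff \<delta> k f + ddiff \<delta> k g"
proof -
  let ?A = "Poly_Mapping.keys f \<union> Poly_Mapping.keys g"
  have "ddiff \<delta> k h = (\<Sum>M\<in>?A. ddiff_term \<delta> k M (Poly_Mapping.lookup h M))"
    if "Poly_Mapping.keys h \<subseteq> ?A" for h
    by (rule ddiff_superset) (use assms that in auto)
  then show ?thesis
    using Poly_Mapping.keys_add[of f g]
    by (simp add: lookup_add ddiff_term_add assms sum.distrib)
qed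

lemma ddiff_dconst: "is_derivation (\<delta> k) \<Longrightarrow> ddiff \<delta> k (dconst c) = dconst (\<delta> k c)"
  by (simp add: dconst_def ddiff_single ddiff_term_def)

lemma ddiff_dvar_poly:
  "is_derivation (\<delta> k) \<Longrightarrow> ddiff \<delta> k (dvar_poly (\<xi>, i)) = dvar_poly (mshift k \<xi>, i)"
  by (simp add: dvar_poly_def ddiff_single ddiff_term_def is_derivation_1)

lemma ddiff_term_superset:
  assumes "finite A" "Poly_Mapping.keys M \<subseteq> A"
  shows "ddiff_term \<delta> k M c = Poly_Mapping.single M (\<delta> k c) +
     (\<Sum>v\<in>A. Poly_Mapping.single
          (M - Poly_Mapping.single v 1 + Poly_Mapping.single (mshift k (fst v), snd v) 1)
          (of_nat (Poly_Mapping.lookup M v) * c))"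
  unfolding ddiff_term_def
  by (rule arg_cong[where f = "(+) _"], rule sum.mono_neutral_left)
     (use assms in \<open>auto simp: in_keys_iff\<close>)

lemma ddiff_term_mult:
  fixes \<delta> :: "'m \<Rightarrow> 'k::comm_ring_1 \<Rightarrow> 'k" and M N :: "('m, 'n) dmonom"
  assumes "is_derivation (\<delta> k)"
  shows "ddiff_term \<delta> k (M + N) (a * b) =
    ddiff_term \<delta> k M a * Poly_Mapping.single N b + Poly_Mapping.single M a * ddiff_term \<delta> k N b"
proof -
  let ?A = "Poly_Mapping.keys M \<union> Poly_Mapping.keys N"
  let ?s = "\<lambda>v::('m, 'n) dvar. Poly_Mapping.single v (1::nat)"
  let ?t = "\<lambda>v::('m, 'n) dvar. Poly_Mapping.single (mshift k (fst v), snd v) (1::nat)"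
  have shift: "(U - ?s v + ?t v) + V = U + V - ?s v + ?t v"
    if "Poly_Mapping.lookup U v \<noteq> 0" for U V :: "('m, 'n) dmonom" and v
    by (rule poly_mapping_eqI)
       (use that in \<open>auto simp: lookup_add lookup_minus lookup_single when_def\<close>)
  have term_left: "Poly_Mapping.single (U - ?s v + ?t v) (of_nat (Poly_Mapping.lookup U v) * c)
        * Poly_Mapping.single V d =
      Poly_Mapping.single (U + V - ?s v + ?t v) (of_nat (Poly_Mapping.lookup U v) * (c * d))"
    for U V :: "('m, 'n) dmonom" and v and c d :: 'k
    by (cases "Poly_Mapping.lookup U v = 0")
       (simp_all add: Poly_Mapping.mult_single shift[simplified] mult.assoc)
  have fin: "finite ?A" and keysM: "Poly_Mapping.keys M \<subseteq> ?A" and keysN: "Poly_Mapping.keys N \<subseteq> ?A"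
    by auto
  have keys: "Poly_Mapping.keys (M + N) \<subseteq> ?A"
    by (rule Poly_Mapping.keys_add)
  have M: "ddiff_term \<delta> k M a * Poly_Mapping.single N b =
      Poly_Mapping.single (M + N) (\<delta> k a * b) +
      (\<Sum>v\<in>?A. Poly_Mapping.single (M + N - ?s v + ?t v)
         (of_nat (Poly_Mapping.lookup M v) * (a * b)))"
    unfolding ddiff_term_superset[OF fin keysM] distrib_right sum_distrib_right term_left
    by (simp add: Poly_Mapping.mult_single)
  have N: "ddiff_term \<delta> k N b * Poly_Mapping.single M a =
      Poly_Mapping.single (M + N) (\<delta> k b * a) +
      (\<Sum>v\<in>?A. Poly_Mapping.single (M + N - ?s v + ?t v)
         (of_nat (Poly_Mapping.lookup N v) * (a * b)))"
    unfolding ddiff_term_superset[OF fin keysN] distrib_right sum_distrib_right term_left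
    by (simp add: Poly_Mapping.mult_single add.commute[of N M] mult.commute[of b a])
  have "ddiff_term \<delta> k (M + N) (a * b) =
      Poly_Mapping.single (M + N) (\<delta> k a * b + a * \<delta> k b) +
      (\<Sum>v\<in>?A. Poly_Mapping.single (M + N - ?s v + ?t v)
         (of_nat (Poly_Mapping.lookup M v) * (a * b) + of_nat (Poly_Mapping.lookup N v) * (a * b)))"
    by (subst ddiff_term_superset[OF _ keys])
       (use assms in \<open>auto simp: is_derivation_def lookup_add distrib_right\<close>)
  also have "\<dots> = ddiff_term \<delta> k M a * Poly_Mapping.single N b +
      ddiff_term \<delta> k N b * Poly_Mapping.single M a"
    unfolding M N by (simp add: single_add sum.distrib mult.commute add_ac)
  finally show ?thesis
    by (simp add: mult.commute)
qed

lemma dpoly_induct [case_names zero single sum]: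
  fixes f :: "'a \<Rightarrow>\<^sub>0 'b::ab_group_add"
  assumes "P 0" "\<And>M a. P (Poly_Mapping.single M a)" "\<And>f g. P f \<Longrightarrow> P g \<Longrightarrow> P (f + g)"
  shows "P f"
proof (induction f rule: Poly_Mapping.update_induct)
  case const
  show ?case by (rule assms(1))
next
  case (update f M b)
  have "Poly_Mapping.update M b f = f + Poly_Mapping.single M b"
    using update(1)
    by (intro poly_mapping_eqI) (auto simp: lookup_update lookup_add lookup_single in_keys_iff when_def)
  with update(3) assms(2,3) show ?case by simp
qed

lemma ddiff_mult:
  assumes d: "is_derivation (\<delta> k)"
  shows "ddiff \<delta> k (f * g) = ddiff \<delta> k f * g + f * ddiff \<delta> k g"
proof -
  have ddiff_zero: "ddiff \<delta> k 0 = 0"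
    by (simp add: ddiff_def)
  have single_mult: "ddiff \<delta> k (Poly_Mapping.single M a * g) =
      ddiff \<delta> k (Poly_Mapping.single M a) * g + Poly_Mapping.single M a * ddiff \<delta> k g" for M a g
  proof (induction g rule: dpoly_induct)
    case zero
    show ?case by (simp add: ddiff_zero)
  next
    case (single N b)
    then show ?case
      by (simp add: Poly_Mapping.mult_single ddiff_single d ddiff_term_mult)
  next
    case (sum g1 g2)
    then show ?case
      by (simp add: distrib_left ddiff_add d add_ac)
  qed
  show ?thesis
  proof (induction f rule: dpoly_induct)
    case zero
    show ?case by (simp add: ddiff_zero)
  next
    case (single M a)
    show ?case by (rule single_mult)
  next
    case (sum f1 f2)
    then show ?case
      by (simp add: distrib_right ddiff_add d add_ac)
  qed
qed

lemma is_derivation_ddiff: "is_derivation (\<delta> k) \<Longrightarrow> is_derivation (ddiff \<delta> k)"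
  unfolding is_derivation_def[of "ddiff \<delta> k"] by (simp add: ddiff_add ddiff_mult)

text \<open>The derivatives that occur in a differential polynomial, and its order (\<open>0\<close> if none occurs).\<close>

definition dvars :: "('k::zero, 'm, 'n) dpoly \<Rightarrow> ('m, 'n) dvar set" where
  "dvars f = (\<Union>M\<in>Poly_Mapping.keys f. Poly_Mapping.keys M)"

definition dorder :: "('k::zero, 'm::finite, 'n) dpoly \<Rightarrow> nat" where
  "dorder f = Max (insert 0 ((\<lambda>v. mdeg (fst v)) ` dvars f))"

definition degree_in :: "('k::zero, 'm, 'n) dpoly \<Rightarrow> ('m, 'n) dvar \<Rightarrow> nat" where
  "degree_in f v = Max (insert 0 ((\<lambda>M. Poly_Mapping.lookup M v) ` Poly_Mapping.keys f))"


section \<open>Prime differential ideals\<close>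

definition prime_differential_ideal ::
    "('m \<Rightarrow> 'k::field \<Rightarrow> 'k) \<Rightarrow> ('k, 'm, 'n) dpoly set \<Rightarrow> bool" where
  "prime_differential_ideal \<delta> P \<longleftrightarrow>
     primeideal P ring_of_type_algebra \<and> (\<forall>k. \<forall>f\<in>P. ddiff \<delta> k f \<in> P)"

definition minimal_prime_differential_ideal ::
    "('m \<Rightarrow> 'k::field \<Rightarrow> 'k) \<Rightarrow> ('k, 'm, 'n) dpoly set \<Rightarrow> ('k, 'm, 'n) dpoly set \<Rightarrow> bool" where
  "minimal_prime_differential_ideal \<delta> S P \<longleftrightarrow>
     prime_differential_ideal \<delta> P \<and> S \<subseteq> P \<and>
     (\<forall>Q. prime_differential_ideal \<delta> Q \<and> S \<subseteq> Q \<and> Q \<subseteq> P \<longrightarrow> Q = P)"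


section \<open>Characteristic sets for the canonical orderly ranking\<close>

fun ranking_less ::
    "('m::{finite,linorder}, 'n::linorder) dvar \<Rightarrow> ('m, 'n) dvar \<Rightarrow> bool" where
  "ranking_less (\<xi>, i) (\<tau>, j) \<longleftrightarrow>
     mdeg \<xi> < mdeg \<tau> \<or>
     mdeg \<xi> = mdeg \<tau> \<and>
       (i < j \<or> i = j \<and> (\<exists>k. \<xi> k < \<tau> k \<and> (\<forall>l<k. \<xi> l = \<tau> l)))"

text \<open>The leader is only meaningful for polynomials outside the coefficient field.\<close>

definition leader ::
    "('k::zero, 'm::{finite,linorder}, 'n::linorder) dpoly \<Rightarrow> ('m, 'n) dvar" where
  "leader f = (THE v. v \<in> dvars f \<and> (\<forall>w\<in>dvars f. w \<noteq> v \<longrightarrow> ranking_less w v))"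

definition proper_derivative :: "('m, 'n) dvar \<Rightarrow> ('m, 'n) dvar \<Rightarrow> bool" where
  "proper_derivative w v \<longleftrightarrow> dvar_le v w \<and> w \<noteq> v"

definition reduced_wrt ::
    "('k::zero, 'm::{finite,linorder}, 'n::linorder) dpoly \<Rightarrow> ('k, 'm, 'n) dpoly \<Rightarrow> bool" where
  "reduced_wrt f g \<longleftrightarrow>
     (\<forall>w\<in>dvars f. \<not> proper_derivative w (leader g)) \<and>
     degree_in f (leader g) < degree_in g (leader g)"

definition autoreduced ::
    "('k::zero, 'm::{finite,linorder}, 'n::linorder) dpoly set \<Rightarrow> bool" where
  "autoreduced A \<longleftrightarrow>
     (\<forall>f\<in>A. dvars f \<noteq> {}) \<and> (\<forall>f\<in>A. \<forall>g\<in>A. f \<noteq> g \<longrightarrow> reduced_wrt f g)"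

definition lower_rank ::
    "('k::zero, 'm::{finite,linorder}, 'n::linorder) dpoly \<Rightarrow> ('k, 'm, 'n) dpoly \<Rightarrow> bool" where
  "lower_rank f g \<longleftrightarrow>
     ranking_less (leader f) (leader g) \<or>
     leader f = leader g \<and> degree_in f (leader f) < degree_in g (leader g)"

definition same_rank ::
    "('k::zero, 'm::{finite,linorder}, 'n::linorder) dpoly \<Rightarrow> ('k, 'm, 'n) dpoly \<Rightarrow> bool" where
  "same_rank f g \<longleftrightarrow>
     leader f = leader g \<and> degree_in f (leader f) = degree_in g (leader g)"

definition lower_rank_list ::
    "('k::zero, 'm::{finite,linorder}, 'n::linorder) dpoly list \<Rightarrow> ('k, 'm, 'n) dpoly list \<Rightarrow> bool" where
  "lower_rank_list fs gs \<longleftrightarrow>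
     (\<exists>t < min (length fs) (length gs).
        (\<forall>s<t. same_rank (fs ! s) (gs ! s)) \<and> lower_rank (fs ! t) (gs ! t)) \<or>
     length gs < length fs \<and> (\<forall>s < length gs. same_rank (fs ! s) (gs ! s))"

text \<open>
  Autoreduced sets are always finite, and their elements have distinct leaders; they are
  compared by listing their elements in increasing rank.
\<close>
definition lower_rank_set ::
    "('k::zero, 'm::{finite,linorder}, 'n::linorder) dpoly set \<Rightarrow> ('k, 'm, 'n) dpoly set \<Rightarrow> bool" where
  "lower_rank_set A B \<longleftrightarrow>
     (\<exists>fs gs. set fs = A \<and> sorted_wrt lower_rank fs \<and>
              set gs = B \<and> sorted_wrt lower_rank gs \<and> lower_rank_list fs gs)"

definition characteristic_set ::
    "('k::zero, 'm::{finite,linorder}, 'n::linorder) dpoly set \<Rightarrow> ('k, 'm, 'n) dpoly set \<Rightarrow> bool" where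
  "characteristic_set P A \<longleftrightarrow>
     autoreduced A \<and> A \<subseteq> P \<and>
     (\<forall>B. autoreduced B \<and> B \<subseteq> P \<longrightarrow> \<not> lower_rank_set B A)"

end

theory Submission
  imports Defs "HOL-Computational_Algebra.Polynomial"
begin

text \<open>
  Let \<open>Lmin\<close> be the antichain of minimal leaders of \<open>P\<close>, that is, of the minimal derivatives that are
  algebraic, modulo \<open>P\<close>, over the derivatives of lower rank, and let \<open>p\<close> be the number \<open>D\<close> of this
  antichain. Choose for each minimal leader an element of \<open>P\<close> of least degree in it. The elements of
  \<open>P\<close> of order at most \<open>p\<close>, together with all derivatives of those chosen elements whose leader has
  degree at most \<open>p\<close>, generate an ideal; let \<open>Q\<close> be the set of all \<open>f\<close> such that \<open>h * f\<close> lies in it for some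
  \<open>h\<close> of order at most \<open>p\<close> outside \<open>P\<close>.

  The chains in the definition of \<open>D\<close> make the chosen elements coherent: two derivatives with the
  same leader \<open>v\<close> of degree above \<open>p\<close> agree, after cross-multiplication by the separants, modulo
  generators of lower rank. As in Rosenfeld's lemma, \<open>v\<close> can then be eliminated, and \<open>Q\<close> is a prime
  differential ideal with \<open>S \<subseteq> Q \<subseteq> P\<close>; hence \<open>Q = P\<close> by minimality. But
  a derivative of degree above \<open>p\<close> that is not above a minimal leader of degree at most \<open>p\<close> is
  algebraically independent modulo \<open>Q\<close>, so all minimal leaders have degree at most \<open>p\<close>. Reducing the
  chosen elements with respect to each other gives a characteristic set with exactly these leaders,
  and the ranking is orderly.
\<close>

section \<open>The ranking of derivatives\<close>

text \<open>Two obstacles shape the argument. Coherence helps only if the difference of two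
  derivatives is expressed through generators ranked strictly lower; so the ideal is filtered by
  rank into stages \<open>J n\<close>, and elimination lowers the stage one derivative at a time.
  Moreover, differentiation does not respect truncation: an element of \<open>P\<close> of order
  \<open>p\<close> has derivatives of order \<open>p + 1\<close>, which are no longer low-order
  elements. That these derivatives are generated nevertheless has to be proved
  (\<open>ddiff_Pp\<close>), by pseudo-divisions whose initials the saturation makes invertible.
  Characteristic zero enters through the separants, which must be outside \<open>P\<close>. Since
  the antichain is determined by the unknown leaders of \<open>P\<close>, the final bound is a
  maximum over all antichains, and the finiteness of that maximum is itself a step of the
  proof.\<close>

definition dshift :: "'m \<Rightarrow> ('m, 'n) dvar \<Rightarrow> ('m, 'n) dvar" where
  "dshift k v = (mshift k (fst v), snd v)"

lemma mdeg_mshift [simp]: "mdeg (mshift k \<xi>) = Suc (mdeg \<xi>)"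
  by (simp add: mdeg_def mshift_def munit_def sum.distrib)

lemma mdeg_dshift [simp]: "mdeg (fst (dshift k v)) = Suc (mdeg (fst v))"
  by (simp add: dshift_def)

lemma mdeg_mono: "\<xi> \<le> \<tau> \<Longrightarrow> mdeg \<xi> \<le> mdeg \<tau>"
  by (simp add: mdeg_def le_fun_def sum_mono)

lemma mdeg_strict_mono:
  assumes "\<xi> \<le> \<tau>" "\<xi> \<noteq> \<tau>"
  shows "mdeg \<xi> < mdeg \<tau>"
proof -
  obtain k where "\<xi> k \<noteq> \<tau> k" using assms(2) by auto
  with assms(1) have "\<xi> k < \<tau> k" by (simp add: le_fun_def order_le_neq_trans)
  with assms(1) show ?thesis
    unfolding mdeg_def by (intro sum_strict_mono_ex1) (auto simp: le_fun_def)
qed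

lemma finite_Gam: "finite (Gam p :: ('m::finite, 'n::finite) dvar set)"
proof -
  have "(Gam p :: ('m, 'n) dvar set) \<subseteq> (PiE UNIV (\<lambda>_. {..p})) \<times> (UNIV :: 'n set)"
  proof
    fix v :: "('m, 'n) dvar" assume v: "v \<in> Gam p"
    have "fst v k \<le> mdeg (fst v)" for k
      unfolding mdeg_def by (rule member_le_sum) auto
    with v have "fst v k \<le> p" for k
      unfolding Gam_def using order_trans by blast
    then show "v \<in> (PiE UNIV (\<lambda>_. {..p})) \<times> UNIV" by (cases v) auto
  qed
  then show ?thesis
    by (rule finite_subset) (intro finite_cartesian_product finite_PiE, auto)
qed

lemma ranking_less_irrefl [simp]: "\<not> ranking_less v v"
  by (cases v) auto

lemma ranking_less_mdeg: "ranking_less v w \<Longrightarrow> mdeg (fst v) \<le> mdeg (fst w)"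
  by (cases v; cases w) auto

lemma ranking_less_if_mdeg_less: "mdeg (fst v) < mdeg (fst w) \<Longrightarrow> ranking_less v w"
  by (cases v; cases w) auto

lemma ranking_less_trans:
  assumes "ranking_less u v" "ranking_less v w"
  shows "ranking_less u w"
proof -
  obtain \<xi> i \<tau> j \<sigma> l where uvw: "u = (\<xi>, i)" "v = (\<tau>, j)" "w = (\<sigma>, l)"
    by (cases u; cases v; cases w)
  have "\<exists>k. \<xi> k < \<sigma> k \<and> (\<forall>l<k. \<xi> l = \<sigma> l)"
    if "\<xi> k < \<tau> k" "\<forall>l<k. \<xi> l = \<tau> l" "\<tau> k' < \<sigma> k'" "\<forall>l<k'. \<tau> l = \<sigma> l" for k k'
    \<comment> \<open>Two lexicographic comparisons compose at the smaller of their deciding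
      positions.\<close>
    using that by (intro exI[of _ "min k k'"]) (auto simp: min_def, metis order_le_less less_trans)
  with assms uvw show ?thesis by auto
qed

lemma ranking_less_total:
  assumes "v \<noteq> w"
  shows "ranking_less v w \<or> ranking_less w v"
proof -
  obtain \<xi> i \<tau> j where vw: "v = (\<xi>, i)" "w = (\<tau>, j)"
    by (cases v; cases w)
  have "(\<exists>k. \<xi> k < \<tau> k \<and> (\<forall>l<k. \<xi> l = \<tau> l)) \<or> (\<exists>k. \<tau> k < \<xi> k \<and> (\<forall>l<k. \<tau> l = \<xi> l))"
    if "\<xi> \<noteq> \<tau>"
  proof -
    let ?K = "{k. \<xi> k \<noteq> \<tau> k}"
    from that have ne: "?K \<noteq> {}" by auto
    have "Min ?K \<in> ?K" by (rule Min_in) (use ne in auto)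
    moreover have "\<xi> l = \<tau> l" if "l < Min ?K" for l
      using that Min_le[of ?K l] by (metis (mono_tags) finite leD mem_Collect_eq)
    ultimately show ?thesis
      by (metis (mono_tags) linorder_less_linear mem_Collect_eq)
  qed
  then show ?thesis
    using assms unfolding vw by (auto simp: neq_iff) 
qed

lemma ranking_less_asym: "ranking_less v w \<Longrightarrow> \<not> ranking_less w v"
  using ranking_less_trans ranking_less_irrefl by blast

lemma ranking_less_dshift: "ranking_less v (dshift k v)"
  by (rule ranking_less_if_mdeg_less) simp

lemma ranking_less_dshift_mono:
  assumes "ranking_less v w"
  shows "ranking_less (dshift k v) (dshift k w)"
proof -
  obtain \<xi> i \<tau> j where vw: "v = (\<xi>, i)" "w = (\<tau>, j)" by (cases v; cases w)
  have "mshift k \<xi> l < mshift k \<tau> l \<longleftrightarrow> \<xi> l < \<tau> l" "mshift k \<xi> l = mshift k \<tau> l \<longleftrightarrow> \<xi> l = \<tau> l" for l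
    by (simp_all add: mshift_def)
  then show ?thesis using assms unfolding vw dshift_def by simp
qed

text \<open>
  The ranking is orderly, so its order type is that of the natural numbers; inductions along the
  ranking become inductions on the position \<open>idx v\<close>.
\<close>
definition idx :: "('m::{finite,linorder}, 'n::{finite,linorder}) dvar \<Rightarrow> nat" where
  "idx v = card {w. ranking_less w v}"

lemma finite_ranking_less:
  "finite {w. ranking_less w (v :: ('m::{finite,linorder}, 'n::{finite,linorder}) dvar)}"
  by (rule finite_subset[OF _ finite_Gam[of "mdeg (fst v)"]])
     (auto simp: Gam_def dest: ranking_less_mdeg)

lemma idx_strict_mono: "ranking_less v w \<Longrightarrow> idx v < idx w"
  unfolding idx_def
  by (rule psubset_card_mono[OF finite_ranking_less])
     (use ranking_less_trans ranking_less_irrefl in blast)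

lemma idx_less_iff: "idx v < idx w \<longleftrightarrow> ranking_less v w"
  using idx_strict_mono ranking_less_total by (metis less_asym less_irrefl)

lemma idx_inj: "idx v = idx w \<longleftrightarrow> v = w"
  using idx_strict_mono ranking_less_total by (metis less_irrefl)

lemma idx_dshift: "idx v < idx (dshift k v)"
  by (simp add: idx_less_iff ranking_less_dshift)

lemma idx_dshift_mono:
  fixes v w :: "('m::{finite,linorder}, 'n::{finite,linorder}) dvar"
  shows "idx v < idx w \<Longrightarrow> idx (dshift k v) < idx (dshift k w)"
  by (simp add: idx_less_iff ranking_less_dshift_mono)

lemma idx_less_if_mdeg_less:
  fixes v w :: "('m::{finite,linorder}, 'n::{finite,linorder}) dvar"
  shows "mdeg (fst v) < mdeg (fst w) \<Longrightarrow> idx v < idx w"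
  by (simp add: idx_less_iff ranking_less_if_mdeg_less)

lemma mdeg_le_if_idx_le:
  fixes v w :: "('m::{finite,linorder}, 'n::{finite,linorder}) dvar"
  shows "idx v \<le> idx w \<Longrightarrow> mdeg (fst v) \<le> mdeg (fst w)"
  using idx_less_if_mdeg_less[of w v] by (meson leD leI)

text \<open>The predecessors of \<open>v\<close> have \<open>idx v\<close> distinct positions, all
  less than \<open>idx v\<close>, so no position is skipped; shifting makes positions unbounded.
  Inductions over \<open>n\<close> use this to name the derivative at position
  \<open>n\<close>.\<close>

lemma ex_idx:
  "\<exists>v :: ('m::{finite,linorder}, 'n::{finite,linorder}) dvar. idx v = n"
proof -
  have down: "\<exists>w :: ('m, 'n) dvar. idx w = j" if "j < idx v" for v :: "('m, 'n) dvar" and j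
  proof -
    have "idx ` {w :: ('m, 'n) dvar. ranking_less w v} = {..<idx v}"
    proof (rule card_subset_eq)
      show "idx ` {w. ranking_less w v} \<subseteq> {..<idx v}" by (auto simp: idx_strict_mono)
      have "inj_on idx {w. ranking_less w v}" by (auto simp: inj_on_def idx_inj)
      then show "card (idx ` {w. ranking_less w v}) = card {..<idx v}"
        by (simp add: card_image) (simp add: idx_def)
    qed simp
    with that have "j \<in> idx ` {w. ranking_less w v}" by simp
    then show ?thesis by blast
  qed
  have "\<exists>v :: ('m, 'n) dvar. n \<le> idx v"
  proof (induction n)
    case (Suc n)
    then obtain v :: "('m, 'n) dvar" where "n \<le> idx v" by blast
    then show ?case using idx_dshift[of v undefined] by (meson Suc_leI le_less_trans)
  qed simp
  then show ?thesis using down by (metis order_le_less)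
qed

lemma dvar_le_refl [simp]: "dvar_le v v"
  by (simp add: dvar_le_def)

lemma dvar_le_trans: "dvar_le u v \<Longrightarrow> dvar_le v w \<Longrightarrow> dvar_le u w"
  unfolding dvar_le_def using order_trans by metis

lemma dvar_le_dshift: "dvar_le v (dshift k v)"
  by (simp add: dvar_le_def dshift_def mshift_def le_fun_def)

lemma dvar_le_mdeg: "dvar_le v w \<Longrightarrow> mdeg (fst v) \<le> mdeg (fst w)"
  by (simp add: dvar_le_def mdeg_mono)

lemma dvar_le_idx: "dvar_le v w \<Longrightarrow> idx v \<le> idx w"
proof (cases "v = w")
  case False
  assume "dvar_le v w"
  with False have "mdeg (fst v) < mdeg (fst w)"
    by (intro mdeg_strict_mono) (auto simp: dvar_le_def prod_eq_iff)
  then show ?thesis using idx_less_if_mdeg_less less_imp_le by blast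
qed simp

text \<open>An entry in which \<open>v\<close> exceeds \<open>u\<close> can be lowered by one.
  Peeling off one derivation in this way carries the inductions along
  \<open>dvar_le\<close>.\<close>

lemma dvar_le_dshiftE:
  assumes "dvar_le u v" "u \<noteq> v"
  obtains k w where "v = dshift k w" "dvar_le u w"
proof -
  have le: "fst u \<le> fst v" and eq: "snd u = snd v" and "fst u \<noteq> fst v"
    using assms by (auto simp: dvar_le_def prod_eq_iff)
  then obtain k where "fst u k \<noteq> fst v k" by auto
  with le have k: "fst u k < fst v k" by (simp add: le_fun_def order_le_neq_trans)
  define w where "w = ((fst v)(k := fst v k - 1), snd v)"
  have "v = dshift k w"
    using k by (auto simp: w_def dshift_def mshift_def munit_def prod_eq_iff fun_eq_iff)
  moreover have "dvar_le u w"
    using le eq k by (auto simp: dvar_le_def w_def le_fun_def)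
  ultimately show thesis by (rule that)
qed

section \<open>Antichains\<close>

text \<open>The subsequence runs through the positions whose value is at most all later values;
  beyond any \<open>k\<close> there is one, where the tail attains its minimum.\<close>

lemma nat_seq_mono_subseq:
  fixes f :: "nat \<Rightarrow> nat"
  shows "\<exists>g :: nat \<Rightarrow> nat. strict_mono g \<and> mono (f \<circ> g)"
proof -
  let ?N = "{n. \<forall>m\<ge>n. f n \<le> f m}"
  have "\<exists>n\<ge>k. n \<in> ?N" for k
  proof -
    let ?a = "LEAST a. \<exists>n\<ge>k. f n = a"
    have "\<exists>n\<ge>k. f n = ?a" by (rule LeastI[of _ "f k"]) auto
    then obtain n where n: "n \<ge> k" "f n = ?a" by blast
    have "?a \<le> f m" if "m \<ge> n" for m
      by (rule Least_le) (use that n in \<open>auto intro: order_trans\<close>)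
    with n show ?thesis by auto
  qed
  then have inf: "infinite ?N" by (metis (lifting) infinite_nat_iff_unbounded_le)
  have mem: "enumerate ?N i \<in> ?N" for i
    by (rule enumerate_in_set[OF inf])
  have sm: "strict_mono (enumerate ?N)"
    by (rule strict_mono_enumerate[OF inf])
  have "mono (f \<circ> enumerate ?N)"
  proof (rule monoI)
    fix i j :: nat assume "i \<le> j"
    with sm have "enumerate ?N i \<le> enumerate ?N j" by (simp add: strict_mono_less_eq)
    with mem[of i] show "(f \<circ> enumerate ?N) i \<le> (f \<circ> enumerate ?N) j" by simp
  qed
  with sm show ?thesis by blast
qed

text \<open>Dickson's lemma for sequences: the entries are treated one after another, and passing to
  a further subsequence keeps the earlier entries monotone.\<close>

lemma fun_seq_mono_subseq:
  fixes f :: "nat \<Rightarrow> 'm::finite \<Rightarrow> nat"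
  shows "\<exists>g :: nat \<Rightarrow> nat. strict_mono g \<and> mono (f \<circ> g)"
proof -
  have "\<exists>g :: nat \<Rightarrow> nat. strict_mono g \<and> (\<forall>k\<in>K. mono (\<lambda>n. f (g n) k))" if "finite K" for K
    using that
  proof (induction K)
    case empty
    show ?case by (rule exI[of _ id]) (auto simp: strict_mono_def)
  next
    case (insert k K)
    then obtain g :: "nat \<Rightarrow> nat" where g: "strict_mono g" "\<forall>k\<in>K. mono (\<lambda>n. f (g n) k)" by blast
    obtain h :: "nat \<Rightarrow> nat" where h: "strict_mono h" "mono ((\<lambda>n. f (g n) k) \<circ> h)"
      using nat_seq_mono_subseq by blast
    have mh: "mono h" using h(1) by (rule strict_mono_mono)
    have "mono (\<lambda>n. f ((g \<circ> h) n) k')" if "k' \<in> insert k K" for k'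
    proof (cases "k' = k")
      case True
      with h(2) show ?thesis by (simp add: comp_def)
    next
      case False
      with that g(2) have "mono (\<lambda>n. f (g n) k')" by blast
      with mh show ?thesis by (auto simp: mono_def)
    qed
    with g(1) h(1) show ?case
      by (intro exI[of _ "g \<circ> h"] conjI strict_mono_o) auto
  qed
  from this[of UNIV] obtain g :: "nat \<Rightarrow> nat" where "strict_mono g" "\<forall>k. mono (\<lambda>n. f (g n) k)" by auto
  then show ?thesis by (auto simp: mono_def le_fun_def intro!: exI[of _ g])
qed

definition dvar_antichain :: "('m, 'n) dvar set \<Rightarrow> bool" where
  "dvar_antichain A \<longleftrightarrow> (\<forall>u\<in>A. \<forall>v\<in>A. dvar_le u v \<longrightarrow> u = v)"

lemma finite_dvar_antichain:
  fixes A :: "('m::finite, 'n::finite) dvar set"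
  assumes "dvar_antichain A"
  shows "finite A"
proof (rule ccontr)
  assume inf: "infinite A"
  have "\<exists>i. infinite {v \<in> A. snd v = i}"
  proof (rule ccontr)
    assume "\<not> ?thesis"
    then have "finite (\<Union>i. {v \<in> A. snd v = i})" by auto
    moreover have "A \<subseteq> (\<Union>i. {v \<in> A. snd v = i})" by auto
    ultimately show False using inf finite_subset by blast
  qed
  then obtain i where "infinite {v \<in> A. snd v = i}" by blast
  then obtain a :: "nat \<Rightarrow> ('m, 'n) dvar" where a: "inj a" "range a \<subseteq> {v \<in> A. snd v = i}"
    using infinite_countable_subset by blast
  obtain g :: "nat \<Rightarrow> nat" where g: "strict_mono g" "mono ((fst \<circ> a) \<circ> g)"
    using fun_seq_mono_subseq by blast
  have "snd (a n) = i" for n using a(2) by blast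
  then have "dvar_le (a (g 0)) (a (g 1))"
    using monoD[OF g(2), of 0 1] by (simp add: dvar_le_def)
  with a(2) assms have "a (g 0) = a (g 1)" unfolding dvar_antichain_def by blast
  with a(1) have "g 0 = g 1" by (simp add: inj_eq)
  with g(1) show False by (metis less_irrefl strict_mono_less zero_less_one)
qed

lemma antichain_seq_antichain: "antichain_seq as \<Longrightarrow> dvar_antichain (set as)"
  unfolding antichain_seq_def dvar_antichain_def by (metis in_set_conv_nth)

lemma antichain_seq_ex:
  fixes A :: "('m::finite, 'n::finite) dvar set"
  assumes "dvar_antichain A"
  obtains as where "set as = A" "antichain_seq as"
proof -
  obtain as where as: "set as = A" "distinct as"
    using finite_distinct_list[OF finite_dvar_antichain[OF assms]] by blast
  then have "antichain_seq as"
    using assms unfolding antichain_seq_def dvar_antichain_def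
    by (metis nth_eq_iff_index_eq nth_mem)
  with as that show thesis by blast
qed

section \<open>The number \<open>D_num\<close> and its boundedness\<close>

lemma D_condition_cong: "Gam_seq as p = Gam_seq bs p \<Longrightarrow> D_condition as p \<longleftrightarrow> D_condition bs p"
  by (simp add: D_condition_def)

lemma ex_D_condition:
  fixes as :: "('m::{finite,linorder}, 'n::{finite,linorder}) dvar list"
  shows "\<exists>p\<ge>r. D_condition as p"
proof -
  let ?G = "gam (set as)"
  have "?G \<subseteq> (\<lambda>(v, w). (mlub (fst v) (fst w), snd v)) ` (set as \<times> set as)"
    by (force simp: gam_def)
  then have fin: "finite ?G" by (rule finite_subset) simp
  define p where "p = Max (insert r ((\<lambda>v. mdeg (fst v)) ` ?G))"
  have "gam (Gam_seq as p) \<subseteq> ?G"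
    by (auto simp: gam_def Gam_seq_def)
  moreover have "?G \<subseteq> Gam p"
    unfolding p_def Gam_def using fin by (auto intro!: Max_ge)
  ultimately have "gam (Gam_seq as p) - Gam p = {}" by blast
  then have "D_condition as p" unfolding D_condition_def by blast
  moreover have "r \<le> p" unfolding p_def using fin by (intro Max_ge) auto
  ultimately show ?thesis by blast
qed

lemma D_num_props:
  fixes as :: "('m::{finite,linorder}, 'n::{finite,linorder}) dvar list"
  shows "r \<le> D_num r as" "D_condition as (D_num r as)"
  using LeastI_ex[OF ex_D_condition[of r as], folded D_num_def] by auto

text \<open>
  Koenig's lemma: a sequence of antichains with unbounded \<open>D_num\<close> would have a limit, again an
  antichain, that agrees with infinitely many of its members up to any given degree; but
  \<open>D_num\<close> is determined by the antichain up to degree \<open>D_num\<close>.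
\<close>
lemma bounded_D_num:
  "\<exists>N. \<forall>as :: ('m::{finite,linorder}, 'n::{finite,linorder}) dvar list.
         antichain_seq as \<longrightarrow> D_num r as \<le> N"
proof (rule ccontr)
  assume "\<not> ?thesis"
  then have "\<forall>N. \<exists>as :: ('m, 'n) dvar list. antichain_seq as \<and> N < D_num r as"
    by (meson not_le)
  then obtain a :: "nat \<Rightarrow> ('m, 'n) dvar list"
    where a: "\<And>N. antichain_seq (a N)" "\<And>N. N < D_num r (a N)" by metis
  \<comment> \<open>A truncation is kept only if infinitely many members of the sequence share it,
    so that it can always be prolonged to the next degree.\<close>
  define good where "good n F \<longleftrightarrow> infinite {N. Gam_seq (a N) n = F}" for n F
  have split: "\<exists>F. infinite {N. N \<in> Y \<and> Gam_seq (a N) n = F}" if "infinite Y" for n Y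
  proof -
    have "finite ((\<lambda>N. Gam_seq (a N) n) ` Y)"
      by (rule finite_subset[OF _ finite_Pow_iff[THEN iffD2, OF finite_Gam[of n]]])
         (auto simp: Gam_seq_def)
    from pigeonhole_infinite[OF that this] show ?thesis by blast
  qed
  have restrict: "Gam_seq as n = Gam_seq as (Suc n) \<inter> Gam n" for as :: "('m, 'n) dvar list" and n
    by (auto simp: Gam_seq_def Gam_def)
  have "\<exists>F. \<forall>n. good n (F n) \<and> F (Suc n) \<inter> Gam n = F n"
  proof (rule dependent_nat_choice)
    show "\<exists>F. good 0 F" using split[of UNIV 0] by (auto simp: good_def)
  next
    fix F n assume "good n F"
    then obtain F' where F': "infinite {N. N \<in> {N. Gam_seq (a N) n = F} \<and> Gam_seq (a N) (Suc n) = F'}"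
      unfolding good_def using split by blast
    then obtain N where "Gam_seq (a N) n = F" "Gam_seq (a N) (Suc n) = F'"
      using not_finite_existsD by auto
    then have "F' \<inter> Gam n = F" using restrict by metis
    moreover have "good (Suc n) F'"
      unfolding good_def by (rule infinite_super[OF _ F']) auto
    ultimately show "\<exists>F'. good (Suc n) F' \<and> F' \<inter> Gam n = F" by blast
  qed
  then obtain F where F: "\<And>n. good n (F n)" "\<And>n. F (Suc n) \<inter> Gam n = F n" by blast
  have FG: "F n \<subseteq> Gam n" for n using F(2)[of n] by blast
  have Gam_mono: "n \<le> n' \<Longrightarrow> (Gam n :: ('m, 'n) dvar set) \<subseteq> Gam n'" for n n'
    by (auto simp: Gam_def)
  have restrict_F: "F n' \<inter> Gam n = F n" if "n \<le> n'" for n n'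
    using that
  proof (induction n' rule: dec_induct)
    case base
    show ?case using FG by blast
  next
    case (step n')
    have "F (Suc n') \<inter> Gam n = F (Suc n') \<inter> Gam n' \<inter> Gam n"
      using Gam_mono[OF step.hyps(1)] by blast
    with step F(2) show ?case by simp
  qed
  define A where "A = (\<Union>n. F n)"
  have AG: "A \<inter> Gam n = F n" for n
  proof -
    have "F n' \<inter> Gam n \<subseteq> F n" for n'
      using restrict_F[of n n'] restrict_F[of n' n] Gam_mono[of n n'] FG by (cases "n \<le> n'") auto
    then show ?thesis using FG unfolding A_def by blast
  qed
  have "dvar_antichain A"
    unfolding dvar_antichain_def
  proof (intro ballI impI)
    fix u v assume uv: "u \<in> A" "v \<in> A" "dvar_le u v"
    define n where "n = max (mdeg (fst u)) (mdeg (fst v))"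
    have "u \<in> F n" "v \<in> F n"
      using uv by (auto simp flip: AG simp: n_def Gam_def)
    moreover obtain N where "Gam_seq (a N) n = F n"
      using F(1)[of n] unfolding good_def using not_finite_existsD by blast
    ultimately have "u \<in> set (a N)" "v \<in> set (a N)" by (auto simp: Gam_seq_def)
    with antichain_seq_antichain[OF a(1)] uv(3) show "u = v"
      unfolding dvar_antichain_def by blast
  qed
  then obtain as where as: "set as = A" by (rule antichain_seq_ex)
  let ?p = "D_num r as"
  have "infinite {N. Gam_seq (a N) ?p = F ?p}" using F(1) by (simp add: good_def)
  \<comment> \<open>Among the infinitely many members that agree with the limit up to degree
    \<open>?p\<close>, one of index at least \<open>?p\<close> is taken, because \<open>a N\<close>
    was chosen with \<open>N < D_num r (a N)\<close>.\<close>
  then obtain N where N: "N \<ge> ?p" "Gam_seq (a N) ?p = F ?p"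
    unfolding infinite_nat_iff_unbounded_le by blast
  have "Gam_seq as ?p = F ?p" by (auto simp: Gam_seq_def as simp flip: AG)
  with N have "D_condition (a N) ?p"
    using D_condition_cong D_num_props(2) by metis
  then have "D_num r (a N) \<le> ?p"
    unfolding D_num_def[of r "a N"] using D_num_props(1) by (intro Least_le) auto
  with N a(2)[of N] show False by simp
qed

lemma D_num_le_C_num:
  fixes as :: "('m::{finite,linorder}, 'n::{finite,linorder}) dvar list"
  assumes "antichain_seq as"
  shows "D_num r as \<le> C_num TYPE('m) TYPE('n) r"
proof -
  obtain N where "\<forall>as :: ('m, 'n) dvar list. antichain_seq as \<longrightarrow> D_num r as \<le> N"
    using bounded_D_num by blast
  then have "finite {D_num r as | as :: ('m, 'n) dvar list. antichain_seq as}"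
    by (intro finite_subset[OF _ finite_atMost[of N]]) auto
  with assms show ?thesis unfolding C_num_def by (intro Max_ge) auto
qed

section \<open>Differential polynomials as univariate polynomials\<close>

lemma single_eq_dconst_mult:
  "Poly_Mapping.single M c = (dconst c * Poly_Mapping.single M 1 :: ('k::comm_ring_1, 'm, 'n) dpoly)"
  by (simp add: dconst_def Poly_Mapping.mult_single)

lemma dvar_poly_power:
  "dvar_poly v ^ d = (Poly_Mapping.single (Poly_Mapping.single v d) 1 :: ('k::comm_ring_1, 'm, 'n) dpoly)"
proof (induction d)
  case (Suc d)
  then show ?case
    by (simp add: dvar_poly_def Poly_Mapping.mult_single flip: single_add)
qed simp

lemma dconst_1 [simp]: "dconst 1 = 1"
  by (simp add: dconst_def)

lemma dconst_0 [simp]: "dconst 0 = 0"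
  by (simp add: dconst_def)

lemma dconst_add: "dconst (a + b) = dconst a + dconst b"
  by (simp add: dconst_def single_add)

lemma dconst_mult: "dconst (a * b) = dconst a * dconst b"
  by (simp add: dconst_def Poly_Mapping.mult_single)

lemma dvars_zero [simp]: "dvars 0 = {}"
  by (simp add: dvars_def)

lemma dvars_single: "dvars (Poly_Mapping.single M c) \<subseteq> Poly_Mapping.keys M"
  by (auto simp: dvars_def)

lemma dvars_dconst [simp]: "dvars (dconst c) = {}"
  using dvars_single[of 0 c] by (auto simp: dconst_def)

lemma dvars_one [simp]: "dvars (1 :: ('k::comm_ring_1, 'm, 'n) dpoly) = {}"
  using dvars_dconst[of 1] by simp

lemma dvars_dvar_poly: "dvars (dvar_poly v) \<subseteq> {v}"
  using dvars_single by (fastforce simp: dvar_poly_def)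

lemma dvars_add: "dvars (f + g) \<subseteq> dvars f \<union> dvars g"
  using Poly_Mapping.keys_add[of f g] by (auto simp: dvars_def)

lemma dvars_uminus [simp]: "dvars (- f) = dvars (f :: ('k::ab_group_add, 'm, 'n) dpoly)"
  by (simp add: dvars_def in_keys_iff set_eq_iff)

lemma dvars_diff: "dvars (f - g) \<subseteq> dvars f \<union> dvars (g :: ('k::ab_group_add, 'm, 'n) dpoly)"
  using dvars_add[of f "- g"] by simp

lemma dvars_mult: "dvars (f * g) \<subseteq> dvars f \<union> dvars (g :: ('k::comm_ring_1, 'm, 'n) dpoly)"
proof
  fix v assume "v \<in> dvars (f * g)"
  then obtain M where M: "M \<in> Poly_Mapping.keys (f * g)" "v \<in> Poly_Mapping.keys M"
    by (auto simp: dvars_def)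
  from M(1) obtain M1 M2 where "M = M1 + M2" "M1 \<in> Poly_Mapping.keys f" "M2 \<in> Poly_Mapping.keys g"
    using Poly_Mapping.keys_mult by blast
  with M(2) show "v \<in> dvars f \<union> dvars g"
    using Poly_Mapping.keys_add[of M1 M2] by (auto simp: dvars_def)
qed

lemma dvars_sum: "dvars (sum f A) \<subseteq> (\<Union>a\<in>A. dvars (f a))"
proof (induction A rule: infinite_finite_induct)
  case (insert a A)
  then show ?case using dvars_add[of "f a" "sum f A"] by auto
qed auto

lemma dvars_power: "dvars (f ^ d) \<subseteq> dvars (f :: ('k::comm_ring_1, 'm, 'n) dpoly)"
proof (induction d)
  case (Suc d)
  then show ?case using dvars_mult[of f "f ^ d"] by auto
qed simp

lemma finite_dvars [simp]: "finite (dvars f)"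
  by (simp add: dvars_def)

lemma dvars_poly_subset:
  fixes F :: "('k::comm_ring_1, 'm, 'n) dpoly poly"
  assumes "\<And>d. dvars (coeff F d) \<subseteq> W" "dvars x \<subseteq> W"
  shows "dvars (poly F x) \<subseteq> W"
proof -
  have "dvars (coeff F d * x ^ d) \<subseteq> W" for d
    using dvars_mult[of "coeff F d" "x ^ d"] dvars_power[of x d] assms by blast
  then show ?thesis
    unfolding poly_altdef using dvars_sum[of "\<lambda>d. coeff F d * x ^ d" "{..degree F}"] by blast
qed

text \<open>Lets inductions treat a polynomial as built from constants and derivatives by ring
  operations, while \<open>W\<close> remembers which derivatives may occur.\<close>

lemma dpoly_ring_induct [consumes 1, case_names const var add mult]:
  fixes f :: "('k::comm_ring_1, 'm, 'n) dpoly"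
  assumes "dvars f \<subseteq> W"
    and const: "\<And>c. P (dconst c)"
    and var: "\<And>v. v \<in> W \<Longrightarrow> P (dvar_poly v)"
    and add: "\<And>f g. P f \<Longrightarrow> P g \<Longrightarrow> P (f + g)"
    and mult: "\<And>f g. P f \<Longrightarrow> P g \<Longrightarrow> P (f * g)"
  shows "P f"
proof -
  have one: "P 1" using const[of 1] by simp
  have power: "P (dvar_poly v ^ d)" if "v \<in> W" for v d
    by (induction d) (use one var mult that in auto)
  have monom: "P (Poly_Mapping.single M 1)" if "Poly_Mapping.keys M \<subseteq> W" for M
    using that
  proof (induction M rule: Poly_Mapping.update_induct)
    case const
    then show ?case using one by simp
  next
    case (update M v b)
    have eq: "Poly_Mapping.update v b M = M + Poly_Mapping.single v b"
      using update(1)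
      by (intro poly_mapping_eqI) (auto simp: lookup_update lookup_add lookup_single in_keys_iff when_def)
    have "v \<in> W" "Poly_Mapping.keys M \<subseteq> W"
      using update(1,2,4) keys_update[of v b M] by auto
    then have "P (Poly_Mapping.single M 1 * dvar_poly v ^ b)"
      using update.IH power mult by blast
    then show ?case by (simp add: eq dvar_poly_power Poly_Mapping.mult_single)
  qed
  have "f = (\<Sum>M\<in>Poly_Mapping.keys f. Poly_Mapping.single M (Poly_Mapping.lookup f M))"
    by (rule poly_mapping_eqI)
       (simp add: lookup_sum lookup_single when_def in_keys_iff flip: sum.inter_filter)
  also have "P \<dots>"
  proof -
    have "P (\<Sum>M\<in>A. Poly_Mapping.single M (Poly_Mapping.lookup f M))"
      if "finite A" "A \<subseteq> Poly_Mapping.keys f" for A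
      using that
    proof (induction A)
      case empty
      show ?case using const[of 0] by simp
    next
      case (insert M A)
      have "Poly_Mapping.keys M \<subseteq> W"
        using insert.prems assms(1) by (auto simp: dvars_def)
      then have "P (Poly_Mapping.single M (Poly_Mapping.lookup f M))"
        by (subst single_eq_dconst_mult) (intro mult const monom)
      with insert show ?case by (auto intro: add)
    qed
    then show ?thesis by auto
  qed
  finally show ?thesis .
qed

text \<open>The expansion of \<open>f\<close> in powers of \<open>v\<close>. Its coefficients stay
  in the type of differential polynomials and merely avoid \<open>v\<close>, so no second ring is
  involved.\<close>

definition upoly :: "('m, 'n) dvar \<Rightarrow> ('k::comm_ring_1, 'm, 'n) dpoly \<Rightarrow> ('k, 'm, 'n) dpoly poly" where
  "upoly v f = (\<Sum>M\<in>Poly_Mapping.keys f.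
     monom (Poly_Mapping.single (M - Poly_Mapping.single v (Poly_Mapping.lookup M v))
       (Poly_Mapping.lookup f M)) (Poly_Mapping.lookup M v))"

lemma upoly_superset:
  assumes "finite A" "Poly_Mapping.keys f \<subseteq> A"
  shows "upoly v f = (\<Sum>M\<in>A.
     monom (Poly_Mapping.single (M - Poly_Mapping.single v (Poly_Mapping.lookup M v))
       (Poly_Mapping.lookup f M)) (Poly_Mapping.lookup M v))"
  unfolding upoly_def by (rule sum.mono_neutral_left) (use assms in \<open>auto simp: in_keys_iff\<close>)

lemma upoly_single:
  "upoly v (Poly_Mapping.single M c) =
     monom (Poly_Mapping.single (M - Poly_Mapping.single v (Poly_Mapping.lookup M v)) c)
       (Poly_Mapping.lookup M v)"
  by (subst upoly_superset[where A = "{M}"]) auto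

lemma upoly_add: "upoly v (f + g) = upoly v f + upoly v g"
proof -
  let ?A = "Poly_Mapping.keys f \<union> Poly_Mapping.keys g"
  have fin: "finite ?A" by simp
  have sub: "Poly_Mapping.keys (f + g) \<subseteq> ?A" "Poly_Mapping.keys f \<subseteq> ?A" "Poly_Mapping.keys g \<subseteq> ?A"
    using Poly_Mapping.keys_add[of f g] by auto
  show ?thesis
    unfolding sub[THEN upoly_superset[OF fin]]
    by (simp add: lookup_add single_add sum.distrib flip: add_monom)
qed

lemma upoly_0 [simp]: "upoly v 0 = 0"
  by (simp add: upoly_def)

lemma upoly_mult: "upoly v (f * g) = upoly v f * upoly v g"
proof -
  have single_mult: "upoly v (Poly_Mapping.single M a * g) = upoly v (Poly_Mapping.single M a) * upoly v g"
    for M a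
  proof (induction g rule: dpoly_induct)
    case (single N b)
    let ?c = "\<lambda>M. M - Poly_Mapping.single v (Poly_Mapping.lookup M v)"
    have "?c M + ?c N = ?c (M + N)"
      by (rule poly_mapping_eqI) (auto simp: lookup_add lookup_minus lookup_single when_def)
    then show ?case
      by (simp add: Poly_Mapping.mult_single upoly_single lookup_add mult_monom)
  qed (simp_all add: distrib_left upoly_add)
  show ?thesis
    by (induction f rule: dpoly_induct) (simp_all add: single_mult distrib_right upoly_add)
qed

lemma upoly_uminus: "upoly v (- f) = - upoly v f"
  using upoly_add[of v f "- f"] by (simp add: eq_neg_iff_add_eq_0 add.commute)

lemma upoly_diff: "upoly v (f - g) = upoly v f - upoly v g"
  using upoly_add[of v f "- g"] by (simp add: upoly_uminus)

lemma upoly_dconst: "upoly v (dconst c) = [:dconst c:]"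
  by (simp add: dconst_def upoly_single monom_0)

lemma upoly_dvar_poly_self: "upoly v (dvar_poly v) = [:0, 1:]"
  by (simp add: dvar_poly_def upoly_single monom_altdef)

lemma upoly_dvar_poly_other: "w \<noteq> v \<Longrightarrow> upoly v (dvar_poly w) = [:dvar_poly w:]"
  by (simp add: dvar_poly_def upoly_single lookup_single monom_0)

lemma upoly_free: "v \<notin> dvars f \<Longrightarrow> upoly v f = [:f:]"
proof -
  assume "v \<notin> dvars f"
  then have "dvars f \<subseteq> - {v}" by auto
  then show ?thesis
    by (induction rule: dpoly_ring_induct)
       (auto simp: upoly_dconst upoly_dvar_poly_other upoly_add upoly_mult)
qed

lemma poly_upoly [simp]: "poly (upoly v f) (dvar_poly v) = f"
proof -
  have "dvars f \<subseteq> UNIV" by simp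
  then show ?thesis
  proof (induction rule: dpoly_ring_induct)
    case (var w)
    show ?case by (cases "w = v") (simp_all add: upoly_dvar_poly_self upoly_dvar_poly_other)
  qed (simp_all add: upoly_dconst upoly_add upoly_mult)
qed

lemma lookup_coeff_upoly:
  "Poly_Mapping.lookup (coeff (upoly v f) d) M =
     (if Poly_Mapping.lookup M v = 0 then Poly_Mapping.lookup f (M + Poly_Mapping.single v d) else 0)"
proof (induction f rule: dpoly_induct)
  case (single N c)
  let ?N = "N - Poly_Mapping.single v (Poly_Mapping.lookup N v)"
  have "?N = M \<and> Poly_Mapping.lookup N v = d \<longleftrightarrow>
      Poly_Mapping.lookup M v = 0 \<and> N = M + Poly_Mapping.single v d"
    by (auto simp: poly_mapping_eq_iff fun_eq_iff lookup_add lookup_minus lookup_single when_def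
        simp del: split_paired_All)
  then show ?case
    by (auto simp: upoly_single lookup_single when_def)
qed (simp_all add: upoly_add lookup_add)

lemma dvars_coeff_upoly: "dvars (coeff (upoly v f) d) \<subseteq> dvars f - {v}"
proof
  fix w assume "w \<in> dvars (coeff (upoly v f) d)"
  then obtain M where M: "M \<in> Poly_Mapping.keys (coeff (upoly v f) d)" "w \<in> Poly_Mapping.keys M"
    by (auto simp: dvars_def)
  then have v: "Poly_Mapping.lookup M v = 0" and "M + Poly_Mapping.single v d \<in> Poly_Mapping.keys f"
    by (auto simp: in_keys_iff lookup_coeff_upoly split: if_splits)
  moreover have "w \<in> Poly_Mapping.keys (M + Poly_Mapping.single v d)"
    using M(2) by (auto simp: in_keys_iff lookup_add)
  moreover have "w \<noteq> v" using v M(2) by (auto simp: in_keys_iff)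
  ultimately show "w \<in> dvars f - {v}" by (auto simp: dvars_def)
qed

text \<open>Connects the degree that defines rank and reducedness with the univariate degree on
  which pseudo-division operates.\<close>

lemma degree_upoly: "degree (upoly v f) = degree_in f v"
proof (rule antisym)
  show "degree (upoly v f) \<le> degree_in f v"
  proof (rule degree_le, intro allI impI)
    fix d assume d: "degree_in f v < d"
    show "coeff (upoly v f) d = 0"
    proof (rule poly_mapping_eqI)
      fix M
      have "M + Poly_Mapping.single v d \<notin> Poly_Mapping.keys f"
      proof
        assume "M + Poly_Mapping.single v d \<in> Poly_Mapping.keys f"
        then have "Poly_Mapping.lookup (M + Poly_Mapping.single v d) v \<le> degree_in f v"
          unfolding degree_in_def by (intro Max_ge) auto
        with d show False by (simp add: lookup_add)
      qed
      then show "Poly_Mapping.lookup (coeff (upoly v f) d) M = Poly_Mapping.lookup 0 M"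
        by (simp add: lookup_coeff_upoly in_keys_iff)
    qed
  qed
  have "Poly_Mapping.lookup M v \<le> degree (upoly v f)" if "M \<in> Poly_Mapping.keys f" for M
  proof (rule le_degree)
    let ?N = "M - Poly_Mapping.single v (Poly_Mapping.lookup M v)"
    have "?N + Poly_Mapping.single v (Poly_Mapping.lookup M v) = M"
      by (rule poly_mapping_eqI) (auto simp: lookup_add lookup_minus lookup_single when_def)
    then have "Poly_Mapping.lookup (coeff (upoly v f) (Poly_Mapping.lookup M v)) ?N \<noteq> 0"
      using that by (simp add: lookup_coeff_upoly lookup_minus in_keys_iff)
    then show "coeff (upoly v f) (Poly_Mapping.lookup M v) \<noteq> 0" by auto
  qed
  then show "degree_in f v \<le> degree (upoly v f)"
    unfolding degree_in_def by (intro Max.boundedI) auto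
qed

lemma upoly_poly:
  assumes "\<And>d. v \<notin> dvars (coeff F d)"
  shows "upoly v (poly F (dvar_poly v)) = F"
  using assms
proof (induction F)
  case (pCons a F)
  have "v \<notin> dvars a" "\<And>d. v \<notin> dvars (coeff F d)"
    using pCons.prems[of 0] pCons.prems[of "Suc _"] by auto
  with pCons.IH show ?case
    by (simp add: upoly_add upoly_mult upoly_free upoly_dvar_poly_self)
qed simp

lemma degree_in_eq_0_iff:
  "degree_in f v = 0 \<longleftrightarrow> v \<notin> dvars (f :: ('k::comm_ring_1, 'm, 'n) dpoly)"
proof
  assume "degree_in f v = 0"
  then obtain c where c: "upoly v f = [:c:]"
    by (metis degree_0_id degree_upoly)
  then have "c = coeff (upoly v f) 0" by simp
  moreover have "f = c" using c poly_upoly[of v f] by simp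
  ultimately show "v \<notin> dvars f" using dvars_coeff_upoly[of v f 0] by auto
next
  assume "v \<notin> dvars f"
  then show "degree_in f v = 0" by (simp add: upoly_free flip: degree_upoly)
qed

section \<open>Derivations of differential polynomials\<close>

text \<open>
  The library's \<open>pderiv\<close> requires a coefficient ring without zero divisors; that differential
  polynomials form such a ring is not needed below.
\<close>
definition fderiv :: "'a::comm_ring_1 poly \<Rightarrow> 'a poly" where
  "fderiv F = (\<Sum>i\<le>degree F. monom (of_nat (Suc i) * coeff F (Suc i)) i)"

lemma coeff_fderiv: "coeff (fderiv F) n = of_nat (Suc n) * coeff F (Suc n)"
  unfolding fderiv_def coeff_sum coeff_monom
  by (cases "n \<le> degree F") (simp_all add: coeff_eq_0)

lemma fderiv_0 [simp]: "fderiv 0 = 0"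
  by (simp add: fderiv_def)

lemma fderiv_pCons: "fderiv (pCons a F) = F + pCons 0 (fderiv F)"
  by (rule poly_eqI) (simp add: coeff_fderiv coeff_pCons distrib_right split: nat.split)

text \<open>The chain rule. When \<open>x\<close> is a leader, the summand with \<open>D x\<close>
  brings in the new leader, and its factor is the separant.\<close>

lemma is_derivation_poly:
  assumes D: "is_derivation D"
  shows "D (poly F x) = poly (map_poly D F) x + poly (fderiv F) x * D x"
proof (induction F)
  case 0
  show ?case by (simp add: is_derivation_0[OF D])
next
  case (pCons a F)
  have "D (poly (pCons a F) x) = D a + (D x * poly F x + x * D (poly F x))"
    using D by (simp add: is_derivation_def)
  also have "\<dots> = poly (map_poly D (pCons a F)) x + poly (fderiv (pCons a F)) x * D x"
    unfolding pCons.IH by (simp add: map_poly_pCons is_derivation_0[OF D] fderiv_pCons algebra_simps)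
  finally show ?case .
qed

lemma dvars_ddiff:
  assumes "is_derivation (\<delta> k)" "dvars f \<subseteq> W"
  shows "dvars (ddiff \<delta> k f) \<subseteq> W \<union> dshift k ` W"
proof -
  have "dvars f \<subseteq> W \<and> dvars (ddiff \<delta> k f) \<subseteq> W \<union> dshift k ` W"
    using assms(2)
  proof (induction rule: dpoly_ring_induct)
    case (const c)
    show ?case by (simp add: ddiff_dconst assms(1))
  next
    case (var v)
    have "dvars (ddiff \<delta> k (dvar_poly v)) \<subseteq> {dshift k v}"
      using assms(1) ddiff_dvar_poly[of \<delta> k "fst v" "snd v"] dvars_dvar_poly[of "dshift k v"]
      by (simp add: dshift_def)
    then show ?case using var dvars_dvar_poly[of v] by blast
  next
    case (add f g)
    then show ?case
      using dvars_add[of f g] dvars_add[of "ddiff \<delta> k f" "ddiff \<delta> k g"]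
      by (simp add: ddiff_add assms(1)) blast
  next
    case (mult f g)
    then show ?case
      using dvars_mult[of f g] dvars_mult[of "ddiff \<delta> k f" g] dvars_mult[of f "ddiff \<delta> k g"]
        dvars_add[of "ddiff \<delta> k f * g" "f * ddiff \<delta> k g"]
      by (simp add: ddiff_mult assms(1)) blast
  qed
  then show ?thesis by blast
qed

lemma ddiff_dvar: "is_derivation (\<delta> k) \<Longrightarrow> ddiff \<delta> k (dvar_poly v) = dvar_poly (dshift k v)"
  using ddiff_dvar_poly[of \<delta> k "fst v" "snd v"] by (simp add: dshift_def)

lemma dshift_commute: "dshift k (dshift l v) = dshift l (dshift k v)"
  by (auto simp: dshift_def mshift_def)

lemma ddiff_commute:
  assumes "differential_field \<delta>"
  shows "ddiff \<delta> k (ddiff \<delta> l f) = ddiff \<delta> l (ddiff \<delta> k f)"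
proof -
  have d: "is_derivation (\<delta> k)" for k using assms by (simp add: differential_field_def)
  have "dvars f \<subseteq> UNIV" by simp
  then show ?thesis
  proof (induction rule: dpoly_ring_induct)
    case (const c)
    then show ?case using assms by (simp add: ddiff_dconst d differential_field_def)
  qed (simp_all add: ddiff_dvar d dshift_commute[of k l] ddiff_add ddiff_mult algebra_simps)
qed

text \<open>The listing of the index type only fixes an order of composition; commutativity makes
  the order immaterial.\<close>

definition dpow ::
    "('m::{finite,linorder} \<Rightarrow> 'k::comm_ring_1 \<Rightarrow> 'k) \<Rightarrow> 'm mindex \<Rightarrow> ('k, 'm, 'n) dpoly \<Rightarrow> ('k, 'm, 'n) dpoly" where
  "dpow \<delta> \<theta> = fold (\<lambda>k. ddiff \<delta> k ^^ \<theta> k) (sorted_list_of_set UNIV)"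

lemma dpow_0 [simp]: "dpow \<delta> (\<lambda>_. 0) f = f"
proof -
  have "fold (\<lambda>k. ddiff \<delta> k ^^ 0) ks f = f" for ks by (induction ks) auto
  then show ?thesis by (simp add: dpow_def)
qed

lemma dpow_mshift:
  fixes f :: "('k::field, 'm::{finite,linorder}, 'n) dpoly"
  assumes "differential_field \<delta>"
  shows "dpow \<delta> (mshift k \<theta>) f = ddiff \<delta> k (dpow \<delta> \<theta> f)"
proof -
  have funpow: "(ddiff \<delta> j ^^ n) (ddiff \<delta> k f) = ddiff \<delta> k ((ddiff \<delta> j ^^ n) f)"
    for j n and f :: "('k, 'm, 'n) dpoly"
    by (induction n) (simp_all add: ddiff_commute[OF assms, of j k])
  have comm: "fold (\<lambda>j. ddiff \<delta> j ^^ \<theta> j) ks (ddiff \<delta> k f) = ddiff \<delta> k (fold (\<lambda>j. ddiff \<delta> j ^^ \<theta> j) ks f)"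
    for ks and f :: "('k, 'm, 'n) dpoly"
    by (induction ks arbitrary: f) (simp_all add: funpow)
  have "fold (\<lambda>j. ddiff \<delta> j ^^ mshift k \<theta> j) ks f =
      (if k \<in> set ks then ddiff \<delta> k (fold (\<lambda>j. ddiff \<delta> j ^^ \<theta> j) ks f)
       else fold (\<lambda>j. ddiff \<delta> j ^^ \<theta> j) ks f)" if "distinct ks" for ks and f :: "('k, 'm, 'n) dpoly"
    using that
  proof (induction ks arbitrary: f)
    case (Cons j ks)
    then show ?case by (auto simp: mshift_def munit_def funpow comm)
  qed simp
  from this[of "sorted_list_of_set UNIV"] show ?thesis by (simp add: dpow_def)
qed

section \<open>Ideals\<close>

text \<open>Ideals of the ring formed by a whole type; \<open>primeideal_type_algebra_iff\<close>
  translates the notion used in the statement into this one.\<close>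

definition is_ideal :: "'a::comm_ring_1 set \<Rightarrow> bool" where
  "is_ideal J \<longleftrightarrow> 0 \<in> J \<and> (\<forall>a\<in>J. \<forall>b\<in>J. a + b \<in> J) \<and> (\<forall>a\<in>J. \<forall>c. c * a \<in> J)"

lemma is_idealD:
  assumes "is_ideal J"
  shows is_ideal_0: "0 \<in> J"
    and is_ideal_add: "a \<in> J \<Longrightarrow> b \<in> J \<Longrightarrow> a + b \<in> J"
    and is_ideal_mult: "a \<in> J \<Longrightarrow> c * a \<in> J"
    and is_ideal_mult_right: "a \<in> J \<Longrightarrow> a * c \<in> J"
  using assms by (auto simp: is_ideal_def mult.commute)

lemma is_ideal_uminus: "is_ideal J \<Longrightarrow> a \<in> J \<Longrightarrow> - a \<in> J"
  using is_ideal_mult[of J a "- 1"] by simp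

lemma is_ideal_diff: "is_ideal J \<Longrightarrow> a \<in> J \<Longrightarrow> b \<in> J \<Longrightarrow> a - b \<in> J"
  using is_ideal_add[of J a "- b"] is_ideal_uminus[of J b] by simp

lemma is_ideal_sum: "is_ideal J \<Longrightarrow> (\<And>a. a \<in> A \<Longrightarrow> f a \<in> J) \<Longrightarrow> sum f A \<in> J"
  by (induction A rule: infinite_finite_induct) (auto simp: is_ideal_0 is_ideal_add)

lemma is_ideal_cong: "is_ideal J \<Longrightarrow> a - b \<in> J \<Longrightarrow> a \<in> J \<longleftrightarrow> b \<in> J"
  using is_ideal_diff[of J a "a - b"] is_ideal_add[of J "a - b" b] by auto

lemma is_ideal_poly: "is_ideal J \<Longrightarrow> (\<And>d. coeff F d \<in> J) \<Longrightarrow> poly F x \<in> J"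
  unfolding poly_altdef by (intro is_ideal_sum) (auto intro: is_ideal_mult_right)

lemma is_ideal_coeff_mult:
  assumes "is_ideal J" "\<And>d. coeff G d \<in> J"
  shows "coeff (F * G) d \<in> J"
  unfolding coeff_mult using assms by (intro is_ideal_sum) (auto intro: is_ideal_mult)

text \<open>The position found is the degree of \<open>F\<close> modulo \<open>J\<close>, so
  arguments with leading coefficients work without a quotient ring.\<close>

lemma ex_last_coeff_notin:
  assumes "is_ideal J" "coeff F d \<notin> J"
  obtains e where "d \<le> e" "coeff F e \<notin> J" "\<And>i. e < i \<Longrightarrow> coeff F i \<in> J"
proof -
  have bound: "\<forall>e. coeff F e \<notin> J \<longrightarrow> e \<le> degree F"
    using assms(1) by (metis is_ideal_0 le_degree)
  let ?e = "GREATEST e. coeff F e \<notin> J"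
  have "coeff F ?e \<notin> J" using GreatestI_nat[of "\<lambda>e. coeff F e \<notin> J"] assms(2) bound by blast
  moreover have "e \<le> ?e" if "coeff F e \<notin> J" for e
    using Greatest_le_nat[of "\<lambda>e. coeff F e \<notin> J"] that bound by blast
  ultimately show thesis using that assms(2) by (meson not_le)
qed

text \<open>Gauss's argument: the product of the topmost coefficients outside \<open>J\<close> is,
  modulo \<open>J\<close>, a coefficient of \<open>F * G\<close>. Primality is assumed only for
  coefficients of \<open>F\<close> and \<open>G\<close>, because in the application it is known only
  for polynomials of lower rank.\<close>

lemma coeffs_in_ideal_prime:
  assumes J: "is_ideal J"
    and prime: "\<And>d e. coeff F d * coeff G e \<in> J \<Longrightarrow> coeff F d \<in> J \<or> coeff G e \<in> J"
    and FG: "\<And>d. coeff (F * G) d \<in> J"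
  shows "(\<forall>d. coeff F d \<in> J) \<or> (\<forall>d. coeff G d \<in> J)"
proof (rule ccontr)
  assume "\<not> ?thesis"
  then obtain d0 e0 where "coeff F d0 \<notin> J" "coeff G e0 \<notin> J" by blast
  then obtain d e where d: "coeff F d \<notin> J" "\<And>i. d < i \<Longrightarrow> coeff F i \<in> J"
    and e: "coeff G e \<notin> J" "\<And>i. e < i \<Longrightarrow> coeff G i \<in> J"
    using ex_last_coeff_notin[OF J] by metis
  have "(\<Sum>i\<in>{..d + e} - {d}. coeff F i * coeff G (d + e - i)) \<in> J"
  proof (rule is_ideal_sum[OF J])
    fix i assume i: "i \<in> {..d + e} - {d}"
    show "coeff F i * coeff G (d + e - i) \<in> J"
    proof (cases "d < i")
      case True
      then show ?thesis using d(2) is_ideal_mult_right[OF J] by blast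
    next
      case False
      with i have "e < d + e - i" by auto
      then show ?thesis using e(2) is_ideal_mult[OF J] by blast
    qed
  qed
  moreover have "coeff (F * G) (d + e) =
      coeff F d * coeff G e + (\<Sum>i\<in>{..d + e} - {d}. coeff F i * coeff G (d + e - i))"
    unfolding coeff_mult by (subst sum.remove[of _ d]) auto
  ultimately have "coeff F d * coeff G e \<in> J"
    using FG[of "d + e"] is_ideal_cong[OF J, of "coeff (F * G) (d + e)" "coeff F d * coeff G e"] by simp
  with prime d(1) e(1) show False by blast
qed

text \<open>
  If a constant \<open>h\<close> is congruent to a multiple of \<open>s * X + t\<close>, comparing coefficients from the
  top shows that the cofactor vanishes modulo \<open>J\<close>.
\<close>
lemma const_in_ideal_if_linear_multiple:
  assumes J: "is_ideal J" and s: "\<And>a. s * a \<in> J \<Longrightarrow> a \<in> J"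
    and C: "\<And>d. coeff ([:h:] - C * [:t, s:]) d \<in> J"
  shows "h \<in> J"
proof -
  have C_in: "coeff C d \<in> J" for d
  proof (rule ccontr)
    assume "coeff C d \<notin> J"
    then obtain e where e: "coeff C e \<notin> J" "\<And>i. e < i \<Longrightarrow> coeff C i \<in> J"
      using ex_last_coeff_notin[OF J] by metis
    have "coeff ([:h:] - C * [:t, s:]) (Suc e) = - (s * coeff C e) - t * coeff C (Suc e)"
      by (simp add: mult.commute[of C] coeff_pCons)
    with C[of "Suc e"] have "- (s * coeff C e) - t * coeff C (Suc e) \<in> J" by metis
    then have "- (s * coeff C e) \<in> J"
      using is_ideal_add[OF J _ is_ideal_mult[OF J e(2)[of "Suc e"], of t]] by fastforce
    then have "s * coeff C e \<in> J" using is_ideal_uminus[OF J] by fastforce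
    with s e(1) show False by blast
  qed
  have "coeff ([:h:] - C * [:t, s:]) 0 = h - t * coeff C 0"
    by (simp add: mult.commute[of C])
  with C[of 0] C_in[of 0] show ?thesis
    using is_ideal_cong[OF J, of h "t * coeff C 0"] is_ideal_mult[OF J] by simp
qed

text \<open>The ideal generated by \<open>G\<close>, saturated at \<open>H\<close>. Division is one
  of the closure rules, so properties of its members are proved rule by rule.\<close>

inductive_set sat :: "'a::comm_ring_1 set \<Rightarrow> 'a set \<Rightarrow> 'a set" for H G where
  zero: "0 \<in> sat H G"
| gen: "g \<in> G \<Longrightarrow> g \<in> sat H G"
| add: "f \<in> sat H G \<Longrightarrow> g \<in> sat H G \<Longrightarrow> f + g \<in> sat H G"
| mult: "f \<in> sat H G \<Longrightarrow> c * f \<in> sat H G"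
| div: "h \<in> H \<Longrightarrow> h * f \<in> sat H G \<Longrightarrow> f \<in> sat H G"

lemma is_ideal_sat: "is_ideal (sat H G)"
  by (auto simp: is_ideal_def intro: sat.intros)

lemma sat_mono:
  assumes "G \<subseteq> G'"
  shows "sat H G \<subseteq> sat H G'"
proof
  fix f assume "f \<in> sat H G"
  then show "f \<in> sat H G'"
    by induction (use assms in \<open>auto intro: sat.intros\<close>)
qed

text \<open>If neither the generators nor the denominators involve \<open>v\<close>, the ideal is
  extended from the polynomials without \<open>v\<close>, so membership passes to the
  coefficients.\<close>

lemma sat_coeff_upoly:
  assumes "f \<in> sat H G" "\<And>g. g \<in> G \<Longrightarrow> v \<notin> dvars g" "\<And>h. h \<in> H \<Longrightarrow> v \<notin> dvars h"
  shows "coeff (upoly v f) d \<in> sat H G"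
  using assms(1)
proof (induction arbitrary: d)
  case (gen g)
  then show ?case
    using assms(2) by (auto simp: upoly_free coeff_pCons intro: sat.intros split: nat.split)
next
  case (mult f c)
  then show ?case unfolding upoly_mult using is_ideal_coeff_mult[OF is_ideal_sat] by blast
next
  case (div h f)
  have "upoly v (h * f) = smult h (upoly v f)"
    using div(1) assms(3) by (simp add: upoly_mult upoly_free)
  then have "h * coeff (upoly v f) d \<in> sat H G" using div.IH[of d] by simp
  with div(1) show ?case by (rule sat.div)
qed (auto simp: upoly_add intro: sat.intros)

text \<open>Multiplying by the leading coefficient at every step replaces division in the
  coefficient ring. The set \<open>W\<close> controls the derivatives in the remainder, and thereby
  its rank.\<close>

lemma pseudo_division:
  fixes F G :: "('k::comm_ring_1, 'm, 'n) dpoly poly"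
  assumes "0 < degree G" "\<And>d. dvars (coeff F d) \<subseteq> W" "\<And>d. dvars (coeff G d) \<subseteq> W"
  shows "\<exists>N Q R. smult (lead_coeff G ^ N) F = Q * G + R \<and> degree R < degree G \<and>
    (\<forall>d. dvars (coeff R d) \<subseteq> W)"
  using assms(2)
proof (induction "degree F" arbitrary: F rule: less_induct)
  case less
  show ?case
  proof (cases "degree F < degree G")
    case True
    with less.prems show ?thesis by (intro exI[of _ 0] exI[of _ F]) auto
  next
    case False
    let ?c = "lead_coeff G"
    define T where "T = monom (lead_coeff F) (degree F - degree G)"
    define F' where "F' = smult ?c F - T * G"
    have coeff_TG: "coeff (T * G) d =
        (if d < degree F - degree G then 0 else lead_coeff F * coeff G (d - (degree F - degree G)))" for d
      by (auto simp: T_def coeff_monom_mult)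
    have "degree F' < degree F"
    proof (rule le_less_trans)
      show "degree F' \<le> degree F - 1"
      proof (rule degree_le, intro allI impI)
        fix d assume d: "degree F - 1 < d"
        show "coeff F' d = 0"
        proof (cases "d = degree F")
          case True
          with False show ?thesis by (simp add: F'_def coeff_TG)
        next
          case neq: False
          with d have "degree F < d" by simp
          moreover from this False have "degree G < d - (degree F - degree G)" by simp
          ultimately show ?thesis by (simp add: F'_def coeff_TG coeff_eq_0)
        qed
      qed
      show "degree F - 1 < degree F" using False assms(1) by simp
    qed
    moreover have "dvars (coeff F' d) \<subseteq> W" for d
    proof -
      have "dvars (coeff (T * G) d) \<subseteq> W"
        using dvars_mult[of "lead_coeff F" "coeff G (d - (degree F - degree G))"]
          less.prems[of "degree F"] assms(3)[of "d - (degree F - degree G)"]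
        by (simp add: coeff_TG) blast
      moreover have "dvars (?c * coeff F d) \<subseteq> W"
        using dvars_mult[of ?c "coeff F d"] less.prems assms(3) by blast
      ultimately show ?thesis
        using dvars_diff[of "?c * coeff F d" "coeff (T * G) d"]
        unfolding F'_def coeff_diff coeff_smult by blast
    qed
    ultimately obtain N Q R where R: "smult (?c ^ N) F' = Q * G + R" "degree R < degree G"
      "\<forall>d. dvars (coeff R d) \<subseteq> W"
      using less.hyps by blast
    have "smult (?c ^ Suc N) F = smult (?c ^ N) (F' + T * G)"
      by (simp add: F'_def mult.commute)
    also have "\<dots> = (Q + smult (?c ^ N) T) * G + R"
      by (simp add: smult_add_right R(1) algebra_simps)
    finally show ?thesis using R(2,3) by blast
  qed
qed

section \<open>Initial segments of the ranking\<close>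

definition below :: "nat \<Rightarrow> ('m::{finite,linorder}, 'n::{finite,linorder}) dvar set" where
  "below n = {w. idx w < n}"

lemma below_mono: "n \<le> n' \<Longrightarrow> below n \<subseteq> below n'"
  by (auto simp: below_def)

lemma below_Suc: "below (Suc (idx v)) = insert v (below (idx v))"
  by (auto simp: below_def less_Suc_eq idx_inj)

lemma Gam_subset_below:
  fixes v :: "('m::{finite,linorder}, 'n::{finite,linorder}) dvar"
  shows "p < mdeg (fst v) \<Longrightarrow> (Gam p :: ('m, 'n) dvar set) \<subseteq> below (idx v)"
  unfolding Gam_def below_def using idx_less_if_mdeg_less[of _ v] le_less_trans by blast

lemma below_Suc_subset_Gam:
  fixes v :: "('m::{finite,linorder}, 'n::{finite,linorder}) dvar"
  shows "mdeg (fst v) \<le> p \<Longrightarrow> (below (Suc (idx v)) :: ('m, 'n) dvar set) \<subseteq> Gam p"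
  using mdeg_le_if_idx_le[of _ v] order_trans unfolding Gam_def below_def less_Suc_eq_le by blast

lemma dvars_coeff_upoly_below:
  "dvars f \<subseteq> below (Suc (idx v)) \<Longrightarrow> dvars (coeff (upoly v f) d) \<subseteq> below (idx v)"
  using dvars_coeff_upoly[of v f d] by (auto simp: below_Suc)

text \<open>The bound \<open>n'\<close> is abstract because initial segments both with and without
  their last derivative are differentiated.\<close>

lemma dvars_ddiff_below:
  fixes f :: "('k::comm_ring_1, 'm::{finite,linorder}, 'n::{finite,linorder}) dpoly"
  assumes "is_derivation (\<delta> k)" "dvars f \<subseteq> below n"
    "\<And>w :: ('m, 'n) dvar. idx w < n \<Longrightarrow> idx (dshift k w) < n'"
  shows "dvars (ddiff \<delta> k f) \<subseteq> below n'"
proof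
  fix w assume "w \<in> dvars (ddiff \<delta> k f)"
  then have "w \<in> below n \<union> dshift k ` below n"
    using dvars_ddiff[of \<delta> k f "below n"] assms(1,2) by blast
  then obtain u where "idx u < n" "w = u \<or> w = dshift k u"
    unfolding below_def by blast
  then show "w \<in> below n'" using assms(3)[of u] idx_dshift[of u k] by (auto simp: below_def)
qed

text \<open>By the chain rule, \<open>dshift k v\<close> occurs linearly, with the separant of
  \<open>f\<close> with respect to \<open>v\<close> as coefficient; all else ranks lower because
  shifting preserves the ranking.\<close>

lemma ddiff_leading_form:
  assumes d: "is_derivation (\<delta> k)" and f: "dvars f \<subseteq> below (Suc (idx v))"
  shows "\<exists>t. ddiff \<delta> k f = poly (fderiv (upoly v f)) (dvar_poly v) * dvar_poly (dshift k v) + t \<and>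
    dvars t \<subseteq> below (idx (dshift k v))"
proof -
  let ?F = "upoly v f" and ?u = "dshift k v"
  let ?t = "poly (map_poly (ddiff \<delta> k) ?F) (dvar_poly v)"
  have D: "is_derivation (ddiff \<delta> k)" by (rule is_derivation_ddiff[of \<delta> k]) (rule d)
  have "ddiff \<delta> k f = ?t + poly (fderiv ?F) (dvar_poly v) * dvar_poly ?u"
    using is_derivation_poly[OF D, of ?F "dvar_poly v"] ddiff_dvar[of \<delta> k v] d by simp
  moreover have "dvars ?t \<subseteq> below (idx ?u)"
  proof (rule dvars_poly_subset)
    show "dvars (dvar_poly v) \<subseteq> below (idx ?u)"
      using dvars_dvar_poly[of v] idx_dshift[of v k] by (auto simp: below_def)
    fix e
    have "dvars (ddiff \<delta> k (coeff ?F e)) \<subseteq> below (idx ?u)"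
      by (rule dvars_ddiff_below[of \<delta> k, OF d dvars_coeff_upoly_below[OF f]]) (rule idx_dshift_mono)
    then show "dvars (coeff (map_poly (ddiff \<delta> k) ?F) e) \<subseteq> below (idx ?u)"
      by (simp add: coeff_map_poly is_derivation_0[OF D])
  qed
  ultimately show ?thesis by (metis add.commute)
qed

lemma dvars_empty_dconst: "dvars f = {} \<Longrightarrow> \<exists>c. f = dconst (c :: 'k::comm_ring_1)"
proof -
  assume "dvars f = {}"
  then have "dvars f \<subseteq> {}" by simp
  then show ?thesis
    by (induction rule: dpoly_ring_induct) (auto simp flip: dconst_add dconst_mult)
qed

lemma ddiff_0 [simp]: "ddiff \<delta> k 0 = 0"
  by (simp add: ddiff_def)

section \<open>Leaders modulo a prime differential ideal\<close>

locale prime_dideal =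
  fixes \<delta> :: "'m::{finite,linorder} \<Rightarrow> 'k::field_char_0 \<Rightarrow> 'k"
    and P :: "('k, 'm, 'n::{finite,linorder}) dpoly set"
  assumes diff_field: "differential_field \<delta>"
    and P_ideal: "is_ideal P"
    and one_notin: "1 \<notin> P"
    and P_prime: "\<And>f g. f * g \<in> P \<Longrightarrow> f \<in> P \<or> g \<in> P"
    and P_diff: "\<And>f k. f \<in> P \<Longrightarrow> ddiff \<delta> k f \<in> P"
begin

lemma deriv: "is_derivation (\<delta> k)"
  using diff_field by (simp add: differential_field_def)

lemmas P_add = is_ideal_add[OF P_ideal]
lemmas P_mult = is_ideal_mult[OF P_ideal]
lemmas P_diffI = is_ideal_diff[OF P_ideal]
lemmas P_cong = is_ideal_cong[OF P_ideal]

lemma dconst_in_P: "dconst c \<in> P \<Longrightarrow> c = 0"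
  using P_mult[of "dconst c" "dconst (inverse c)"] one_notin
  by (cases "c = 0") (simp_all flip: dconst_mult)

lemma power_notin: "f \<notin> P \<Longrightarrow> f ^ n \<notin> P"
  by (induction n) (auto simp: one_notin dest: P_prime)

text \<open>Characteristic zero enters here: \<open>Suc n\<close> is an invertible constant.\<close>

lemma of_nat_mult_in_P: "of_nat (Suc n) * f \<in> P \<Longrightarrow> f \<in> P"
proof -
  assume *: "of_nat (Suc n) * f \<in> P"
  have "(of_nat j :: ('k, 'm, 'n) dpoly) = dconst (of_nat j)" for j
    by (induction j) (simp_all add: dconst_add)
  with * have "dconst (of_nat (Suc n)) * f \<in> P" by metis
  then have "dconst (inverse (of_nat (Suc n))) * (dconst (of_nat (Suc n)) * f) \<in> P" by (rule P_mult)
  moreover have "dconst (inverse (of_nat (Suc n))) * dconst (of_nat (Suc n) :: 'k) = (1 :: ('k, 'm, 'n) dpoly)"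
    by (simp flip: dconst_mult del: of_nat_Suc)
  ultimately show ?thesis by (simp flip: mult.assoc)
qed

text \<open>A relation of degree \<open>d\<close> for \<open>v\<close> over the lower derivatives.
  Its leading coefficient has to survive modulo \<open>P\<close>, as otherwise the relation could
  become trivial there.\<close>

definition cand :: "('m, 'n) dvar \<Rightarrow> ('k, 'm, 'n) dpoly \<Rightarrow> nat \<Rightarrow> bool" where
  "cand v f d \<longleftrightarrow> f \<in> P \<and> dvars f \<subseteq> below (Suc (idx v)) \<and> degree (upoly v f) = d \<and> 0 < d \<and>
     coeff (upoly v f) d \<notin> P"

text \<open>
  The derivatives that, modulo \<open>P\<close>, are algebraic over the derivatives of lower rank, and the
  degree and a witness of a minimal algebraic relation.
\<close>
definition L :: "('m, 'n) dvar set" where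
  "L = {v. \<exists>f d. cand v f d}"

definition dmin :: "('m, 'n) dvar \<Rightarrow> nat" where
  "dmin v = (LEAST d. \<exists>f. cand v f d)"

definition lead :: "('m, 'n) dvar \<Rightarrow> ('k, 'm, 'n) dpoly" where
  "lead v = (SOME f. cand v f (dmin v))"

definition sep :: "('m, 'n) dvar \<Rightarrow> ('k, 'm, 'n) dpoly" where
  "sep v = poly (fderiv (upoly v (lead v))) (dvar_poly v)"

lemma cand_lead:
  assumes "v \<in> L"
  shows "cand v (lead v) (dmin v)"
proof -
  have "\<exists>f. cand v f (dmin v)"
    unfolding dmin_def by (rule LeastI_ex) (use assms in \<open>auto simp: L_def\<close>)
  then show ?thesis unfolding lead_def by (rule someI_ex)
qed

lemma dmin_le: "cand v f d \<Longrightarrow> dmin v \<le> d"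
  unfolding dmin_def by (rule Least_le) blast

text \<open>If some coefficient were outside \<open>P\<close>, discarding the terms above the last
  such coefficient would leave a relation for \<open>v\<close> that \<open>v \<notin> L\<close> or
  the minimality of \<open>dmin v\<close> forbids.\<close>

lemma coeffs_in_P:
  assumes f: "f \<in> P" "dvars f \<subseteq> below (Suc (idx v))" and deg: "v \<notin> L \<or> degree (upoly v f) < dmin v"
  shows "coeff (upoly v f) d \<in> P"
proof (rule ccontr)
  let ?F = "upoly v f"
  assume "coeff ?F d \<notin> P"
  then obtain e where e: "coeff ?F e \<notin> P" "\<And>i. e < i \<Longrightarrow> coeff ?F i \<in> P"
    using ex_last_coeff_notin[OF P_ideal] by metis
  define G where "G = poly_cutoff (Suc e) ?F"
  have coeff_G: "coeff G i = (if i \<le> e then coeff ?F i else 0)" for i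
    by (simp add: G_def coeff_poly_cutoff)
  have dvars_G: "dvars (coeff G i) \<subseteq> below (idx v)" for i
    using dvars_coeff_upoly_below[OF f(2)] by (simp add: coeff_G)
  define g where "g = poly G (dvar_poly v)"
  have "v \<notin> dvars (coeff G i)" for i using dvars_G[of i] by (auto simp: below_def)
  then have upoly_g: "upoly v g = G" unfolding g_def by (rule upoly_poly)
  have "poly (?F - G) (dvar_poly v) \<in> P"
    by (rule is_ideal_poly[OF P_ideal]) (auto simp: coeff_G e(2) is_ideal_0[OF P_ideal])
  then have "f - g \<in> P" by (simp add: g_def)
  with f(1) P_cong have g: "g \<in> P" by blast
  have "e \<noteq> 0"
  proof
    assume "e = 0"
    then have "G = [:coeff ?F e:]"
      by (intro poly_eqI) (auto simp: coeff_G coeff_pCons split: nat.split)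
    with g e(1) show False by (simp add: g_def)
  qed
  have "degree G = e"
  proof (rule antisym)
    show "degree G \<le> e" by (rule degree_le) (simp add: coeff_G)
    show "e \<le> degree G" using e(1) is_ideal_0[OF P_ideal] by (intro le_degree) (auto simp: coeff_G)
  qed
  moreover have "dvars g \<subseteq> below (Suc (idx v))"
    unfolding g_def using dvars_G below_Suc dvars_dvar_poly[of v]
    by (intro dvars_poly_subset) blast+
  ultimately have "cand v g e"
    using g e(1) \<open>e \<noteq> 0\<close> by (simp add: cand_def upoly_g coeff_G)
  then have "v \<in> L" "dmin v \<le> e" using dmin_le by (auto simp: L_def)
  moreover have "e \<le> degree ?F" using e(1) is_ideal_0[OF P_ideal] by (intro le_degree) auto
  ultimately show False using deg by auto
qed

lemma dvars_sep:
  assumes "v \<in> L"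
  shows "dvars (sep v) \<subseteq> below (Suc (idx v))" "v \<notin> dvars (coeff (fderiv (upoly v (lead v))) d)"
proof -
  have lead: "dvars (lead v) \<subseteq> below (Suc (idx v))" using cand_lead[OF assms] by (simp add: cand_def)
  have dv: "dvars (coeff (fderiv (upoly v (lead v))) d) \<subseteq> below (idx v)" for d
  proof -
    have "dvars (of_nat n * f) \<subseteq> dvars f" for n and f :: "('k, 'm, 'n) dpoly"
    proof (induction n)
      case (Suc n)
      then show ?case using dvars_add[of f "of_nat n * f"] by (auto simp: distrib_right)
    qed simp
    then show ?thesis using dvars_coeff_upoly_below[OF lead] unfolding coeff_fderiv by blast
  qed
  show "v \<notin> dvars (coeff (fderiv (upoly v (lead v))) d)" using dv[of d] by (auto simp: below_def)
  show "dvars (sep v) \<subseteq> below (Suc (idx v))"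
    unfolding sep_def using dv below_Suc dvars_dvar_poly[of v]
    by (intro dvars_poly_subset) blast+
qed

text \<open>The degree of the separant in \<open>v\<close> is below \<open>dmin v\<close>, so
  membership in \<open>P\<close> would put all its coefficients in \<open>P\<close>. The one at
  \<open>dmin v - 1\<close> is \<open>dmin v\<close> times the initial of \<open>lead v\<close>,
  which is outside \<open>P\<close>.\<close>

lemma sep_notin:
  assumes "v \<in> L"
  shows "sep v \<notin> P"
proof
  assume sep: "sep v \<in> P"
  note lead = cand_lead[OF assms, unfolded cand_def]
  have up: "upoly v (sep v) = fderiv (upoly v (lead v))"
    unfolding sep_def by (rule upoly_poly) (rule dvars_sep[OF assms])
  have "degree (fderiv (upoly v (lead v))) \<le> dmin v - 1"
    by (rule degree_le) (use lead in \<open>auto simp: coeff_fderiv coeff_eq_0\<close>)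
  then have "degree (upoly v (sep v)) < dmin v" using up lead by (metis diff_less less_numeral_extra(1) order_le_less_trans)
  then have "coeff (fderiv (upoly v (lead v))) (dmin v - 1) \<in> P"
    using coeffs_in_P[OF sep dvars_sep(1)[OF assms]] up by simp
  then have "coeff (upoly v (lead v)) (dmin v) \<in> P"
    using lead of_nat_mult_in_P[of "dmin v - 1"] by (simp add: coeff_fderiv del: of_nat_Suc)
  with lead show False by blast
qed

definition Lmin :: "('m, 'n) dvar set" where
  "Lmin = {v \<in> L. \<forall>u\<in>L. dvar_le u v \<longrightarrow> u = v}"

lemma Lmin_L: "\<alpha> \<in> Lmin \<Longrightarrow> \<alpha> \<in> L"
  by (simp add: Lmin_def)

lemma Lmin_antichain: "dvar_antichain Lmin"
  by (auto simp: dvar_antichain_def Lmin_def)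

lemma Lmin_below:
  assumes "v \<in> L"
  shows "\<exists>\<alpha>\<in>Lmin. dvar_le \<alpha> v"
  using assms
proof (induction "idx v" arbitrary: v rule: less_induct)
  case less
  show ?case
  proof (cases "v \<in> Lmin")
    case False
    with less.prems obtain u where u: "u \<in> L" "dvar_le u v" "u \<noteq> v" by (auto simp: Lmin_def)
    then have "idx u < idx v" using dvar_le_idx[of u v] by (simp add: idx_inj order_less_le)
    then show ?thesis using less.hyps u dvar_le_trans by blast
  qed (use dvar_le_refl in blast)
qed

text \<open>
  The derivative of \<open>lead \<alpha>\<close> that has leader \<open>u\<close>; because of the truncated subtraction this
  is only meaningful if \<open>dvar_le \<alpha> u\<close>.
\<close>
definition pgen :: "('m, 'n) dvar \<Rightarrow> ('m, 'n) dvar \<Rightarrow> ('k, 'm, 'n) dpoly" where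
  "pgen \<alpha> u = dpow \<delta> (\<lambda>k. fst u k - fst \<alpha> k) (lead \<alpha>)"

lemma pgen_self [simp]: "pgen \<alpha> \<alpha> = lead \<alpha>"
  by (simp add: pgen_def)

lemma pgen_dshift:
  assumes "dvar_le \<alpha> u"
  shows "pgen \<alpha> (dshift k u) = ddiff \<delta> k (pgen \<alpha> u)"
proof -
  have "(\<lambda>l. fst (dshift k u) l - fst \<alpha> l) = mshift k (\<lambda>l. fst u l - fst \<alpha> l)"
    using assms by (auto simp: dshift_def mshift_def dvar_le_def le_fun_def)
  then show ?thesis by (simp add: pgen_def dpow_mshift[OF diff_field])
qed

lemma dvar_le_induct [consumes 1, case_names self shift]:
  fixes \<alpha> u :: "('m, 'n) dvar"
  assumes "dvar_le \<alpha> u" "Q \<alpha>" "\<And>k w. dvar_le \<alpha> w \<Longrightarrow> Q w \<Longrightarrow> Q (dshift k w)"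
  shows "Q u"
  using assms(1)
proof (induction "idx u" arbitrary: u rule: less_induct)
  case less
  show ?case
  proof (cases "\<alpha> = u")
    case False
    with less.prems obtain k w where "u = dshift k w" "dvar_le \<alpha> w" by (rule dvar_le_dshiftE)
    then show ?thesis using less.hyps[of w] idx_dshift assms(3) by blast
  qed (use assms(2) in simp)
qed

lemma pgen_in_P:
  assumes "\<alpha> \<in> L" "dvar_le \<alpha> u"
  shows "pgen \<alpha> u \<in> P"
  using assms(2)
  by (induction rule: dvar_le_induct)
     (use cand_lead[OF assms(1)] in \<open>auto simp: cand_def pgen_dshift P_diff\<close>)

text \<open>One differentiation makes the leader linear with coefficient
  \<open>sep \<alpha>\<close>; further ones keep this form, since the remaining terms of the product
  rule rank lower. The case \<open>u = \<alpha>\<close> is exempt because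
  \<open>lead \<alpha>\<close> may have higher degree.\<close>

lemma pgen_form_dvars:
  assumes "\<alpha> \<in> L" "dvar_le \<alpha> u"
  shows "dvars (pgen \<alpha> u) \<subseteq> below (Suc (idx u)) \<and>
    (u \<noteq> \<alpha> \<longrightarrow> (\<exists>t. pgen \<alpha> u = sep \<alpha> * dvar_poly u + t \<and> dvars t \<subseteq> below (idx u)))"
  using assms(2)
proof (induction rule: dvar_le_induct)
  case self
  then show ?case using cand_lead[OF assms(1)] by (simp add: cand_def)
next
  case (shift k w)
  let ?u = "dshift k w"
  have form: "\<exists>t. pgen \<alpha> ?u = sep \<alpha> * dvar_poly ?u + t \<and> dvars t \<subseteq> below (idx ?u)"
  proof (cases "w = \<alpha>")
    case True
    then show ?thesis
      using ddiff_leading_form[of \<delta> k, OF deriv, of "lead \<alpha>" \<alpha>] cand_lead[OF assms(1)]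
      by (simp add: pgen_dshift sep_def cand_def)
  next
    case False
    then obtain t where t: "pgen \<alpha> w = sep \<alpha> * dvar_poly w + t" "dvars t \<subseteq> below (idx w)"
      using shift by blast
    have lt: "idx \<alpha> < idx w"
      using dvar_le_idx[OF shift(1)] False by (simp add: idx_inj order_less_le)
    let ?t = "ddiff \<delta> k (sep \<alpha>) * dvar_poly w + ddiff \<delta> k t"
    have "pgen \<alpha> ?u = sep \<alpha> * dvar_poly ?u + ?t"
      by (simp add: pgen_dshift[OF shift(1)] t ddiff_add ddiff_mult ddiff_dvar deriv)
    moreover have "dvars ?t \<subseteq> below (idx ?u)"
    proof -
      have "dvars (sep \<alpha>) \<subseteq> below (idx w)"
        using dvars_sep(1)[OF assms(1)] below_mono[of "Suc (idx \<alpha>)" "idx w"] lt by auto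
      moreover have "dvars (ddiff \<delta> k f) \<subseteq> below (idx ?u)" if "dvars f \<subseteq> below (idx w)"
        for f :: "('k, 'm, 'n) dpoly"
        by (rule dvars_ddiff_below[of \<delta> k, OF deriv that]) (rule idx_dshift_mono)
      ultimately have "dvars (ddiff \<delta> k (sep \<alpha>)) \<subseteq> below (idx ?u)" "dvars (ddiff \<delta> k t) \<subseteq> below (idx ?u)"
        using t(2) by blast+
      moreover have "dvars (dvar_poly w) \<subseteq> below (idx ?u)"
        using dvars_dvar_poly[of w] idx_dshift[of w k] by (auto simp: below_def)
      ultimately show ?thesis
        using dvars_add[of "ddiff \<delta> k (sep \<alpha>) * dvar_poly w" "ddiff \<delta> k t"]
          dvars_mult[of "ddiff \<delta> k (sep \<alpha>)" "dvar_poly w"] by blast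
    qed
    ultimately show ?thesis by blast
  qed
  moreover have "dvars (pgen \<alpha> ?u) \<subseteq> below (Suc (idx ?u))"
    unfolding pgen_dshift[OF shift(1)]
    by (rule dvars_ddiff_below[of \<delta> k, OF deriv conjunct1[OF shift(2)]])
       (metis idx_dshift_mono idx_inj less_Suc_eq)
  ultimately show ?case by blast
qed

lemma dvars_pgen: "\<alpha> \<in> L \<Longrightarrow> dvar_le \<alpha> u \<Longrightarrow> dvars (pgen \<alpha> u) \<subseteq> below (Suc (idx u))"
  using pgen_form_dvars by blast

lemma pgen_form:
  assumes "\<alpha> \<in> L" "dvar_le \<alpha> u" "u \<noteq> \<alpha>"
  obtains t where "pgen \<alpha> u = sep \<alpha> * dvar_poly u + t" "dvars t \<subseteq> below (idx u)"
  using pgen_form_dvars assms by blast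

lemma dvars_sep_below:
  assumes "\<alpha> \<in> L" "dvar_le \<alpha> u" "u \<noteq> \<alpha>"
  shows "dvars (sep \<alpha>) \<subseteq> below (idx u)"
proof -
  have "idx \<alpha> < idx u" using dvar_le_idx[OF assms(2)] assms(3) by (simp add: idx_inj order_less_le)
  then show ?thesis using dvars_sep(1)[OF assms(1)] below_mono[of "Suc (idx \<alpha>)" "idx u"] by auto
qed

lemma upoly_pgen:
  assumes "\<alpha> \<in> L" "dvar_le \<alpha> u" "u \<noteq> \<alpha>"
  obtains t where "upoly u (pgen \<alpha> u) = [:t, sep \<alpha>:]" "pgen \<alpha> u = sep \<alpha> * dvar_poly u + t"
    "dvars t \<subseteq> below (idx u)"
proof -
  obtain t where t: "pgen \<alpha> u = sep \<alpha> * dvar_poly u + t" "dvars t \<subseteq> below (idx u)"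
    using pgen_form assms by blast
  have "u \<notin> dvars t" "u \<notin> dvars (sep \<alpha>)"
    using t(2) dvars_sep_below[OF assms] by (auto simp: below_def)
  then have "upoly u (pgen \<alpha> u) = [:t, sep \<alpha>:]"
    by (simp add: t(1) upoly_add upoly_mult upoly_free upoly_dvar_poly_self)
  with t that show thesis by blast
qed

lemma cand_pgen:
  assumes "\<alpha> \<in> L" "dvar_le \<alpha> u" "u \<noteq> \<alpha>"
  shows "cand u (pgen \<alpha> u) 1"
proof -
  obtain t where t: "upoly u (pgen \<alpha> u) = [:t, sep \<alpha>:]" using upoly_pgen[OF assms] by blast
  have "sep \<alpha> \<noteq> 0" using sep_notin[OF assms(1)] is_ideal_0[OF P_ideal] by auto
  then show ?thesis
    using t sep_notin[OF assms(1)] pgen_in_P[OF assms(1,2)] dvars_pgen[OF assms(1,2)]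
    by (simp add: cand_def)
qed

lemma dmin_pos: "v \<in> L \<Longrightarrow> 0 < dmin v"
  using cand_lead by (auto simp: cand_def)

text \<open>So \<open>L\<close> is closed under passing to derivatives, and at a proper derivative a
  degree less than \<open>dmin\<close> means that it does not occur at all.\<close>

lemma dmin_proper:
  assumes "\<alpha> \<in> L" "dvar_le \<alpha> u" "u \<noteq> \<alpha>"
  shows "u \<in> L" "dmin u = 1"
proof -
  show L: "u \<in> L" using cand_pgen[OF assms] by (auto simp: L_def)
  show "dmin u = 1" using dmin_le[OF cand_pgen[OF assms]] dmin_pos[OF L] by simp
qed

lemma cand_pgen_dmin:
  assumes "\<alpha> \<in> L" "dvar_le \<alpha> u"
  shows "cand u (pgen \<alpha> u) (dmin u)"
  using assms cand_lead cand_pgen dmin_proper(2) by (cases "u = \<alpha>") auto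

end

section \<open>The prime differential ideal determined by the elements of low order\<close>

lemma below_pred_iff:
  "below_pred \<eta> \<tau> k \<longleftrightarrow> (\<exists>w. (\<tau>, l) = dshift k w \<and> dvar_le (\<eta>, l) w)"
proof
  assume *: "below_pred \<eta> \<tau> k"
  let ?w = "(\<lambda>j. \<tau> j - munit k j, l)"
  have "(\<tau>, l) = dshift k ?w"
    using * by (auto simp: below_pred_def dshift_def mshift_def munit_def fun_eq_iff)
  moreover have "dvar_le (\<eta>, l) ?w" using * by (simp add: below_pred_def dvar_le_def)
  ultimately show "\<exists>w. (\<tau>, l) = dshift k w \<and> dvar_le (\<eta>, l) w" by blast
next
  assume "\<exists>w. (\<tau>, l) = dshift k w \<and> dvar_le (\<eta>, l) w"
  then show "below_pred \<eta> \<tau> k"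
    by (auto simp: below_pred_def dshift_def mshift_def munit_def dvar_le_def le_fun_def)
qed

lemma ex_mdeg_less:
  "\<exists>v :: ('m::{finite,linorder}, 'n::{finite,linorder}) dvar. p < mdeg (fst v)"
proof (induction p)
  case 0
  have "0 < mdeg (fst (dshift undefined (undefined :: ('m, 'n) dvar)))" by simp
  then show ?case by blast
next
  case (Suc p)
  then obtain v :: "('m, 'n) dvar" where "p < mdeg (fst v)" by blast
  then have "Suc p < mdeg (fst (dshift undefined v))" by simp
  then show ?case by blast
qed

locale truncation = prime_dideal \<delta> P
  for \<delta> :: "'m::{finite,linorder} \<Rightarrow> 'k::field_char_0 \<Rightarrow> 'k"
    and P :: "('k, 'm, 'n::{finite,linorder}) dpoly set" +
  fixes as :: "('m, 'n) dvar list" and p :: nat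
  assumes set_as: "set as = Lmin" and D_cond: "D_condition as p"
begin

definition A :: "('m, 'n) dvar set" where
  "A = Lmin \<inter> Gam p"

lemma Gam_seq_as: "Gam_seq as p = A"
  by (auto simp: Gam_seq_def A_def set_as)

lemma A_L: "\<alpha> \<in> A \<Longrightarrow> \<alpha> \<in> L"
  by (simp add: A_def Lmin_L)

lemma A_Gam: "\<alpha> \<in> A \<Longrightarrow> mdeg (fst \<alpha>) \<le> p"
  by (simp add: A_def Gam_def)

lemma A_antichain: "\<alpha> \<in> A \<Longrightarrow> \<beta> \<in> A \<Longrightarrow> dvar_le \<alpha> \<beta> \<Longrightarrow> \<alpha> = \<beta>"
  using Lmin_antichain by (auto simp: A_def dvar_antichain_def)

text \<open>Inverting these turns the polynomials of order at most \<open>p\<close>, taken modulo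
  \<open>P\<close>, into a field, over which the higher derivatives are adjoined one at a
  time.\<close>

definition Hs :: "('k, 'm, 'n) dpoly set" where
  "Hs = {h. dvars h \<subseteq> Gam p \<and> h \<notin> P}"

definition Pp :: "('k, 'm, 'n) dpoly set" where
  "Pp = {f \<in> P. dvars f \<subseteq> Gam p}"

text \<open>Every stage contains all of \<open>Pp\<close>; only the derivatives of the chosen
  elements are filtered by rank. At \<open>v\<close>, the strictly lower ones are those of
  \<open>J (idx v)\<close>.\<close>

definition J :: "nat \<Rightarrow> ('k, 'm, 'n) dpoly set" where
  "J n = sat Hs (Pp \<union> {pgen \<alpha> u | \<alpha> u. \<alpha> \<in> A \<and> dvar_le \<alpha> u \<and> idx u < n})"

lemma J_ideal: "is_ideal (J n)"
  by (simp add: J_def is_ideal_sat)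

lemma J_mono: "n \<le> n' \<Longrightarrow> J n \<subseteq> J n'"
  unfolding J_def using less_le_trans[of _ n n'] by (intro sat_mono) blast

lemma J_div: "h \<in> Hs \<Longrightarrow> h * f \<in> J n \<Longrightarrow> f \<in> J n"
  unfolding J_def by (rule sat.div)

lemma Pp_J: "f \<in> Pp \<Longrightarrow> f \<in> J n"
  unfolding J_def by (rule sat.gen) simp

lemma pgen_J: "\<alpha> \<in> A \<Longrightarrow> dvar_le \<alpha> u \<Longrightarrow> idx u < n \<Longrightarrow> pgen \<alpha> u \<in> J n"
  unfolding J_def by (rule sat.gen) blast

lemma J_induct [consumes 1, case_names zero Pp pgen add mult div]:
  assumes "f \<in> J n" "Q 0" "\<And>f. f \<in> Pp \<Longrightarrow> Q f"
    "\<And>\<alpha> u. \<alpha> \<in> A \<Longrightarrow> dvar_le \<alpha> u \<Longrightarrow> idx u < n \<Longrightarrow> Q (pgen \<alpha> u)"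
    "\<And>f g. f \<in> J n \<Longrightarrow> Q f \<Longrightarrow> g \<in> J n \<Longrightarrow> Q g \<Longrightarrow> Q (f + g)"
    "\<And>f c. f \<in> J n \<Longrightarrow> Q f \<Longrightarrow> Q (c * f)"
    "\<And>h f. h \<in> Hs \<Longrightarrow> h * f \<in> J n \<Longrightarrow> Q (h * f) \<Longrightarrow> Q f"
  shows "Q f"
  using assms(1) unfolding J_def
proof (induction rule: sat.induct)
  case (gen g)
  then show ?case using assms(3,4) by auto
next
  case (add f g)
  then show ?case using assms(5) by (simp add: J_def)
next
  case (mult f c)
  then show ?case using assms(6) by (simp add: J_def)
next
  case (div h f)
  then show ?case using assms(7) by (simp add: J_def)
qed (rule assms(2))

lemma J_subset_P: "f \<in> J n \<Longrightarrow> f \<in> P"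
proof (induction rule: J_induct)
  case (div h f)
  then show ?case using P_prime by (auto simp: Hs_def)
qed (auto simp: Pp_def A_L pgen_in_P P_add P_mult is_ideal_0[OF P_ideal])

lemma Hs_mult: "h \<in> Hs \<Longrightarrow> h' \<in> Hs \<Longrightarrow> h * h' \<in> Hs"
  using dvars_mult[of h h'] P_prime by (auto simp: Hs_def)

lemma Hs_one: "1 \<in> Hs"
  by (simp add: Hs_def one_notin)

lemma Hs_power: "h \<in> Hs \<Longrightarrow> h ^ n \<in> Hs"
  by (induction n) (auto simp: Hs_one Hs_mult)

lemma sep_Hs: "\<alpha> \<in> A \<Longrightarrow> sep \<alpha> \<in> Hs"
  using dvars_sep(1)[OF A_L] below_Suc_subset_Gam[OF A_Gam] sep_notin[OF A_L]
  unfolding Hs_def by blast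

text \<open>By induction along the ranking, \<open>f\<close> is pseudo-divided by
  \<open>pgen \<alpha> v\<close> at its highest possible derivative \<open>v\<close>, if
  \<open>v\<close> is in \<open>L\<close>. The derivative of \<open>pgen \<alpha> v\<close> is a
  generator, and the remainder has coefficients in \<open>P\<close> of lower rank.\<close>

lemma ddiff_Pp:
  assumes "f \<in> P" "dvars f \<subseteq> Gam p" "dvars f \<subseteq> below n"
    "\<And>u :: ('m, 'n) dvar. idx u < n \<Longrightarrow> idx (dshift k u) < n'"
  shows "ddiff \<delta> k f \<in> J n'"
  using assms
proof (induction n arbitrary: f)
  case 0
  then have "dvars f = {}" by (simp add: below_def)
  then obtain c where "f = dconst c" using dvars_empty_dconst by blast
  moreover from this 0 have "c = 0" using dconst_in_P by blast
  ultimately have "f = 0" by simp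
  then show ?case by (simp add: is_ideal_0[OF J_ideal])
next
  case (Suc n)
  obtain v :: "('m, 'n) dvar" where v: "idx v = n" using ex_idx by blast
  have below: "below (Suc n) = insert v (below n)" using below_Suc[of v] v by simp
  have shift: "idx (dshift k u) < n'" if "idx u < n" for u :: "('m, 'n) dvar"
    using Suc.prems(4) that by simp
  show ?case
  proof (cases "mdeg (fst v) \<le> p")
    case False
    then have "v \<notin> dvars f" using Suc.prems(2) by (auto simp: Gam_def)
    then have "dvars f \<subseteq> below n" using Suc.prems(3) below by auto
    with Suc.prems shift show ?thesis by (intro Suc.IH) auto
  next
    case True
    then have Gam: "below (Suc n) \<subseteq> (Gam p :: ('m, 'n) dvar set)"
      using below_Suc_subset_Gam v by blast
    let ?X = "dvar_poly v :: ('k, 'm, 'n) dpoly"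
    have D: "is_derivation (ddiff \<delta> k :: ('k, 'm, 'n) dpoly \<Rightarrow> _)"
      by (rule is_derivation_ddiff[of \<delta> k]) (rule deriv)
    \<comment> \<open>By the chain rule only the coefficients and their derivatives matter, and the
      latter are covered by induction.\<close>
    have low: "ddiff \<delta> k (poly R ?X) \<in> J n'"
      if R: "\<And>d. coeff R d \<in> P" "\<And>d. dvars (coeff R d) \<subseteq> below n" for R
    proof -
      have "ddiff \<delta> k (coeff R d) \<in> J n'" for d
        using R[of d] Gam below shift by (intro Suc.IH) auto
      then have "poly (map_poly (ddiff \<delta> k) R) ?X \<in> J n'"
        by (intro is_ideal_poly[OF J_ideal]) (simp add: coeff_map_poly)
      moreover have "coeff R d \<in> J n'" for d
        using R[of d] Gam below by (intro Pp_J) (auto simp: Pp_def)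
      then have "poly (fderiv R) ?X \<in> J n'"
        unfolding coeff_fderiv
        by (intro is_ideal_poly[OF J_ideal]) (simp add: coeff_fderiv is_ideal_mult[OF J_ideal] del: of_nat_Suc)
      ultimately show ?thesis
        unfolding is_derivation_poly[OF D, of R ?X]
        by (intro is_ideal_add[OF J_ideal] is_ideal_mult_right[OF J_ideal])
    qed
    have dF: "dvars (coeff (upoly v f) d) \<subseteq> below n" for d
      using dvars_coeff_upoly_below[of f v] Suc.prems(3) v by blast
    show ?thesis
    proof (cases "v \<in> L")
      case False
      have "coeff (upoly v f) d \<in> P" for d
        using coeffs_in_P[of f v d] Suc.prems False v by simp
      then show ?thesis using low[of "upoly v f"] dF by simp
    next
      case L: True
      obtain \<alpha> where "\<alpha> \<in> Lmin" and \<alpha>: "dvar_le \<alpha> v" using Lmin_below[OF L] by blast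
      then have "\<alpha> \<in> A" using dvar_le_mdeg[OF \<alpha>] True by (simp add: A_def Gam_def)
      let ?b = "pgen \<alpha> v"
      let ?B = "upoly v ?b"
      let ?i = "lead_coeff ?B"
      have cand: "cand v ?b (dmin v)"
        by (rule cand_pgen_dmin[OF A_L[OF \<open>\<alpha> \<in> A\<close>] \<alpha>])
      then have b: "?b \<in> P" "dvars ?b \<subseteq> below (Suc n)" and B: "degree ?B = dmin v" "0 < degree ?B" "?i \<notin> P"
        by (auto simp: cand_def v)
      have dB: "dvars (coeff ?B d) \<subseteq> below n" for d
        using dvars_coeff_upoly_below[of ?b v] b(2) v by blast
      obtain N Q R where R: "smult (?i ^ N) (upoly v f) = Q * ?B + R" "degree R < degree ?B"
        "\<forall>d. dvars (coeff R d) \<subseteq> below n"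
        using pseudo_division[OF B(2) dF dB] by blast
      have eq: "?i ^ N * f = poly Q ?X * ?b + poly R ?X"
        using arg_cong[OF R(1), of "\<lambda>F. poly F ?X"] by simp
      have "poly R ?X = ?i ^ N * f - poly Q ?X * ?b" using eq by simp
      then have r_P: "poly R ?X \<in> P" using P_diffI P_mult Suc.prems(1) b(1) by auto
      have "v \<notin> dvars (coeff R d)" for d using R(3) v by (auto simp: below_def)
      then have up: "upoly v (poly R ?X) = R" by (rule upoly_poly)
      have "dvars (poly R ?X) \<subseteq> below (Suc (idx v))"
        using R(3) below v dvars_dvar_poly[of v] by (intro dvars_poly_subset) blast+
      then have "coeff R d \<in> P" for d
        using coeffs_in_P[OF r_P, of v d] up R(2) B(1) by simp
      with R(3) have "ddiff \<delta> k (poly R ?X) \<in> J n'" by (intro low) auto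
      moreover have "ddiff \<delta> k (poly Q ?X * ?b) \<in> J n'"
      proof -
        have "?b \<in> J n'" using b Gam by (intro Pp_J) (auto simp: Pp_def)
        moreover have "ddiff \<delta> k ?b \<in> J n'"
          using pgen_J[OF \<open>\<alpha> \<in> A\<close>, of "dshift k v"] dvar_le_trans[OF \<alpha> dvar_le_dshift]
            Suc.prems(4)[of v] v pgen_dshift[OF \<alpha>] by auto
        ultimately show ?thesis
          by (simp add: ddiff_mult deriv is_ideal_add[OF J_ideal] is_ideal_mult[OF J_ideal])
      qed
      ultimately have "ddiff \<delta> k (?i ^ N * f) \<in> J n'"
        unfolding eq by (simp add: ddiff_add deriv is_ideal_add[OF J_ideal])
      moreover have "f \<in> J n'" using Suc.prems by (intro Pp_J) (simp add: Pp_def)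
      \<comment> \<open>The product rule leaves a multiple of \<open>f\<close>, which is in
        \<open>J n'\<close> because \<open>f\<close> is; the power of the initial is then divided
        out.\<close>
      ultimately have "?i ^ N * ddiff \<delta> k f \<in> J n'"
        using is_ideal_diff[OF J_ideal _ is_ideal_mult[OF J_ideal, of f n' "ddiff \<delta> k (?i ^ N)"]]
        by (fastforce simp: ddiff_mult deriv)
      moreover have "?i ^ N \<in> Hs"
        using dB[of "degree ?B"] below Gam B(3) by (intro Hs_power) (auto simp: Hs_def)
      ultimately show ?thesis by (rule J_div[rotated])
    qed
  qed
qed

text \<open>Shifting preserves the ranking, so generators below \<open>w\<close> become generators
  below \<open>dshift k w\<close>. Low-order elements lie below \<open>w\<close> because of its
  degree, so \<open>ddiff_Pp\<close> applies to them. For a quotient, the term with the derivative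
  of the denominator is a multiple of \<open>f\<close>.\<close>

lemma ddiff_J:
  fixes w :: "('m, 'n) dvar"
  assumes f: "f \<in> J (idx w)" and w: "p < mdeg (fst w)"
  shows "ddiff \<delta> k f \<in> J (idx (dshift k w))"
  using f
proof (induction rule: J_induct)
  case zero
  then show ?case by (simp add: is_ideal_0[OF J_ideal])
next
  case (Pp f)
  then have "dvars f \<subseteq> below (idx w)" using Gam_subset_below[OF w] by (auto simp: Pp_def)
  with Pp show ?case
    using idx_dshift_mono by (intro ddiff_Pp[of f "idx w"]) (simp_all add: Pp_def)
next
  case (pgen \<alpha> u)
  show ?case
    unfolding pgen_dshift[OF pgen(2), symmetric]
    by (intro pgen_J pgen(1) idx_dshift_mono pgen(3) dvar_le_trans[OF pgen(2) dvar_le_dshift])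
next
  case (add f g)
  then show ?case by (simp add: ddiff_add deriv is_ideal_add[OF J_ideal])
next
  case (mult f c)
  then have "f \<in> J (idx (dshift k w))" using J_mono[of "idx w"] idx_dshift less_imp_le by blast
  with mult show ?case
    by (simp add: ddiff_mult deriv is_ideal_add[OF J_ideal] is_ideal_mult[OF J_ideal])
next
  case (div h f)
  have "f \<in> J (idx w)" using div J_div by blast
  then have "f \<in> J (idx (dshift k w))" using J_mono[of "idx w"] idx_dshift less_imp_le by blast
  then have "ddiff \<delta> k (h * f) - ddiff \<delta> k h * f \<in> J (idx (dshift k w))"
    using div is_ideal_diff[OF J_ideal] is_ideal_mult[OF J_ideal] by blast
  then have "h * ddiff \<delta> k f \<in> J (idx (dshift k w))" by (simp add: ddiff_mult deriv)
  with div show ?case using J_div by blast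
qed

text \<open>The Delta-polynomial of two chosen elements at a common derivative \<open>v\<close>. If
  \<open>v\<close> is a proper derivative of both leaders, the terms in \<open>v\<close> cancel;
  coherence asks for membership in the stage strictly below \<open>v\<close>.\<close>

definition coh :: "('m, 'n) dvar \<Rightarrow> ('m, 'n) dvar \<Rightarrow> ('m, 'n) dvar \<Rightarrow> bool" where
  "coh v \<alpha> \<beta> \<longleftrightarrow> sep \<beta> * pgen \<alpha> v - sep \<alpha> * pgen \<beta> v \<in> J (idx v)"

lemma coh_refl: "coh v \<alpha> \<alpha>"
  by (simp add: coh_def is_ideal_0[OF J_ideal])

lemma coh_sym: "coh v \<alpha> \<beta> \<Longrightarrow> coh v \<beta> \<alpha>"
  unfolding coh_def using is_ideal_uminus[OF J_ideal] by fastforce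

text \<open>Eliminating \<open>pgen \<beta> v\<close> leaves the factor \<open>sep \<beta>\<close>,
  which the saturation removes because \<beta> is in \<open>A\<close>.\<close>

lemma coh_trans:
  assumes "\<beta> \<in> A" "coh v \<alpha> \<beta>" "coh v \<beta> \<gamma>"
  shows "coh v \<alpha> \<gamma>"
proof -
  have "sep \<gamma> * (sep \<beta> * pgen \<alpha> v - sep \<alpha> * pgen \<beta> v) + sep \<alpha> * (sep \<gamma> * pgen \<beta> v - sep \<beta> * pgen \<gamma> v)
      \<in> J (idx v)"
    using assms by (intro is_ideal_add[OF J_ideal] is_ideal_mult[OF J_ideal]) (simp_all add: coh_def)
  moreover have "sep \<gamma> * (sep \<beta> * pgen \<alpha> v - sep \<alpha> * pgen \<beta> v) + sep \<alpha> * (sep \<gamma> * pgen \<beta> v - sep \<beta> * pgen \<gamma> v)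
      = sep \<beta> * (sep \<gamma> * pgen \<alpha> v - sep \<alpha> * pgen \<gamma> v)"
    by (simp add: algebra_simps)
  ultimately show ?thesis unfolding coh_def using J_div[OF sep_Hs[OF assms(1)]] by metis
qed

text \<open>
  Differentiating the coherence relation at \<open>w\<close>, or, if \<open>w\<close> has degree at most \<open>p\<close>, a relation
  that lies in \<open>P\<close> and has order at most \<open>p\<close>.
\<close>
lemma coh_dshift:
  assumes v: "p < mdeg (fst (dshift k w))"
    and \<alpha>: "\<alpha> \<in> A" "dvar_le \<alpha> w" and \<beta>: "\<beta> \<in> A" "dvar_le \<beta> w"
    and w: "p < mdeg (fst w) \<Longrightarrow> coh w \<alpha> \<beta>"
  shows "coh (dshift k w) \<alpha> \<beta>"
proof (cases "\<alpha> = \<beta>")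
  case True
  then show ?thesis by (simp add: coh_refl)
next
  case False
  \<comment> \<open>If \<open>w\<close> were one of the two, the antichain condition would make them
    equal. Hence both \<open>pgen\<close> are linear in \<open>w\<close>, and these terms cancel in
    \<open>?c\<close>.\<close>
  have ne: "w \<noteq> \<alpha>" "w \<noteq> \<beta>" using False A_antichain \<alpha> \<beta> by blast+
  let ?v = "dshift k w"
  let ?c = "sep \<beta> * pgen \<alpha> w - sep \<alpha> * pgen \<beta> w"
  have D: "ddiff \<delta> k ?c \<in> J (idx ?v)"
  proof (cases "p < mdeg (fst w)")
    case True
    then show ?thesis using w ddiff_J unfolding coh_def by blast
  next
    case low: False
    obtain t where t: "pgen \<alpha> w = sep \<alpha> * dvar_poly w + t" "dvars t \<subseteq> below (idx w)"
      using pgen_form[OF A_L[OF \<alpha>(1)] \<alpha>(2) ne(1)] by blast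
    obtain t' where t': "pgen \<beta> w = sep \<beta> * dvar_poly w + t'" "dvars t' \<subseteq> below (idx w)"
      using pgen_form[OF A_L[OF \<beta>(1)] \<beta>(2) ne(2)] by blast
    have "?c = sep \<beta> * t - sep \<alpha> * t'" by (simp add: t(1) t'(1) algebra_simps)
    then have c: "dvars ?c \<subseteq> below (idx w)"
      using dvars_diff[of "sep \<beta> * t" "sep \<alpha> * t'"] dvars_mult[of "sep \<beta>" t] dvars_mult[of "sep \<alpha>" t']
        t(2) t'(2) dvars_sep_below[OF A_L[OF \<alpha>(1)] \<alpha>(2) ne(1)]
        dvars_sep_below[OF A_L[OF \<beta>(1)] \<beta>(2) ne(2)]
      by (simp only:) blast
    have "below (idx w) \<subseteq> (Gam p :: ('m, 'n) dvar set)"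
      using below_Suc_subset_Gam[of w p] below_Suc[of w] low by auto
    with c have "dvars ?c \<subseteq> Gam p" by blast
    moreover have "?c \<in> P"
      using pgen_in_P A_L \<alpha> \<beta> by (intro P_diffI P_mult) auto
    ultimately show ?thesis using c idx_dshift_mono by (intro ddiff_Pp[of ?c "idx w"])
  qed
  \<comment> \<open>The product rule also produces multiples of these undifferentiated elements;
    their leader \<open>w\<close> is below \<open>?v\<close>, so they can be subtracted.\<close>
  have "pgen \<alpha> w \<in> J (idx ?v)" "pgen \<beta> w \<in> J (idx ?v)"
    using \<alpha> \<beta> by (auto intro!: pgen_J idx_dshift)
  then have "ddiff \<delta> k ?c - ddiff \<delta> k (sep \<beta>) * pgen \<alpha> w + ddiff \<delta> k (sep \<alpha>) * pgen \<beta> w \<in> J (idx ?v)"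
    by (intro is_ideal_add[OF J_ideal] is_ideal_diff[OF J_ideal] is_ideal_mult[OF J_ideal] D)
  moreover have "ddiff \<delta> k (f - g) = ddiff \<delta> k f - ddiff \<delta> k g" for f g :: "('k, 'm, 'n) dpoly"
    using ddiff_add[of \<delta> k "f - g" g] deriv by simp
  ultimately show ?thesis
    by (simp add: coh_def pgen_dshift \<alpha>(2) \<beta>(2) ddiff_mult deriv)
qed

text \<open>
  The condition defining \<open>D_num\<close> provides exactly the chains through which the relation between
  two minimal leaders at their least common derivative follows from relations at lower derivatives.
\<close>
lemma coherence:
  assumes "p < mdeg (fst v)" "\<alpha> \<in> A" "\<beta> \<in> A" "dvar_le \<alpha> v" "dvar_le \<beta> v"
  shows "coh v \<alpha> \<beta>"
  using assms
proof (induction "mdeg (fst v)" arbitrary: v \<alpha> \<beta> rule: less_induct)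
  case less
  obtain \<tau> l where v: "v = (\<tau>, l)" by (cases v)
  have shift: "coh v \<gamma> \<gamma>'"
    if "\<gamma> \<in> A" "\<gamma>' \<in> A" "v = dshift k w" "dvar_le \<gamma> w" "dvar_le \<gamma>' w" for k w \<gamma> \<gamma>'
    using coh_dshift[of k w \<gamma> \<gamma>'] less.hyps[of w \<gamma> \<gamma>'] less.prems(1) that by simp
  \<comment> \<open>The predecessor of \<open>v\<close> in direction \<open>k\<close> is unique, so
    it lies above both elements.\<close>
  have pred: "coh v (\<eta>, l) (\<eta>', l)"
    if A: "(\<eta>, l) \<in> A" "(\<eta>', l) \<in> A" and below: "below_pred \<eta> \<tau> k" "below_pred \<eta>' \<tau> k" for \<eta> \<eta>' k
  proof -
    obtain w where w: "v = dshift k w" "dvar_le (\<eta>, l) w"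
      using below(1) below_pred_iff[of \<eta> \<tau> k l] v by blast
    moreover obtain w' where w': "v = dshift k w'" "dvar_le (\<eta>', l) w'"
      using below(2) below_pred_iff[of \<eta>' \<tau> k l] v by blast
    moreover have "w = w'"
      using w(1) w'(1) by (auto simp: dshift_def mshift_def prod_eq_iff fun_eq_iff)
    ultimately show ?thesis using shift A by blast
  qed
  have pred_le: "dvar_le (\<eta>, l) v" if "below_pred \<eta> \<tau> k" for \<eta> k
    using that below_pred_iff[of \<eta> \<tau> k l] v dvar_le_trans dvar_le_dshift by metis
  \<comment> \<open>If the least upper bound is properly below \<open>v\<close>, some predecessor of
    \<open>v\<close> lies above both elements.\<close>
  have lub: "coh v (\<eta>, l) (\<eta>', l)"
    if A: "(\<eta>, l) \<in> A" "(\<eta>', l) \<in> A" and le: "dvar_le (\<eta>, l) v" "dvar_le (\<eta>', l) v"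
      and ne: "mlub \<eta> \<eta>' \<noteq> \<tau>" for \<eta> \<eta>'
  proof -
    have "dvar_le (mlub \<eta> \<eta>', l) v"
      using le by (simp add: dvar_le_def v mlub_def le_fun_def)
    moreover have "(mlub \<eta> \<eta>', l) \<noteq> v" using ne v by simp
    ultimately obtain k w where w: "v = dshift k w" "dvar_le (mlub \<eta> \<eta>', l) w"
      by (rule dvar_le_dshiftE)
    have "dvar_le (\<eta>, l) (mlub \<eta> \<eta>', l)" "dvar_le (\<eta>', l) (mlub \<eta> \<eta>', l)"
      by (simp_all add: dvar_le_def mlub_def le_fun_def)
    then show ?thesis using shift[OF A w(1)] w(2) dvar_le_trans by blast
  qed
  have main: "coh v (\<eta>, l) (\<eta>', l)"
    if A: "(\<eta>, l) \<in> A" "(\<eta>', l) \<in> A"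
      and below: "below_pred \<eta> \<tau> i" "below_pred \<eta>' \<tau> j" and "i < j" for \<eta> \<eta>' i j
  proof (cases "\<eta> = \<eta>' \<or> mlub \<eta> \<eta>' \<noteq> \<tau>")
    case True
    then show ?thesis using coh_refl lub[OF A] pred_le below by blast
  next
    case False
    then have "(\<tau>, l) \<in> gam (Gam_seq as p) - Gam p"
      using A less.prems(1) unfolding Gam_seq_as by (auto simp: gam_def Gam_def v)
    then have "\<exists>\<eta>s ks. \<eta>s \<noteq> [] \<and> length ks = length \<eta>s \<and> hd ks = i \<and> last ks = j \<and>
        (\<forall>t < length \<eta>s. (\<eta>s ! t, l) \<in> A \<and> below_pred (\<eta>s ! t) \<tau> (ks ! t)) \<and>
        (\<forall>t. Suc t < length \<eta>s \<longrightarrow> mdeg (mlub (\<eta>s ! t) (\<eta>s ! Suc t)) \<le> p)"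
      by (intro D_cond[unfolded D_condition_def, rule_format, unfolded Gam_seq_as, of \<tau> l i j])
         (use A below \<open>i < j\<close> in \<open>auto simp: Gam_seq_as\<close>)
    then obtain \<eta>s ks where chain: "\<eta>s \<noteq> []" "length ks = length \<eta>s" "hd ks = i" "last ks = j"
      and mem: "\<And>t. t < length \<eta>s \<Longrightarrow> (\<eta>s ! t, l) \<in> A \<and> below_pred (\<eta>s ! t) \<tau> (ks ! t)"
      and step: "\<And>t. Suc t < length \<eta>s \<Longrightarrow> mdeg (mlub (\<eta>s ! t) (\<eta>s ! Suc t)) \<le> p"
      by (elim exE conjE) blast
    have "coh v (\<eta>, l) (\<eta>s ! t, l)" if "t < length \<eta>s" for t
      using that
    proof (induction t)
      case 0
      have "ks ! 0 = i" using chain by (metis hd_conv_nth length_0_conv)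
      then show ?case using pred[OF A(1) _ below(1)] mem[OF 0] by auto
    next
      case (Suc t)
      \<comment> \<open>Consecutive elements of the chain have a least upper bound of degree at most
        \<open>p\<close>, less than that of \<open>v\<close>, so every link has a common
        predecessor.\<close>
      have "mlub (\<eta>s ! t) (\<eta>s ! Suc t) \<noteq> \<tau>"
        using step[OF Suc.prems] less.prems(1) by (auto simp: v)
      then have "coh v (\<eta>s ! t, l) (\<eta>s ! Suc t, l)"
        using mem[of t] mem[of "Suc t"] Suc.prems pred_le by (intro lub) auto
      moreover have "(\<eta>s ! t, l) \<in> A" "coh v (\<eta>, l) (\<eta>s ! t, l)"
        using Suc mem[of t] by simp_all
      ultimately show ?case using coh_trans by blast
    qed
    from this[of "length \<eta>s - 1"] have "coh v (\<eta>, l) (last \<eta>s, l)"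
      using chain(1) by (simp add: last_conv_nth)
    moreover have last: "(last \<eta>s, l) \<in> A" "below_pred (last \<eta>s) \<tau> j"
    proof -
      have "ks \<noteq> []" using chain by auto
      then show "(last \<eta>s, l) \<in> A" "below_pred (last \<eta>s) \<tau> j"
        using mem[of "length \<eta>s - 1"] chain by (auto simp: last_conv_nth)
    qed
    ultimately show ?thesis using pred[OF last(1) A(2) last(2) below(2)] coh_trans by blast
  qed
  obtain \<eta> \<eta>' where \<alpha>\<beta>: "\<alpha> = (\<eta>, l)" "\<beta> = (\<eta>', l)"
    using less.prems(4,5) by (cases \<alpha>; cases \<beta>) (auto simp: dvar_le_def v)
  have "\<alpha> \<noteq> v" "\<beta> \<noteq> v" using A_Gam less.prems by (metis not_le)+
  then obtain i w j w' where "v = dshift i w" "dvar_le \<alpha> w" "v = dshift j w'" "dvar_le \<beta> w'"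
    using less.prems(4,5) dvar_le_dshiftE by metis
  then have "below_pred \<eta> \<tau> i" "below_pred \<eta>' \<tau> j"
    unfolding below_pred_iff[of _ _ _ l] using \<alpha>\<beta> v by metis+
  \<comment> \<open>\<open>D_condition\<close> treats only \<open>i < j\<close>; equal directions
    give a common predecessor, and the remaining case follows by symmetry.\<close>
  then show ?case
    using main pred coh_sym less.prems(2,3) unfolding \<alpha>\<beta> by (metis linorder_less_linear)
qed

section \<open>Elimination of derivatives of degree above \<open>p\<close>\<close>

lemma J_coeff:
  assumes f: "f \<in> J (idx v)" and v: "p < mdeg (fst v)"
  shows "coeff (upoly v f) d \<in> J (idx v)"
proof -
  have "v \<notin> Gam p" using v by (simp add: Gam_def)
  moreover have "v \<notin> dvars (pgen \<alpha> u)" if "\<alpha> \<in> A" "dvar_le \<alpha> u" "idx u < idx v" for \<alpha> u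
    using dvars_pgen[OF A_L[OF that(1)] that(2)] that(3) by (auto simp: below_def)
  ultimately show ?thesis
    using f unfolding J_def by (rule_tac sat_coeff_upoly) (auto simp: Pp_def Hs_def)
qed

lemma J_Suc_free:
  assumes "\<And>\<alpha>. \<alpha> \<in> A \<Longrightarrow> \<not> dvar_le \<alpha> v"
  shows "J (Suc (idx v)) = J (idx v)"
proof -
  have "\<alpha> \<in> A \<and> dvar_le \<alpha> u \<and> idx u < Suc (idx v) \<longleftrightarrow>
      \<alpha> \<in> A \<and> dvar_le \<alpha> u \<and> idx u < idx v" for \<alpha> u
    using assms[of \<alpha>] idx_inj[of u v] by (auto simp: less_Suc_eq)
  then show ?thesis unfolding J_def by (simp only:)
qed

text \<open>By coherence, all generators with leader \<open>v\<close> can be replaced, up to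
  denominators, by multiples of the single element \<open>?e\<close>. It is linear in
  \<open>v\<close> and its leading coefficient is a denominator, so a polynomial without
  \<open>v\<close> can be a multiple of it modulo \<open>J (idx v)\<close> only by lying in
  \<open>J (idx v)\<close>.\<close>

lemma J_eliminate:
  assumes f: "f \<in> J (Suc (idx v))" "v \<notin> dvars f" and v: "p < mdeg (fst v)"
  shows "f \<in> J (idx v)"
proof (cases "\<exists>\<alpha>\<in>A. dvar_le \<alpha> v")
  case False
  then show ?thesis using f J_Suc_free by blast
next
  case True
  then obtain \<alpha> where \<alpha>: "\<alpha> \<in> A" "dvar_le \<alpha> v" by blast
  let ?e = "pgen \<alpha> v"
  have "\<exists>h\<in>Hs. \<exists>c. h * f - c * ?e \<in> J (idx v)"
    using f(1)
  proof (induction rule: J_induct)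
    case zero
    then show ?case using Hs_one is_ideal_0[OF J_ideal] by (intro bexI[of _ 1] exI[of _ 0]) auto
  next
    case (Pp f)
    then show ?case using Hs_one Pp_J by (intro bexI[of _ 1] exI[of _ 0]) auto
  next
    case (pgen \<beta> u)
    show ?case
    proof (cases "u = v")
      case True
      then have "sep \<alpha> * pgen \<beta> u - sep \<beta> * ?e \<in> J (idx v)"
        using coherence[OF v pgen(1) \<alpha>(1) _ \<alpha>(2)] pgen(2) by (simp add: coh_def)
      then show ?thesis using sep_Hs[OF \<alpha>(1)] by blast
    next
      case False
      then have "idx u < idx v" using pgen(3) idx_inj[of u v] by (simp add: less_Suc_eq)
      then have "pgen \<beta> u \<in> J (idx v)" using pgen by (intro pgen_J)
      then show ?thesis using Hs_one by (intro bexI[of _ 1] exI[of _ 0]) auto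
    qed
  next
    case (add f g)
    then obtain h c h' c' where hc: "h \<in> Hs" "h * f - c * ?e \<in> J (idx v)"
      "h' \<in> Hs" "h' * g - c' * ?e \<in> J (idx v)" by blast
    then have "h' * (h * f - c * ?e) + h * (h' * g - c' * ?e) \<in> J (idx v)"
      by (intro is_ideal_add[OF J_ideal] is_ideal_mult[OF J_ideal])
    moreover have "h' * (h * f - c * ?e) + h * (h' * g - c' * ?e) =
        (h * h') * (f + g) - (h' * c + h * c') * ?e" by (simp add: algebra_simps)
    ultimately show ?case using Hs_mult[OF hc(1,3)] by metis
  next
    case (mult f c')
    then obtain h c where hc: "h \<in> Hs" "h * f - c * ?e \<in> J (idx v)" by blast
    then have "c' * (h * f - c * ?e) \<in> J (idx v)" by (intro is_ideal_mult[OF J_ideal])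
    moreover have "c' * (h * f - c * ?e) = h * (c' * f) - (c' * c) * ?e" by (simp add: algebra_simps)
    ultimately show ?case using hc(1) by metis
  next
    case (div h' f)
    then obtain h c where hc: "h \<in> Hs" "h * (h' * f) - c * ?e \<in> J (idx v)" by blast
    then have "(h * h') * f - c * ?e \<in> J (idx v)" by (simp add: mult.assoc)
    then show ?case using Hs_mult[OF hc(1) div(1)] by blast
  qed
  then obtain h c where hc: "h \<in> Hs" "h * f - c * ?e \<in> J (idx v)" by blast
  have "v \<noteq> \<alpha>" using A_Gam[OF \<alpha>(1)] v by auto
  then obtain t where t: "upoly v ?e = [:t, sep \<alpha>:]"
    using upoly_pgen[OF A_L[OF \<alpha>(1)] \<alpha>(2)] by blast
  have "v \<notin> dvars (h * f)"
    using dvars_mult[of h f] f(2) hc(1) v by (auto simp: Hs_def Gam_def)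
  then have "upoly v (h * f) = [:h * f:]" by (rule upoly_free)
  then have "upoly v (h * f - c * ?e) = [:h * f:] - upoly v c * [:t, sep \<alpha>:]"
    unfolding upoly_diff upoly_mult[of v c] t by (rule arg_cong)
  then have "coeff ([:h * f:] - upoly v c * [:t, sep \<alpha>:]) d \<in> J (idx v)" for d
    using J_coeff[OF hc(2) v, of d] by metis
  moreover have "a \<in> J (idx v)" if "sep \<alpha> * a \<in> J (idx v)" for a
    using J_div[OF sep_Hs[OF \<alpha>(1)] that] .
  ultimately have "h * f \<in> J (idx v)"
    using const_in_ideal_if_linear_multiple[OF J_ideal, of "sep \<alpha>" "idx v" "h * f" "upoly v c" t] by blast
  then show ?thesis using J_div[OF hc(1)] by blast
qed

text \<open>Elimination from the top down: derivatives outside \<open>below m\<close> have degree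
  above \<open>p\<close>, because \<open>below m\<close> contains \<open>Gam p\<close>.\<close>

lemma J_descend:
  assumes f: "f \<in> J n" "dvars f \<subseteq> below m" and m: "Gam p \<subseteq> (below m :: ('m, 'n) dvar set)"
  shows "f \<in> J m"
  using f(1)
proof (induction n)
  case 0
  then show ?case using J_mono[of 0 m] by blast
next
  case (Suc n)
  obtain v :: "('m, 'n) dvar" where v: "idx v = n" using ex_idx by blast
  show ?case
  proof (cases "Suc n \<le> m")
    case True
    then show ?thesis using J_mono Suc.prems by blast
  next
    case False
    then have "v \<notin> below m" using v by (simp add: below_def)
    then have "v \<notin> dvars f" "v \<notin> Gam p" using f(2) m by blast+
    then show ?thesis using J_eliminate[of f v] Suc v by (simp add: Gam_def)
  qed
qed

section \<open>The ideal \<open>Q\<close>: closure under the derivations and primality\<close>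

definition Q :: "('k, 'm, 'n) dpoly set" where
  "Q = (\<Union>n. J n)"

lemma Q_subset_P: "Q \<subseteq> P"
  using J_subset_P by (auto simp: Q_def)

lemma Pp_subset_Q: "Pp \<subseteq> Q"
  using Pp_J by (auto simp: Q_def)

lemma J_Q: "f \<in> J n \<Longrightarrow> f \<in> Q"
  by (auto simp: Q_def)

lemma Q_ideal: "is_ideal Q"
  unfolding is_ideal_def
proof (intro conjI ballI allI)
  show "0 \<in> Q" using is_ideal_0[OF J_ideal] J_Q by blast
next
  fix f g assume "f \<in> Q" "g \<in> Q"
  then obtain i j where "f \<in> J i" "g \<in> J j" by (auto simp: Q_def)
  then have "f \<in> J (max i j)" "g \<in> J (max i j)"
    using J_mono[of i "max i j"] J_mono[of j "max i j"] by auto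
  then show "f + g \<in> Q" using is_ideal_add[OF J_ideal] J_Q by blast
next
  fix f c assume "f \<in> Q"
  then show "c * f \<in> Q" using is_ideal_mult[OF J_ideal] by (auto simp: Q_def)
qed

lemma Q_div: "h \<in> Hs \<Longrightarrow> h * f \<in> Q \<Longrightarrow> f \<in> Q"
  using J_div by (auto simp: Q_def)

lemma Q_diff:
  assumes "f \<in> Q"
  shows "ddiff \<delta> k f \<in> Q"
proof -
  obtain n where n: "f \<in> J n" using assms by (auto simp: Q_def)
  obtain w0 :: "('m, 'n) dvar" where w0: "p < mdeg (fst w0)" using ex_mdeg_less by blast
  \<comment> \<open>The stage is raised until its derivative \<open>w\<close> has degree above
    \<open>p\<close>, as \<open>ddiff_J\<close> requires.\<close>
  obtain w :: "('m, 'n) dvar" where w: "idx w = max n (idx w0)" using ex_idx by blast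
  have "mdeg (fst w0) \<le> mdeg (fst w)" by (rule mdeg_le_if_idx_le) (simp add: w)
  with w0 have "p < mdeg (fst w)" by simp
  moreover have "f \<in> J (idx w)" using n J_mono[of n "idx w"] w by auto
  ultimately show ?thesis using ddiff_J J_Q by blast
qed

text \<open>On polynomials of order at most \<open>p\<close>, \<open>Q\<close> agrees with the prime
  ideal \<open>P\<close>. A higher derivative is either free, and Gauss's argument extends
  primality, or determined by a linear relation with an invertible leading coefficient, and it can
  be substituted away.\<close>

lemma Q_prime_below:
  assumes "f * g \<in> Q" "dvars f \<subseteq> Gam p \<union> below n" "dvars g \<subseteq> Gam p \<union> below n"
  shows "f \<in> Q \<or> g \<in> Q"
  using assms
proof (induction n arbitrary: f g)
  case 0
  then have "f * g \<in> P" "dvars f \<subseteq> Gam p" "dvars g \<subseteq> Gam p"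
    using Q_subset_P by (auto simp: below_def)
  then show ?case using P_prime[of f g] Pp_subset_Q by (auto simp: Pp_def)
next
  case (Suc n)
  obtain v :: "('m, 'n) dvar" where v: "idx v = n" using ex_idx by blast
  have below: "below (Suc n) = insert v (below n)" using below_Suc[of v] v by simp
  show ?case
  proof (cases "p < mdeg (fst v)")
    case False
    then have "Gam p \<union> below (Suc n) = Gam p \<union> (below n :: ('m, 'n) dvar set)"
      unfolding below by (auto simp: Gam_def)
    with Suc show ?thesis by metis
  next
    case high: True
    have Gam: "Gam p \<subseteq> (below n :: ('m, 'n) dvar set)" using Gam_subset_below[OF high] v by simp
    have f: "dvars f \<subseteq> below (Suc (idx v))" and g: "dvars g \<subseteq> below (Suc (idx v))"
      using Suc.prems(2,3) Gam below v by auto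
    have IH: "a \<in> Q \<or> b \<in> Q" if "a * b \<in> Q" "dvars a \<subseteq> below n" "dvars b \<subseteq> below n" for a b
      using Suc.IH[of a b] that Gam by blast
    show ?thesis
    proof (cases "\<exists>\<alpha>\<in>A. dvar_le \<alpha> v")
      case False
      have J_Suc: "J (Suc n) = J n" using J_Suc_free[of v] False v by auto
      have coeff: "dvars (coeff (upoly v f) d) \<subseteq> below n" "dvars (coeff (upoly v g) d) \<subseteq> below n" for d
        using dvars_coeff_upoly_below f g v by blast+
      have "dvars (f * g) \<subseteq> below (Suc n)"
        using dvars_mult[of f g] f g v by blast
      moreover have "Gam p \<subseteq> (below (Suc n) :: ('m, 'n) dvar set)" using Gam below by blast
      moreover obtain n' where "f * g \<in> J n'" using Suc.prems(1) by (auto simp: Q_def)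
      \<comment> \<open>Membership in \<open>Q\<close> has to be brought down to a stage whose
        generators avoid \<open>v\<close>, where it passes to the coefficients.\<close>
      ultimately have "f * g \<in> J (Suc n)" using J_descend by blast
      then have fg: "coeff (upoly v f * upoly v g) d \<in> J n" for d
        using J_coeff[OF _ high, of "f * g" d] v J_Suc by (simp add: upoly_mult)
      have "coeff (upoly v f) d \<in> J n \<or> coeff (upoly v g) e \<in> J n"
        if "coeff (upoly v f) d * coeff (upoly v g) e \<in> J n" for d e
      proof -
        have "coeff (upoly v f) d \<in> Q \<or> coeff (upoly v g) e \<in> Q"
          using IH[OF J_Q[OF that] coeff] .
        then show ?thesis using J_descend[OF _ _ Gam] coeff by (auto simp: Q_def)
      qed
      then have "(\<forall>d. coeff (upoly v f) d \<in> J n) \<or> (\<forall>d. coeff (upoly v g) d \<in> J n)"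
        by (rule coeffs_in_ideal_prime[OF J_ideal _ fg])
      then have "f \<in> J n \<or> g \<in> J n"
        using is_ideal_poly[OF J_ideal, of "upoly v f" n "dvar_poly v"]
          is_ideal_poly[OF J_ideal, of "upoly v g" n "dvar_poly v"] by auto
      then show ?thesis using J_Q by blast
    next
      case True
      then obtain \<alpha> where \<alpha>: "\<alpha> \<in> A" "dvar_le \<alpha> v" by blast
      let ?e = "pgen \<alpha> v"
      have "v \<noteq> \<alpha>" using A_Gam[OF \<alpha>(1)] high by auto
      then obtain t where t: "upoly v ?e = [:t, sep \<alpha>:]" "dvars t \<subseteq> below n"
        using upoly_pgen[OF A_L[OF \<alpha>(1)] \<alpha>(2)] v by metis
      have s: "sep \<alpha> \<noteq> 0" using sep_notin[OF A_L[OF \<alpha>(1)]] is_ideal_0[OF P_ideal] by auto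
      have ds: "dvars (sep \<alpha>) \<subseteq> below n"
        using sep_Hs[OF \<alpha>(1)] Gam by (auto simp: Hs_def)
      have eQ: "?e \<in> Q" using pgen_J[OF \<alpha>, of "Suc (idx v)"] J_Q by blast
      have reduce: "\<exists>N a'. sep \<alpha> ^ N * a - a' \<in> Q \<and> dvars a' \<subseteq> below n"
        if "dvars a \<subseteq> below (Suc (idx v))" for a
      proof -
        have "0 < degree [:t, sep \<alpha>:]" using s by simp
        moreover have "dvars (coeff (upoly v a) d) \<subseteq> below n" for d
          using dvars_coeff_upoly_below that v by blast
        moreover have "dvars (coeff [:t, sep \<alpha>:] d) \<subseteq> below n" for d
          using t(2) ds by (auto simp: coeff_pCons split: nat.split)
        ultimately obtain N F R where R: "smult (lead_coeff [:t, sep \<alpha>:] ^ N) (upoly v a) = F * [:t, sep \<alpha>:] + R"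
          "degree R < degree [:t, sep \<alpha>:]" "\<forall>d. dvars (coeff R d) \<subseteq> below n"
          using pseudo_division[of "[:t, sep \<alpha>:]" "upoly v a" "below n"] by blast
        have "degree R = 0" using R(2) s by simp
        then obtain a' where a': "R = [:a':]" by (rule degree_eq_zeroE)
        have "poly [:t, sep \<alpha>:] (dvar_poly v) = ?e" using t(1) poly_upoly by metis
        moreover have "lead_coeff [:t, sep \<alpha>:] = sep \<alpha>" using s by simp
        ultimately have "sep \<alpha> ^ N * a - a' = poly F (dvar_poly v) * ?e"
          using arg_cong[OF R(1), of "\<lambda>F. poly F (dvar_poly v)"]
          by (simp only: poly_smult poly_add poly_mult poly_upoly a') simp
        then have "sep \<alpha> ^ N * a - a' \<in> Q" using eQ is_ideal_mult[OF Q_ideal] by simp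
        moreover have "dvars a' \<subseteq> below n" using R(3)[rule_format, of 0] by (simp add: a')
        ultimately show ?thesis by blast
      qed
      obtain M f' where f': "sep \<alpha> ^ M * f - f' \<in> Q" "dvars f' \<subseteq> below n" using reduce[OF f] by blast
      obtain N g' where g': "sep \<alpha> ^ N * g - g' \<in> Q" "dvars g' \<subseteq> below n" using reduce[OF g] by blast
      have "(sep \<alpha> ^ M * f) * (sep \<alpha> ^ N * g) \<in> Q"
        using is_ideal_mult[OF Q_ideal Suc.prems(1), of "sep \<alpha> ^ M * sep \<alpha> ^ N"] by (simp add: ac_simps)
      moreover have "(sep \<alpha> ^ M * f) * (sep \<alpha> ^ N * g) - f' * g' \<in> Q"
      proof -
        have "(sep \<alpha> ^ N * g) * (sep \<alpha> ^ M * f - f') + f' * (sep \<alpha> ^ N * g - g') \<in> Q"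
          using f'(1) g'(1) by (intro is_ideal_add[OF Q_ideal] is_ideal_mult[OF Q_ideal])
        then show ?thesis by (simp add: algebra_simps)
      qed
      ultimately have "f' * g' \<in> Q" using is_ideal_cong[OF Q_ideal] by blast
      then have "f' \<in> Q \<or> g' \<in> Q" using IH f'(2) g'(2) by blast
      then have "sep \<alpha> ^ M * f \<in> Q \<or> sep \<alpha> ^ N * g \<in> Q"
        using is_ideal_cong[OF Q_ideal] f'(1) g'(1) by blast
      then show ?thesis using Q_div[OF Hs_power[OF sep_Hs[OF \<alpha>(1)]]] by blast
    qed
  qed
qed

lemma finite_subset_below:
  assumes "finite (W :: ('m, 'n) dvar set)"
  shows "\<exists>n. W \<subseteq> below n"
proof -
  have "w \<in> below (Suc (Max (idx ` W)))" if "w \<in> W" for w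
    using that assms by (simp add: below_def less_Suc_eq_le)
  then show ?thesis by blast
qed

lemma Q_prime:
  assumes "f * g \<in> Q"
  shows "f \<in> Q \<or> g \<in> Q"
proof -
  obtain n where "dvars f \<union> dvars g \<subseteq> below n"
    using finite_subset_below[of "dvars f \<union> dvars g"] by auto
  then show ?thesis using Q_prime_below[OF assms, of n] by blast
qed

text \<open>If \<alpha> had degree above \<open>p\<close>, no generator would have leader \<alpha>,
  so \<open>lead \<alpha>\<close> would descend to the stage strictly below \<alpha>. Its
  coefficients in powers of \<alpha>, the initial included, would then all lie in
  \<open>P\<close>.\<close>

lemma Lmin_subset_Gam_if_Q_eq_P:
  assumes "Q = P"
  shows "Lmin \<subseteq> Gam p"
proof
  fix \<alpha> assume \<alpha>: "\<alpha> \<in> Lmin"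
  show "\<alpha> \<in> Gam p"
  proof (rule ccontr)
    assume notin: "\<alpha> \<notin> Gam p"
    then have high: "p < mdeg (fst \<alpha>)" by (simp add: Gam_def)
    have free: "\<not> dvar_le \<beta> \<alpha>" if "\<beta> \<in> A" for \<beta>
      using that notin \<alpha> Lmin_antichain by (auto simp: A_def dvar_antichain_def)
    note cand = cand_lead[OF Lmin_L[OF \<alpha>], unfolded cand_def]
    then obtain n where "lead \<alpha> \<in> J n" using assms by (auto simp: Q_def)
    moreover have "Gam p \<subseteq> (below (Suc (idx \<alpha>)) :: ('m, 'n) dvar set)"
      using Gam_subset_below[OF high] below_Suc by blast
    ultimately have "lead \<alpha> \<in> J (Suc (idx \<alpha>))" using cand J_descend by blast
    then have "lead \<alpha> \<in> J (idx \<alpha>)" using J_Suc_free[OF free] by simp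
    then have "coeff (upoly \<alpha> (lead \<alpha>)) (dmin \<alpha>) \<in> P"
      using J_coeff[OF _ high] J_subset_P by blast
    with cand show False by blast
  qed
qed

end

section \<open>Characteristic sets\<close>

lemma degree_in_zero [simp]: "degree_in 0 v = 0"
  by (simp add: degree_in_def)

lemma degree_in_poly_other:
  fixes F :: "('k::comm_ring_1, 'm, 'n) dpoly poly"
  assumes "w \<noteq> v" "0 < d" "\<And>i. degree_in (coeff F i) w < d"
  shows "degree_in (poly F (dvar_poly v)) w < d"
  using assms(3)
proof (induction F)
  case (pCons a F)
  have "degree_in (poly F (dvar_poly v)) w < d"
    using pCons.prems[of "Suc _"] by (intro pCons.IH) simp
  then have "degree (smult (dvar_poly v) (upoly w (poly F (dvar_poly v)))) < d"
    using degree_smult_le[of "dvar_poly v" "upoly w (poly F (dvar_poly v))"]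
    by (simp add: degree_upoly)
  moreover have "degree (upoly w a) < d" using pCons.prems[of 0] by (simp add: degree_upoly)
  ultimately show ?case
    using assms(1) by (simp add: upoly_add upoly_mult upoly_dvar_poly_other degree_add_less flip: degree_upoly)
qed (use assms(2) in simp)

lemma degree_in_coeff_upoly: "degree_in (coeff (upoly v f) d) w \<le> degree_in f w"
proof -
  have "Poly_Mapping.lookup M w \<le> degree_in f w" if "M \<in> Poly_Mapping.keys (coeff (upoly v f) d)" for M
  proof -
    have "M + Poly_Mapping.single v d \<in> Poly_Mapping.keys f"
      using that by (auto simp: in_keys_iff lookup_coeff_upoly split: if_splits)
    then have "Poly_Mapping.lookup (M + Poly_Mapping.single v d) w \<le> degree_in f w"
      unfolding degree_in_def by (intro Max_ge) auto
    then show ?thesis by (simp add: lookup_add)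
  qed
  then show ?thesis
    unfolding degree_in_def[of "coeff (upoly v f) d"] by (intro Max.boundedI) auto
qed

lemma leader_eqI:
  assumes "v \<in> dvars f" "dvars f \<subseteq> below (Suc (idx v))"
  shows "leader f = v"
  unfolding leader_def
proof (rule the_equality)
  have less: "ranking_less w v" if "w \<in> dvars f" "w \<noteq> v" for w
  proof -
    have "w \<in> below (idx v)" using that assms(2) below_Suc by blast
    then show ?thesis by (simp add: below_def idx_less_iff)
  qed
  show "v \<in> dvars f \<and> (\<forall>w\<in>dvars f. w \<noteq> v \<longrightarrow> ranking_less w v)" using assms(1) less by blast
  show "u = v" if "u \<in> dvars f \<and> (\<forall>w\<in>dvars f. w \<noteq> u \<longrightarrow> ranking_less w u)" for u
    using that less[of u] assms(1) ranking_less_asym[of u v] by metis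
qed

lemma leader_props:
  fixes f :: "('k::zero, 'm::{finite,linorder}, 'n::{finite,linorder}) dpoly"
  assumes "dvars f \<noteq> {}"
  shows "leader f \<in> dvars f" "dvars f \<subseteq> below (Suc (idx (leader f)))"
proof -
  have fin: "finite (idx ` dvars f)" by (simp add: dvars_def)
  then have "Max (idx ` dvars f) \<in> idx ` dvars f" using assms by (intro Max_in) auto
  then obtain v where v: "v \<in> dvars f" "idx v = Max (idx ` dvars f)" by auto
  have "idx w < Suc (idx v)" if "w \<in> dvars f" for w
    using that fin v(2) by (simp add: less_Suc_eq_le)
  then have sub: "dvars f \<subseteq> below (Suc (idx v))" unfolding below_def by blast
  have "leader f = v" using v(1) sub by (rule leader_eqI)
  with v(1) sub show "leader f \<in> dvars f" "dvars f \<subseteq> below (Suc (idx (leader f)))" by auto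
qed

section \<open>Reduction modulo \<open>P\<close>\<close>

context prime_dideal
begin

text \<open>The condition ranges over all of \<open>L\<close>, not only over \<open>Lmin\<close>:
  where \<open>dmin\<close> is 1, as at proper derivatives of elements of \<open>L\<close>, it
  forbids the derivative outright.\<close>

definition reduced :: "('k, 'm, 'n) dpoly \<Rightarrow> bool" where
  "reduced f \<longleftrightarrow> (\<forall>w\<in>L. degree_in f w < dmin w)"

lemma reduced_zero: "reduced 0"
  by (simp add: reduced_def dmin_pos)

text \<open>Minimality puts all coefficients in powers of the highest derivative into
  \<open>P\<close>, and they inherit reducedness; descending the ranking leaves constants, and
  \<open>P\<close> contains none but zero.\<close>

lemma reduced_in_P:
  assumes "f \<in> P" "reduced f"
  shows "f = 0"
proof -
  have "f = 0" if "dvars f \<subseteq> below n" "f \<in> P" "reduced f" for n f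
    using that
  proof (induction n arbitrary: f)
    case 0
    then have "dvars f = {}" by (simp add: below_def)
    then obtain c where c: "f = dconst c" using dvars_empty_dconst by blast
    with 0 have "c = 0" using dconst_in_P by blast
    with c show ?case by simp
  next
    case (Suc n)
    obtain v :: "('m, 'n) dvar" where v: "idx v = n" using ex_idx by blast
    have "v \<notin> L \<or> degree (upoly v f) < dmin v"
      using Suc.prems(3) by (auto simp: reduced_def degree_upoly)
    then have in_P: "coeff (upoly v f) d \<in> P" for d
      using coeffs_in_P[of f v d] Suc.prems v by simp
    have "reduced (coeff (upoly v f) d)" for d
      using Suc.prems(3) degree_in_coeff_upoly[of v f d] unfolding reduced_def
      by (meson le_less_trans)
    moreover have "dvars (coeff (upoly v f) d) \<subseteq> below n" for d
      using dvars_coeff_upoly_below[of f v d] Suc.prems(1) v by simp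
    ultimately have "coeff (upoly v f) d = 0" for d using Suc.IH in_P by blast
    then have "upoly v f = 0" by (intro poly_eqI) simp
    then show ?case using poly_upoly[of v f] by simp
  qed
  moreover have "\<exists>n. dvars f \<subseteq> below n"
  proof (cases "dvars f = {}")
    case False
    then show ?thesis using leader_props(2) by blast
  qed simp
  ultimately show ?thesis using assms by blast
qed

text \<open>The members of \<open>C\<close> will be coefficients of one polynomial, so a single
  multiplier \<open>h\<close> has to serve them all.\<close>

lemma reduce_in_variable:
  assumes "finite C" "\<And>c. c \<in> C \<Longrightarrow> dvars c \<subseteq> below (Suc (idx v))"
  shows "\<exists>h R. h \<notin> P \<and> (\<forall>c\<in>C. h * c - poly (R c) (dvar_poly v) \<in> P \<and>
    (v \<in> L \<longrightarrow> degree (R c) < dmin v) \<and> (\<forall>d. dvars (coeff (R c) d) \<subseteq> below (idx v)))"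
proof (cases "v \<in> L")
  case False
  moreover have "dvars (coeff (upoly v c) d) \<subseteq> below (idx v)" if "c \<in> C" for c d
    using dvars_coeff_upoly_below[OF assms(2)[OF that]] .
  ultimately show ?thesis
    using one_notin is_ideal_0[OF P_ideal] by (intro exI[of _ 1] exI[of _ "upoly v"]) simp
next
  case True
  let ?B = "upoly v (lead v)" and ?X = "dvar_poly v :: ('k, 'm, 'n) dpoly"
  let ?i = "lead_coeff ?B"
  have B: "lead v \<in> P" "degree ?B = dmin v" "0 < degree ?B" "?i \<notin> P" "dvars (coeff ?B d) \<subseteq> below (idx v)" for d
    using cand_lead[OF True] dvars_coeff_upoly_below[of "lead v" v d] by (auto simp: cand_def)
  have "\<exists>N R. ?i ^ N * c - poly R ?X \<in> P \<and> degree R < dmin v \<and> (\<forall>d. dvars (coeff R d) \<subseteq> below (idx v))"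
    if c: "c \<in> C" for c
  proof -
    have "dvars (coeff (upoly v c) d) \<subseteq> below (idx v)" for d
      using dvars_coeff_upoly_below assms(2)[OF c] by blast
    then obtain N Q R where R: "smult (?i ^ N) (upoly v c) = Q * ?B + R" "degree R < degree ?B"
      "\<forall>d. dvars (coeff R d) \<subseteq> below (idx v)"
      using pseudo_division[of ?B "upoly v c" "below (idx v)"] B by blast
    have "?i ^ N * c - poly R ?X = poly Q ?X * lead v"
      using arg_cong[OF R(1), of "\<lambda>F. poly F ?X"] by simp
    then have "?i ^ N * c - poly R ?X \<in> P" using P_mult B(1) by simp
    with R B(2) show ?thesis by auto
  qed
  then obtain N R where R: "\<And>c. c \<in> C \<Longrightarrow> ?i ^ N c * c - poly (R c) ?X \<in> P"
    "\<And>c. c \<in> C \<Longrightarrow> degree (R c) < dmin v" "\<And>c d. c \<in> C \<Longrightarrow> dvars (coeff (R c) d) \<subseteq> below (idx v)"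
    by metis
  \<comment> \<open>The exponents needed differ, so each remainder is multiplied by the missing
    power of the initial.\<close>
  define M where "M = Max (insert 0 (N ` C))"
  define R' where "R' c = smult (?i ^ (M - N c)) (R c)" for c
  have "?i ^ M * c - poly (R' c) ?X \<in> P" if "c \<in> C" for c
  proof -
    have "N c \<le> M" unfolding M_def using assms(1) that by (intro Max_ge) auto
    then have "?i ^ M * c - poly (R' c) ?X = ?i ^ (M - N c) * (?i ^ N c * c - poly (R c) ?X)"
      by (simp add: R'_def right_diff_distrib flip: power_add mult.assoc)
    then show ?thesis using P_mult R(1)[OF that] by simp
  qed
  moreover have "degree (R' c) < dmin v" if "c \<in> C" for c
    using R(2)[OF that] degree_smult_le[of "?i ^ (M - N c)" "R c"] by (simp add: R'_def)
  moreover have "dvars (coeff (R' c) d) \<subseteq> below (idx v)" if "c \<in> C" for c d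
    using R(3)[OF that, of d] B(5)[of "degree ?B"] dvars_power[of ?i "M - N c"]
      dvars_mult[of "?i ^ (M - N c)" "coeff (R c) d"] unfolding R'_def coeff_smult by blast
  ultimately show ?thesis
    using power_notin[OF B(4)] by (intro exI[of _ "?i ^ M"] exI[of _ R']) blast
qed

text \<open>Reducing in the top derivative produces a new finite family of coefficients of lower
  rank; hence the induction is over families instead of single polynomials.\<close>

lemma reduce_family:
  assumes "finite C" "\<And>c. c \<in> C \<Longrightarrow> dvars c \<subseteq> below n"
  shows "\<exists>h red. h \<notin> P \<and> (\<forall>c\<in>C. h * c - red c \<in> P \<and> dvars (red c) \<subseteq> below n \<and> reduced (red c))"
  using assms
proof (induction n arbitrary: C)
  case 0
  have "reduced c" if "c \<in> C" for c
    using 0(2)[OF that] dmin_pos degree_in_eq_0_iff[of c] by (auto simp: reduced_def below_def)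
  with 0 show ?case
    using one_notin is_ideal_0[OF P_ideal] by (intro exI[of _ 1] exI[of _ "\<lambda>c. c"]) auto
next
  case (Suc n)
  obtain v :: "('m, 'n) dvar" where v: "idx v = n" using ex_idx by blast
  let ?X = "dvar_poly v :: ('k, 'm, 'n) dpoly"
  obtain h R where h: "h \<notin> P" and R: "\<And>c. c \<in> C \<Longrightarrow> h * c - poly (R c) ?X \<in> P"
    "\<And>c. c \<in> C \<Longrightarrow> v \<in> L \<Longrightarrow> degree (R c) < dmin v"
    "\<And>c d. c \<in> C \<Longrightarrow> dvars (coeff (R c) d) \<subseteq> below n"
    using reduce_in_variable[of C v] Suc.prems v by metis
  define C' where "C' = (\<Union>c\<in>C. coeff (R c) ` {..degree (R c)})"
  have "finite C'" using Suc.prems(1) by (simp add: C'_def)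
  moreover have "dvars c \<subseteq> below n" if "c \<in> C'" for c
    using that R(3) unfolding C'_def by blast
  ultimately obtain h' red where h': "h' \<notin> P"
    and red': "\<forall>c\<in>C'. h' * c - red c \<in> P \<and> dvars (red c) \<subseteq> below n \<and> reduced (red c)"
    using Suc.IH[of C'] by blast
  have C': "coeff (R c) d \<in> C'" if "c \<in> C" "d \<le> degree (R c)" for c d
    using that by (auto simp: C'_def)
  define R' where "R' c = (\<Sum>d\<le>degree (R c). monom (red (coeff (R c) d)) d)" for c
  have coeff_R': "coeff (R' c) d = (if d \<le> degree (R c) then red (coeff (R c) d) else 0)" for c d
    by (simp add: R'_def coeff_sum)
  have R'_P: "h' * coeff (R c) d - coeff (R' c) d \<in> P" if "c \<in> C" for c d
    using red' C'[OF that, of d] is_ideal_0[OF P_ideal] by (simp add: coeff_R' coeff_eq_0)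
  have R'_dvars: "dvars (coeff (R' c) d) \<subseteq> below n" if "c \<in> C" for c d
    using red' C'[OF that, of d] by (simp add: coeff_R')
  have R'_red: "reduced (coeff (R' c) d)" if "c \<in> C" for c d
    using red' C'[OF that, of d] reduced_zero by (simp add: coeff_R')
  have "h' * h * c - poly (R' c) ?X \<in> P" if "c \<in> C" for c
  proof -
    have "poly (smult h' (R c) - R' c) ?X \<in> P"
      using R'_P[OF that] by (intro is_ideal_poly[OF P_ideal]) simp
    then have "h' * (h * c - poly (R c) ?X) + poly (smult h' (R c) - R' c) ?X \<in> P"
      using P_mult[OF R(1)[OF that]] P_add by blast
    then show ?thesis by (simp add: algebra_simps)
  qed
  moreover have "dvars (poly (R' c) ?X) \<subseteq> below (Suc n)" if "c \<in> C" for c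
    using R'_dvars[OF that] below_Suc[of v] v dvars_dvar_poly[of v]
    by (intro dvars_poly_subset) blast+
  moreover have "reduced (poly (R' c) ?X)" if c: "c \<in> C" for c
    unfolding reduced_def
  proof
    fix w assume w: "w \<in> L"
    show "degree_in (poly (R' c) ?X) w < dmin w"
    proof (cases "w = v")
      case True
      have "v \<notin> dvars (coeff (R' c) d)" for d using R'_dvars[OF c, of d] v by (auto simp: below_def)
      then have "upoly v (poly (R' c) ?X) = R' c" by (rule upoly_poly)
      moreover have "degree (R' c) \<le> degree (R c)" by (rule degree_le) (simp add: coeff_R')
      ultimately show ?thesis using R(2)[OF c] w True by (simp flip: degree_upoly)
    next
      case False
      then show ?thesis
        using R'_red[OF c] w dmin_pos by (intro degree_in_poly_other) (auto simp: reduced_def)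
    qed
  qed
  moreover have "h' * h \<notin> P" using h h' P_prime by blast
  ultimately show ?case by (intro exI[of _ "h' * h"] exI[of _ "\<lambda>c. poly (R' c) ?X"]) blast
qed

text \<open>Reducing only the coefficients of \<open>lead v\<close> keeps its degree in
  \<open>v\<close>; the new initial is congruent to \<open>h\<close> times the old one and so stays
  outside \<open>P\<close>.\<close>

lemma ex_reduced_lead:
  assumes "v \<in> L"
  shows "\<exists>a. cand v a (dmin v) \<and> (\<forall>w\<in>L. w \<noteq> v \<longrightarrow> degree_in a w < dmin w)"
proof -
  let ?F = "upoly v (lead v)" and ?X = "dvar_poly v :: ('k, 'm, 'n) dpoly"
  note lead = cand_lead[OF assms, unfolded cand_def]
  have "dvars c \<subseteq> below (idx v)" if "c \<in> coeff ?F ` {..dmin v}" for c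
    using lead that dvars_coeff_upoly_below by blast
  then obtain h red where h: "h \<notin> P" and "\<forall>c\<in>coeff ?F ` {..dmin v}.
      h * c - red c \<in> P \<and> dvars (red c) \<subseteq> below (idx v) \<and> reduced (red c)"
    using reduce_family[of "coeff ?F ` {..dmin v}" "idx v"] by blast
  then have red: "h * coeff ?F d - red (coeff ?F d) \<in> P" "dvars (red (coeff ?F d)) \<subseteq> below (idx v)"
    "reduced (red (coeff ?F d))" if "d \<le> dmin v" for d
    using that by auto
  define F where "F = (\<Sum>d\<le>dmin v. monom (red (coeff ?F d)) d)"
  have coeff_F: "coeff F d = (if d \<le> dmin v then red (coeff ?F d) else 0)" for d
    by (simp add: F_def coeff_sum)
  have dvars_F: "dvars (coeff F d) \<subseteq> below (idx v)" for d
    using red(2)[of d] by (simp add: coeff_F)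
  let ?a = "poly F ?X"
  have "v \<notin> dvars (coeff F d)" for d using dvars_F[of d] by (auto simp: below_def)
  then have up: "upoly v ?a = F" by (rule upoly_poly)
  have hF: "h * coeff ?F d - coeff F d \<in> P" for d
    using red(1)[of d] lead is_ideal_0[OF P_ideal] by (simp add: coeff_F coeff_eq_0)
  then have "poly (smult h ?F - F) ?X \<in> P" by (intro is_ideal_poly[OF P_ideal]) simp
  then have "h * lead v - ?a \<in> P" by simp
  then have a_P: "?a \<in> P" using P_cong P_mult lead by blast
  have top: "coeff F (dmin v) \<notin> P"
    using hF[of "dmin v"] P_cong P_prime h lead by blast
  have "degree F = dmin v"
  proof (rule antisym)
    show "degree F \<le> dmin v" by (rule degree_le) (simp add: coeff_F)
    show "dmin v \<le> degree F" using top is_ideal_0[OF P_ideal] by (intro le_degree) auto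
  qed
  moreover have "dvars ?a \<subseteq> below (Suc (idx v))"
    using dvars_F below_Suc[of v] dvars_dvar_poly[of v] by (intro dvars_poly_subset) blast+
  ultimately have "cand v ?a (dmin v)"
    using a_P top dmin_pos[OF assms] by (simp add: cand_def up)
  moreover have "degree_in ?a w < dmin w" if "w \<in> L" "w \<noteq> v" for w
    using that dmin_pos red(3) by (intro degree_in_poly_other) (auto simp: coeff_F reduced_def)
  ultimately show ?thesis by blast
qed

section \<open>The characteristic set\<close>

definition rlead :: "('m, 'n) dvar \<Rightarrow> ('k, 'm, 'n) dpoly" where
  "rlead v = (SOME a. cand v a (dmin v) \<and> (\<forall>w\<in>L. w \<noteq> v \<longrightarrow> degree_in a w < dmin w))"

lemma rlead:
  assumes "v \<in> L"
  shows "cand v (rlead v) (dmin v)" "w \<in> L \<Longrightarrow> w \<noteq> v \<Longrightarrow> degree_in (rlead v) w < dmin w"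
  using someI_ex[OF ex_reduced_lead[OF assms]] unfolding rlead_def by blast+

lemma rlead_leader:
  assumes "v \<in> L"
  shows "degree_in (rlead v) v = dmin v" "v \<in> dvars (rlead v)" "leader (rlead v) = v"
    "dvars (rlead v) \<subseteq> below (Suc (idx v))"
proof -
  note cand = rlead(1)[OF assms, unfolded cand_def]
  show deg: "degree_in (rlead v) v = dmin v" using cand by (simp flip: degree_upoly)
  show dvars: "dvars (rlead v) \<subseteq> below (Suc (idx v))" using cand by blast
  show v: "v \<in> dvars (rlead v)" using deg dmin_pos[OF assms] degree_in_eq_0_iff[of "rlead v" v] by auto
  show "leader (rlead v) = v" using v dvars by (rule leader_eqI)
qed

lemma autoreduced_rlead: "autoreduced (rlead ` Lmin)"
  unfolding autoreduced_def
proof (intro conjI ballI impI)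
  fix f assume "f \<in> rlead ` Lmin"
  then show "dvars f \<noteq> {}" using rlead_leader(2) Lmin_L by blast
next
  fix f g assume "f \<in> rlead ` Lmin" "g \<in> rlead ` Lmin" "f \<noteq> g"
  then obtain \<alpha> \<beta> where \<alpha>: "\<alpha> \<in> Lmin" "f = rlead \<alpha>" and \<beta>: "\<beta> \<in> Lmin" "g = rlead \<beta>" and "\<alpha> \<noteq> \<beta>"
    by auto
  have L: "\<alpha> \<in> L" "\<beta> \<in> L" using \<alpha> \<beta> Lmin_L by auto
  have lead_g: "leader g = \<beta>" using \<beta> rlead_leader(3)[OF L(2)] by simp
  have "\<not> proper_derivative w \<beta>" if "w \<in> dvars f" for w
  proof
    assume "proper_derivative w \<beta>"
    then have w: "dvar_le \<beta> w" "w \<noteq> \<beta>" by (auto simp: proper_derivative_def)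
    then have "w \<noteq> \<alpha>" using \<alpha>(1) \<beta>(1) Lmin_antichain by (auto simp: dvar_antichain_def)
    then have "degree_in f w < 1"
      using rlead(2)[OF L(1)] dmin_proper[OF L(2) w] \<alpha>(2) by metis
    then show False using that by (simp add: degree_in_eq_0_iff)
  qed
  moreover have "degree_in f \<beta> < degree_in g \<beta>"
    using rlead(2)[OF L(1,2)] rlead_leader(1)[OF L(2)] \<open>\<alpha> \<noteq> \<beta>\<close> \<alpha>(2) \<beta>(2) by simp
  ultimately show "reduced_wrt f g" unfolding reduced_wrt_def lead_g by blast
qed

text \<open>At the first place where the two lists differ in rank, \<open>B\<close> would have an
  element that is reduced with respect to all of \<open>L\<close>; being in \<open>P\<close>, it
  would be zero.\<close>

lemma not_lower_rank_rlead:
  assumes B: "autoreduced B" "B \<subseteq> P"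
  shows "\<not> lower_rank_set B (rlead ` Lmin)"
proof
  assume "lower_rank_set B (rlead ` Lmin)"
  then obtain fs gs where fs: "set fs = B" "sorted_wrt lower_rank fs"
    and gs: "set gs = rlead ` Lmin" "sorted_wrt lower_rank gs" and lower: "lower_rank_list fs gs"
    unfolding lower_rank_set_def by blast
  \<comment> \<open>The two ways of being lower are merged; \<open>t = length gs\<close> is the case
    in which the list of \<open>B\<close> merely continues.\<close>
  from lower have "\<exists>t < length fs. t \<le> length gs \<and> (\<forall>s<t. same_rank (fs ! s) (gs ! s)) \<and>
      (t < length gs \<longrightarrow> lower_rank (fs ! t) (gs ! t))"
    unfolding lower_rank_list_def
  proof (elim disjE exE conjE)
    fix t assume "t < min (length fs) (length gs)" "\<forall>s<t. same_rank (fs ! s) (gs ! s)"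
      "lower_rank (fs ! t) (gs ! t)"
    then show ?thesis by (intro exI[of _ t]) simp
  next
    assume "length gs < length fs" "\<forall>s<length gs. same_rank (fs ! s) (gs ! s)"
    then show ?thesis by (intro exI[of _ "length gs"]) simp
  qed
  then obtain t where t: "t < length fs" "t \<le> length gs"
    and same: "\<And>s. s < t \<Longrightarrow> same_rank (fs ! s) (gs ! s)"
    and less: "t < length gs \<Longrightarrow> lower_rank (fs ! t) (gs ! t)"
    by blast
  define f where "f = fs ! t"
  have f_B: "f \<in> B" using t(1) fs(1) unfolding f_def by auto
  then have f_P: "f \<in> P" and f_ne: "dvars f \<noteq> {}" using B by (auto simp: autoreduced_def)
  have "degree_in f w < dmin w" if w: "w \<in> L" for w
  proof (rule ccontr)
    assume nless: "\<not> degree_in f w < dmin w"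
    then have w_f: "w \<in> dvars f" using dmin_pos[OF w] degree_in_eq_0_iff[of f w] by auto
    obtain \<alpha> where \<alpha>: "\<alpha> \<in> Lmin" "dvar_le \<alpha> w" using Lmin_below[OF w] by blast
    have \<alpha>_L: "\<alpha> \<in> L" using \<alpha> Lmin_L by blast
    have "rlead \<alpha> \<in> set gs" using gs(1) \<alpha>(1) by blast
    then obtain s where s: "s < length gs" "gs ! s = rlead \<alpha>" by (auto simp: in_set_conv_nth)
    show False
    proof (cases "s < t")
      case True
      \<comment> \<open>Here \<open>B\<close> contains an element of the same rank as
        \<open>rlead \<alpha>\<close>, with respect to which \<open>f\<close> is reduced.\<close>
      have lead: "leader (fs ! s) = \<alpha>" "degree_in (fs ! s) \<alpha> = dmin \<alpha>"
        using same[OF True] s(2) rlead_leader[OF \<alpha>_L] by (auto simp: same_rank_def)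
      have "lower_rank (fs ! s) f" using fs(2) True t(1) unfolding f_def by (rule sorted_wrt_nth_less)
      then have "f \<noteq> fs ! s" by (auto simp: lower_rank_def)
      moreover have "fs ! s \<in> B" using True t(1) fs(1) by auto
      ultimately have "reduced_wrt f (fs ! s)" using B(1) f_B by (auto simp: autoreduced_def)
      then have "\<not> proper_derivative w \<alpha>" "degree_in f \<alpha> < dmin \<alpha>"
        using w_f by (auto simp: reduced_wrt_def lead)
      then show False using \<alpha>(2) nless by (auto simp: proper_derivative_def)
    next
      case False
      then have t_gs: "t < length gs" using s(1) by simp
      then obtain \<beta> where \<beta>: "\<beta> \<in> Lmin" "gs ! t = rlead \<beta>"
        using gs(1) nth_mem[of t gs] by auto
      have \<beta>_L: "\<beta> \<in> L" using \<beta> Lmin_L by blast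
      have "\<beta> = \<alpha> \<or> ranking_less \<beta> \<alpha>"
      proof (cases "s = t")
        case True
        then have "rlead \<alpha> = rlead \<beta>" using s(2) \<beta>(2) by simp
        then show ?thesis using rlead_leader(3) \<alpha>_L \<beta>_L by metis
      next
        case neq: False
        have "lower_rank (gs ! t) (gs ! s)"
          using gs(2) _ s(1) by (rule sorted_wrt_nth_less) (use neq False in simp)
        then show ?thesis
          using s(2) \<beta>(2) rlead_leader(3) \<alpha>_L \<beta>_L by (auto simp: lower_rank_def)
      qed
      then have "idx \<beta> \<le> idx \<alpha>" using idx_strict_mono[of \<beta> \<alpha>] by auto
      moreover have low: "ranking_less (leader f) \<beta> \<or> leader f = \<beta> \<and> degree_in f \<beta> < dmin \<beta>"
        using less[OF t_gs] \<beta>(2) rlead_leader[OF \<beta>_L] by (auto simp: lower_rank_def f_def)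
      moreover have "idx w \<le> idx (leader f)"
        using leader_props(2)[OF f_ne] w_f by (auto simp: below_def)
      moreover have "idx \<alpha> \<le> idx w" using dvar_le_idx[OF \<alpha>(2)] .
      \<comment> \<open>In the ranking, \<beta>, \<alpha>, \<open>w\<close>, \<open>leader f\<close>
        and again \<beta> follow each other weakly, so all coincide, and \<open>f\<close> has degree
        less than \<open>dmin \<beta>\<close> in \<open>w\<close>.\<close>
      ultimately have "\<not> ranking_less (leader f) \<beta>" using idx_strict_mono[of "leader f" \<beta>] by linarith
      with low have lf: "leader f = \<beta>" "degree_in f \<beta> < dmin \<beta>" by auto
      with \<open>idx w \<le> idx (leader f)\<close> \<open>idx \<beta> \<le> idx \<alpha>\<close> \<open>idx \<alpha> \<le> idx w\<close> have "idx w = idx \<beta>" by simp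
      then have "w = \<beta>" by (simp add: idx_inj)
      with lf nless show False by simp
    qed
  qed
  then have "f = 0" using reduced_in_P[OF f_P] by (simp add: reduced_def)
  with f_ne show False by simp
qed

lemma characteristic_set_rlead: "characteristic_set P (rlead ` Lmin)"
  unfolding characteristic_set_def
  using autoreduced_rlead not_lower_rank_rlead rlead(1)[OF Lmin_L] by (auto simp: cand_def)

lemma dorder_rlead:
  assumes "v \<in> L"
  shows "dorder (rlead v) \<le> mdeg (fst v)"
proof -
  have "mdeg (fst w) \<le> mdeg (fst v)" if "w \<in> dvars (rlead v)" for w
    using rlead_leader(4)[OF assms] that mdeg_le_if_idx_le[of w v] by (auto simp: below_def)
  then show ?thesis unfolding dorder_def by (intro Max.boundedI) auto
qed

end

section \<open>The bound\<close>

text \<open>The operations of \<open>ring_of_type_algebra\<close> are those of the type, so the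
  locale axioms unfold to plain closure conditions.\<close>

lemma primeideal_type_algebra_iff:
  fixes P :: "'a::comm_ring_1 set"
  shows "primeideal P ring_of_type_algebra \<longleftrightarrow>
    is_ideal P \<and> 1 \<notin> P \<and> (\<forall>f g. f * g \<in> P \<longrightarrow> f \<in> P \<or> g \<in> P)"
proof
  let ?R = "ring_of_type_algebra :: 'a ring"
  assume "primeideal P ?R"
  then interpret primeideal P ?R .
  have "1 \<notin> P" using one_imp_carrier I_notcarr by (auto simp: ring_of_type_algebra_def)
  moreover have "is_ideal P"
    using additive_subgroup.zero_closed[OF additive_subgroup_axioms]
      additive_subgroup.a_closed[OF additive_subgroup_axioms] I_l_closed
    by (auto simp: is_ideal_def ring_of_type_algebra_def)
  moreover have "f * g \<in> P \<Longrightarrow> f \<in> P \<or> g \<in> P" for f g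
    using I_prime[of f g] by (simp add: ring_of_type_algebra_def)
  ultimately show "is_ideal P \<and> 1 \<notin> P \<and> (\<forall>f g. f * g \<in> P \<longrightarrow> f \<in> P \<or> g \<in> P)" by blast
next
  let ?R = "ring_of_type_algebra :: 'a ring"
  assume *: "is_ideal P \<and> 1 \<notin> P \<and> (\<forall>f g. f * g \<in> P \<longrightarrow> f \<in> P \<or> g \<in> P)"
  then have P: "is_ideal P" by blast
  interpret R: cring ?R by (rule cring_from_type_algebra)
  have minus: "\<ominus>\<^bsub>?R\<^esub> a = - a" for a
    by (rule R.minus_equality) (auto simp: ring_of_type_algebra_def)
  have "ideal P ?R"
  proof (rule idealI)
    show "ring ?R" by unfold_locales
    show "subgroup P (add_monoid ?R)"
    proof (rule R.add.subgroupI)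
      show "\<ominus>\<^bsub>?R\<^esub> a \<in> P" if "a \<in> P" for a using that is_ideal_uminus[OF P] by (simp add: minus)
    qed (use is_idealD[OF P] in \<open>auto simp: ring_of_type_algebra_def\<close>)
  qed (use is_idealD[OF P] in \<open>auto simp: ring_of_type_algebra_def\<close>)
  then show "primeideal P ?R"
    by (rule primeidealI) (use * R.cring_axioms in \<open>auto simp: ring_of_type_algebra_def\<close>)
qed

lemma dorder_le_iff: "dorder f \<le> r \<longleftrightarrow> dvars f \<subseteq> Gam r"
proof -
  have "finite ((\<lambda>v. mdeg (fst v)) ` dvars f)" by (simp add: dvars_def)
  then show ?thesis by (auto simp: dorder_def Gam_def)
qed

theorem proposition40:
  fixes \<delta> :: "'m::{finite,linorder} \<Rightarrow> 'k::field_char_0 \<Rightarrow> 'k"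
    and S P :: "('k, 'm, 'n::{finite,linorder}) dpoly set"
    and r :: nat
  assumes "differential_field \<delta>"
    and "\<forall>f\<in>S. dorder f \<le> r"
    and "minimal_prime_differential_ideal \<delta> S P"
  shows "\<exists>A. characteristic_set P A \<and> (\<forall>f\<in>A. dorder f \<le> C_num TYPE('m) TYPE('n) r)"
proof -
  have P: "prime_differential_ideal \<delta> P" "S \<subseteq> P"
    and minimal: "\<And>Q. prime_differential_ideal \<delta> Q \<Longrightarrow> S \<subseteq> Q \<Longrightarrow> Q \<subseteq> P \<Longrightarrow> Q = P"
    using assms(3) by (auto simp: minimal_prime_differential_ideal_def)
  interpret prime_dideal \<delta> P
    using assms(1) P(1)
    by unfold_locales (auto simp: prime_differential_ideal_def primeideal_type_algebra_iff)
  obtain as where as: "set as = Lmin" "antichain_seq as"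
    using antichain_seq_ex[OF Lmin_antichain] by blast
  \<comment> \<open>The antichain depends on \<open>P\<close>, and so does \<open>p\<close>; the
    maximum over all antichains removes this dependence at the end.\<close>
  define p where "p = D_num r as"
  interpret truncation \<delta> P as p
    using as(1) D_num_props(2) by unfold_locales (simp_all add: p_def)
  have "1 \<notin> Q" using Q_subset_P one_notin by blast
  then have "prime_differential_ideal \<delta> Q"
    using Q_ideal Q_prime Q_diff
    by (auto simp: prime_differential_ideal_def primeideal_type_algebra_iff)
  moreover have "S \<subseteq> Q"
  proof
    fix f assume f: "f \<in> S"
    have "dorder f \<le> p" using assms(2) f D_num_props(1)[of r as] by (auto simp: p_def)
    then have "f \<in> Pp" using f P(2) by (auto simp: Pp_def dorder_le_iff)
    then show "f \<in> Q" using Pp_subset_Q by blast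
  qed
  ultimately have "Q = P" using minimal Q_subset_P by blast
  then have "Lmin \<subseteq> Gam p" by (rule Lmin_subset_Gam_if_Q_eq_P)
  have "dorder (rlead \<alpha>) \<le> C_num TYPE('m) TYPE('n) r" if "\<alpha> \<in> Lmin" for \<alpha>
  proof -
    have "dorder (rlead \<alpha>) \<le> mdeg (fst \<alpha>)" using dorder_rlead[OF Lmin_L[OF that]] .
    also have "\<dots> \<le> p" using \<open>Lmin \<subseteq> Gam p\<close> that by (auto simp: Gam_def)
    also have "\<dots> \<le> C_num TYPE('m) TYPE('n) r"
      unfolding p_def by (rule D_num_le_C_num[OF as(2)])
    finally show ?thesis .
  qed
  then show ?thesis using characteristic_set_rlead by blast
qed

end
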